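(* Every hierarchically hyperbolic space admits a roughly geodesic metric in its quasi-isometry class that satisfies the strong shortcut property. That is, if $(X,\mathfrak S)$ is a hierarchically hyperbolic space with metric $d$, then there is a roughly geodesic metric $\sigma$ on $X$ such that $(X,\sigma)$ is quasi-isometric to $(X,d)$ and $(X,\sigma)$ is strongly shortcut.
   Context: A metric space $(X,\sigma)$ is roughly geodesic if there is $C\ge0$ such that any $a,b\in X$ are joined by a $(1,C)$-quasi-isometric embedding $f:[0,\sigma(a,b)]\to X$ with $f(0)=a$, $f(\sigma(a,b))=b$. A Riemannian circle $S$ is $S^1$ with a geodesic metric of some length $|S|$. A roughly geodesic metric space $(X,\sigma)$ is strongly shortcut if there exists $K>1$ such that for any $C>0$ there is a bound on the lengths $|S|$ of Riemannian circles $S$ admitting a $(K,C)$-quasi-isometric embedding $S\to X$ (i.e. a map $f$ with $\frac1Kd_S(s,s')-C\le\sigma(f(s),f(s'))\le Kd_S(s,s')+C$). Hierarchically hyperbolic space (HHS). A quasigeodesic metric space $(X,d)$ is an HHS, written $(X,\mathfrak S)$, if there are a constant $E\ge 1$, a set $\mathfrak S$ (of "domains"), and for each $U\in\mathfrak S$ a geodesic $E$-hyperbolic space $\mathcal CU$, with the following. Write $d_U(x,y)=d_{\mathcal CU}(\pi_U(x),\pi_U(y))$ for $x,y\in X$, and similarly for subsets of $X$ or $\mathcal CU$; distances between sets are infima. (1) Projections: for each $U$ there is an $E$-coarsely onto, $(E,E)$-coarsely Lipschitz map $\pi_U:X\to\mathcal CU$. (2) Nesting: $\mathfrak S$ has a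 partial order $\sqsubseteq$ with a unique maximal element (if $\mathfrak S\ne\emptyset$). If $U\sqsubsetneq V$ there are a nonempty set $\rho^U_V\subset\mathcal CV$ of diameter at most $E$ and a map $\rho^V_U:\mathcal CV\to\mathcal CU$. (3) Orthogonality: there is a symmetric, anti-reflexive relation $\bot$ on $\mathfrak S$; if $U\sqsubseteq V$ and $V\bot W$ then $U\bot W$; orthogonal domains are not $\sqsubseteq$-comparable; for each $T\in\mathfrak S$ and $U\sqsubseteq T$ such that some $V\sqsubseteq T$ has $V\bot U$, there is $W\sqsubsetneq T$ such that every $V\sqsubseteq T$ with $V\bot U$ satisfies $V\sqsubseteq W$. (4) Transversality and consistency: $U,V$ are transverse, $U\pitchfork V$, if they are neither orthogonal nor $\sqsubseteq$-comparable; then there are nonempty sets $\rho^U_V\subset\mathcal CV$, $\rho^V_U\subset\mathcal CU$ of diameter at most $E$ with $\min\{d_U(x,\rho^V_U),d_V(x,\rho^U_V)\}\le E$ for all $x\in X$. If $U\sqsubsetneq V$ then $\min\{d_V(x,\rho^U_V),\operatorname{diam}(\{\pi_U(x)\}\cup\rho^V_U(\pi_V(x)))\}\le E$ for all $x\in X$. If $U\sqsubseteq V$, then $d_W(\rho^U_W,\rho^V_W)\le E$ whenever $V\sqsubsetneq W$, or $V\pitchfork W$ and $W\not\perp U$. (5) Finite complexity: the cardinalities of sets of pairwise $\sqsubseteq$-comparable domains are at most $E$. (6) Large links: for $W\in\mathfrak S$ and $x,x'\in X$, put $N=E\,d_W(x,x')+E$. There are $T_1,\dots,T_{\lfloor N\rfloor}\sqsubsetneq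 W$ such that every $T\sqsubsetneq W$ satisfies $T\sqsubseteq T_i$ for some $i$ or $d_T(x,x')<E$; and $d_W(x,\rho^{T_i}_W)\le N$ for all $i$. (7) Bounded geodesic image: if $U\sqsubsetneq V$ and $\gamma\subset\mathcal CV$ is a geodesic with $d_V(\gamma,\rho^U_V)>E$, then $\operatorname{diam}\rho^V_U(\gamma)\le E$. (8) Partial realisation: if $\{U_i\}$ is a set of pairwise orthogonal domains and $p_i\in\mathcal CU_i$, there is $x\in X$ with $d_{U_i}(x,p_i)\le E$ for all $i$ and $d_V(x,\rho^{U_i}_V)\le E$ whenever $U_i\sqsubsetneq V$ or $U_i\pitchfork V$. (9) Uniqueness: for each $\kappa\ge0$ there is $\theta(\kappa)$ such that if $d(x,y)\ge\theta(\kappa)$ then $d_V(x,y)\ge\kappa$ for some $V\in\mathfrak S$. *)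

theory Defs
  imports "HOL-Analysis.Analysis"
begin

text \<open>
  A metric space is a carrier together with a distance function, as in the library
  locale \<^locale>\<open>Metric_space\<close>; real intervals carry the metric \<^const>\<open>dist\<close>.
\<close>

subsection \<open>Coarse geometry\<close>

definition qi_embedding ::
  "real \<Rightarrow> real \<Rightarrow> 'a set \<Rightarrow> ('a \<Rightarrow> 'a \<Rightarrow> real) \<Rightarrow> 'b set \<Rightarrow> ('b \<Rightarrow> 'b \<Rightarrow> real) \<Rightarrow> ('a \<Rightarrow> 'b) \<Rightarrow> bool"
  where
  "qi_embedding K C A dA B dB f \<longleftrightarrow>
     f \<in> A \<rightarrow> B \<and>
     (\<forall>s\<in>A. \<forall>t\<in>A. dA s t / K - C \<le> dB (f s) (f t) \<and> dB (f s) (f t) \<le> K * dA s t + C)"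

definition coarsely_onto :: "real \<Rightarrow> 'a set \<Rightarrow> 'b set \<Rightarrow> ('b \<Rightarrow> 'b \<Rightarrow> real) \<Rightarrow> ('a \<Rightarrow> 'b) \<Rightarrow> bool"
  where "coarsely_onto r A B dB f \<longleftrightarrow> (\<forall>p\<in>B. \<exists>x\<in>A. dB p (f x) \<le> r)"

definition quasi_isometric ::
  "'a set \<Rightarrow> ('a \<Rightarrow> 'a \<Rightarrow> real) \<Rightarrow> 'b set \<Rightarrow> ('b \<Rightarrow> 'b \<Rightarrow> real) \<Rightarrow> bool"
  where
  "quasi_isometric A dA B dB \<longleftrightarrow>
     (\<exists>K\<ge>1. \<exists>C\<ge>0. \<exists>f. qi_embedding K C A dA B dB f \<and> coarsely_onto C A B dB f)"

definition quasigeodesic_space :: "'a set \<Rightarrow> ('a \<Rightarrow> 'a \<Rightarrow> real) \<Rightarrow> bool"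
  where
  "quasigeodesic_space X d \<longleftrightarrow>
     (\<exists>K\<ge>1. \<exists>C\<ge>0. \<forall>a\<in>X. \<forall>b\<in>X. \<exists>T\<ge>0::real. \<exists>f.
        qi_embedding K C {0..T} dist X d f \<and> f 0 = a \<and> f T = b)"

definition roughly_geodesic :: "'a set \<Rightarrow> ('a \<Rightarrow> 'a \<Rightarrow> real) \<Rightarrow> bool"
  where
  "roughly_geodesic X d \<longleftrightarrow>
     (\<exists>C\<ge>0. \<forall>a\<in>X. \<forall>b\<in>X. \<exists>f.
        qi_embedding 1 C {0..d a b} dist X d f \<and> f 0 = a \<and> f (d a b) = b)"


subsection \<open>Geodesics and hyperbolicity\<close>

text \<open>The set \<open>\<gamma>\<close> is the image of a geodesic from \<open>a\<close> to \<open>b\<close>.\<close>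

definition geodesic_segment :: "'a set \<Rightarrow> ('a \<Rightarrow> 'a \<Rightarrow> real) \<Rightarrow> 'a \<Rightarrow> 'a \<Rightarrow> 'a set \<Rightarrow> bool"
  where
  "geodesic_segment X d a b \<gamma> \<longleftrightarrow>
     (\<exists>f. f \<in> {0..d a b} \<rightarrow> X \<and> f 0 = a \<and> f (d a b) = b \<and>
          (\<forall>s\<in>{0..d a b}. \<forall>t\<in>{0..d a b}. d (f s) (f t) = \<bar>s - t\<bar>) \<and>
          \<gamma> = f ` {0..d a b})"

definition geodesic_space :: "'a set \<Rightarrow> ('a \<Rightarrow> 'a \<Rightarrow> real) \<Rightarrow> bool"
  where "geodesic_space X d \<longleftrightarrow> (\<forall>a\<in>X. \<forall>b\<in>X. \<exists>\<gamma>. geodesic_segment X d a b \<gamma>)"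

text \<open>
  Hyperbolicity of a geodesic space is expressed by slim triangles: each side of a geodesic
  triangle lies in the closed \<open>\<delta>\<close>-neighbourhood of the union of the other two. It is enough to
  speak about one side, since the three vertices are arbitrary.
\<close>

definition hyperbolic :: "real \<Rightarrow> 'a set \<Rightarrow> ('a \<Rightarrow> 'a \<Rightarrow> real) \<Rightarrow> bool"
  where
  "hyperbolic \<delta> X d \<longleftrightarrow>
     (\<forall>a\<in>X. \<forall>b\<in>X. \<forall>c\<in>X. \<forall>\<alpha> \<beta> \<gamma>.
        geodesic_segment X d b c \<alpha> \<longrightarrow> geodesic_segment X d a c \<beta> \<longrightarrow>
        geodesic_segment X d a b \<gamma> \<longrightarrow>
        (\<forall>p\<in>\<alpha>. \<exists>q\<in>\<beta> \<union> \<gamma>. d p q \<le> \<delta>))"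


subsection \<open>Riemannian circles and the strong shortcut property\<close>

text \<open>
  Length of a curve parametrised by the unit interval: the supremum, over all partitions
  \<open>t 0 \<le> \<dots> \<le> t n\<close> of points of the interval, of the lengths of the inscribed polygons.
\<close>

definition curve_length :: "('a \<Rightarrow> 'a \<Rightarrow> real) \<Rightarrow> (real \<Rightarrow> 'a) \<Rightarrow> ereal"
  where
  "curve_length d c =
     (SUP (n, t) \<in> {(n::nat, t::nat \<Rightarrow> real). t \<in> {..n} \<rightarrow> {0..1} \<and> mono_on {..n} t}.
        ereal (\<Sum>i<n. d (c (t i)) (c (t (Suc i)))))"

text \<open>
  A Riemannian circle of length \<open>L\<close>: a geodesic metric on the topological space \<open>S\<^sup>1\<close>
  (so \<open>d\<close> induces the usual topology) for which the simple closed curve running once around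
  has length \<open>L\<close>.
\<close>

definition riemannian_circle :: "(complex \<Rightarrow> complex \<Rightarrow> real) \<Rightarrow> real \<Rightarrow> bool"
  where
  "riemannian_circle d L \<longleftrightarrow>
     Metric_space (sphere 0 1) d \<and>
     Metric_space.mtopology (sphere 0 1) d = top_of_set (sphere 0 1) \<and>
     geodesic_space (sphere 0 1) d \<and>
     curve_length d (\<lambda>t. cis (2 * pi * t)) = ereal L"

definition strongly_shortcut :: "'a set \<Rightarrow> ('a \<Rightarrow> 'a \<Rightarrow> real) \<Rightarrow> bool"
  where
  "strongly_shortcut X \<sigma> \<longleftrightarrow>
     roughly_geodesic X \<sigma> \<and>
     (\<exists>K>1. \<forall>C>0. \<exists>B. \<forall>d L f.
        riemannian_circle d L \<longrightarrow> qi_embedding K C (sphere 0 1) d X \<sigma> f \<longrightarrow> L \<le> B)"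


subsection \<open>Hierarchically hyperbolic spaces\<close>

text \<open>Only applied to nonempty \<open>A\<close> and \<open>B\<close>.\<close>

definition set_dist :: "('a \<Rightarrow> 'a \<Rightarrow> real) \<Rightarrow> 'a set \<Rightarrow> 'a set \<Rightarrow> real"
  where "set_dist d A B = (INF (a, b) \<in> A \<times> B. d a b)"

definition diam_le :: "('a \<Rightarrow> 'a \<Rightarrow> real) \<Rightarrow> 'a set \<Rightarrow> real \<Rightarrow> bool"
  where "diam_le d A r \<longleftrightarrow> (\<forall>p\<in>A. \<forall>q\<in>A. d p q \<le> r)"

text \<open>
  The hyperbolic space of the domain \<open>U\<close> has carrier \<open>\<C> U\<close> and metric \<open>dC U\<close>; all these
  carriers live in one type, but they need not be disjoint or related in any way.

  The notation \<open>\<rho>\<close> with lower and upper index is used in the literature for two different kinds of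
  object, which are separated here: \<open>\<rho> U V\<close> is the bounded subset of \<open>\<C> V\<close> given for
  \<open>U\<close> properly nested in or transverse to \<open>V\<close>, while \<open>\<rho>m V U\<close> is the map from \<open>\<C> V\<close> to
  \<open>\<C> U\<close> given for \<open>U\<close> properly nested in \<open>V\<close>.
\<close>

locale hierarchically_hyperbolic_space = Metric_space X d
  for X :: "'a set" and d :: "'a \<Rightarrow> 'a \<Rightarrow> real" +
  fixes E :: real
    and \<SS> :: "'u set"
    and \<C> :: "'u \<Rightarrow> 'c set"
    and dC :: "'u \<Rightarrow> 'c \<Rightarrow> 'c \<Rightarrow> real"
    and \<pi> :: "'u \<Rightarrow> 'a \<Rightarrow> 'c"
    and nest :: "'u \<Rightarrow> 'u \<Rightarrow> bool" (infix "\<sqsubseteq>" 50)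
    and orth :: "'u \<Rightarrow> 'u \<Rightarrow> bool" (infix "\<perp>" 50)
    and \<rho> :: "'u \<Rightarrow> 'u \<Rightarrow> 'c set"
    and \<rho>m :: "'u \<Rightarrow> 'u \<Rightarrow> 'c \<Rightarrow> 'c"
    and pnest :: "'u \<Rightarrow> 'u \<Rightarrow> bool" (infix "\<sqsubset>" 50)
    and transverse :: "'u \<Rightarrow> 'u \<Rightarrow> bool" (infix "\<pitchfork>" 50)
  defines pnest_def: "U \<sqsubset> V \<equiv> U \<sqsubseteq> V \<and> U \<noteq> V"
    and transverse_def: "U \<pitchfork> V \<equiv> \<not> U \<perp> V \<and> \<not> U \<sqsubseteq> V \<and> \<not> V \<sqsubseteq> U"
  assumes quasigeodesic: "quasigeodesic_space X d"
    and E_ge_1: "1 \<le> E"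
    and domain_metric: "U \<in> \<SS> \<Longrightarrow> Metric_space (\<C> U) (dC U)"
    and domain_geodesic: "U \<in> \<SS> \<Longrightarrow> geodesic_space (\<C> U) (dC U)"
    and domain_hyperbolic: "U \<in> \<SS> \<Longrightarrow> hyperbolic E (\<C> U) (dC U)"
    and proj_in: "U \<in> \<SS> \<Longrightarrow> \<pi> U \<in> X \<rightarrow> \<C> U"
    and proj_onto: "U \<in> \<SS> \<Longrightarrow> coarsely_onto E X (\<C> U) (dC U) (\<pi> U)"
    and proj_lipschitz:
      "\<lbrakk>U \<in> \<SS>; x \<in> X; y \<in> X\<rbrakk> \<Longrightarrow> dC U (\<pi> U x) (\<pi> U y) \<le> E * d x y + E"
    and nest_refl: "reflp_on \<SS> (\<sqsubseteq>)"
    and nest_antisym: "antisymp_on \<SS> (\<sqsubseteq>)"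
    and nest_trans: "transp_on \<SS> (\<sqsubseteq>)"
    and nest_maximal: "\<SS> \<noteq> {} \<Longrightarrow> \<exists>!M. M \<in> \<SS> \<and> (\<forall>V\<in>\<SS>. M \<sqsubseteq> V \<longrightarrow> V = M)"
    and rho_nest:
      "\<lbrakk>U \<in> \<SS>; V \<in> \<SS>; U \<sqsubset> V\<rbrakk> \<Longrightarrow> \<rho> U V \<noteq> {} \<and> \<rho> U V \<subseteq> \<C> V \<and> diam_le (dC V) (\<rho> U V) E"
    and rho_map: "\<lbrakk>U \<in> \<SS>; V \<in> \<SS>; U \<sqsubset> V\<rbrakk> \<Longrightarrow> \<rho>m V U \<in> \<C> V \<rightarrow> \<C> U"
    and orth_sym: "symp_on \<SS> (\<perp>)"
    and orth_irrefl: "irreflp_on \<SS> (\<perp>)"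
    and orth_nest: "\<lbrakk>U \<in> \<SS>; V \<in> \<SS>; W \<in> \<SS>; U \<sqsubseteq> V; V \<perp> W\<rbrakk> \<Longrightarrow> U \<perp> W"
    and orth_not_comparable: "\<lbrakk>U \<in> \<SS>; V \<in> \<SS>; U \<perp> V\<rbrakk> \<Longrightarrow> \<not> U \<sqsubseteq> V \<and> \<not> V \<sqsubseteq> U"
    and containers:
      "\<lbrakk>T \<in> \<SS>; U \<in> \<SS>; U \<sqsubseteq> T; \<exists>V\<in>\<SS>. V \<sqsubseteq> T \<and> V \<perp> U\<rbrakk>
       \<Longrightarrow> \<exists>W\<in>\<SS>. W \<sqsubset> T \<and> (\<forall>V\<in>\<SS>. V \<sqsubseteq> T \<and> V \<perp> U \<longrightarrow> V \<sqsubseteq> W)"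
    and rho_transverse:
      "\<lbrakk>U \<in> \<SS>; V \<in> \<SS>; U \<pitchfork> V\<rbrakk> \<Longrightarrow> \<rho> U V \<noteq> {} \<and> \<rho> U V \<subseteq> \<C> V \<and> diam_le (dC V) (\<rho> U V) E"
    and consistency_transverse:
      "\<lbrakk>U \<in> \<SS>; V \<in> \<SS>; U \<pitchfork> V; x \<in> X\<rbrakk>
       \<Longrightarrow> min (set_dist (dC U) {\<pi> U x} (\<rho> V U)) (set_dist (dC V) {\<pi> V x} (\<rho> U V)) \<le> E"
    and consistency_nest:
      "\<lbrakk>U \<in> \<SS>; V \<in> \<SS>; U \<sqsubset> V; x \<in> X\<rbrakk>
       \<Longrightarrow> set_dist (dC V) {\<pi> V x} (\<rho> U V) \<le> E \<or> diam_le (dC U) {\<pi> U x, \<rho>m V U (\<pi> V x)} E"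
    and rho_consistency:
      "\<lbrakk>U \<in> \<SS>; V \<in> \<SS>; W \<in> \<SS>; U \<sqsubseteq> V; V \<sqsubset> W \<or> (V \<pitchfork> W \<and> \<not> W \<perp> U)\<rbrakk>
       \<Longrightarrow> set_dist (dC W) (\<rho> U W) (\<rho> V W) \<le> E"
    and finite_complexity:
      "\<lbrakk>\<A> \<subseteq> \<SS>; pairwise (\<lambda>U V. U \<sqsubseteq> V \<or> V \<sqsubseteq> U) \<A>\<rbrakk> \<Longrightarrow> finite \<A> \<and> real (card \<A>) \<le> E"
    \<comment> \<open>at most \<open>\<lfloor>N\<rfloor>\<close> domains are required rather than exactly \<open>\<lfloor>N\<rfloor>\<close>, since a
        \<open>\<sqsubseteq>\<close>-minimal \<open>W\<close> has no properly nested domains although \<open>\<lfloor>N\<rfloor> \<ge> 1\<close>\<close>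
    and large_links:
      "\<lbrakk>W \<in> \<SS>; x \<in> X; x' \<in> X; N = E * dC W (\<pi> W x) (\<pi> W x') + E\<rbrakk>
       \<Longrightarrow> \<exists>\<T>. \<T> \<subseteq> {T \<in> \<SS>. T \<sqsubset> W} \<and> finite \<T> \<and> int (card \<T>) \<le> \<lfloor>N\<rfloor> \<and>
             (\<forall>T\<in>\<SS>. T \<sqsubset> W \<longrightarrow> (\<exists>T'\<in>\<T>. T \<sqsubseteq> T') \<or> dC T (\<pi> T x) (\<pi> T x') < E) \<and>
             (\<forall>T\<in>\<T>. set_dist (dC W) {\<pi> W x} (\<rho> T W) \<le> N)"
    and bounded_geodesic_image:
      "\<lbrakk>U \<in> \<SS>; V \<in> \<SS>; U \<sqsubset> V; p \<in> \<C> V; q \<in> \<C> V; geodesic_segment (\<C> V) (dC V) p q \<gamma>;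
        set_dist (dC V) \<gamma> (\<rho> U V) > E\<rbrakk>
       \<Longrightarrow> diam_le (dC U) (\<rho>m V U ` \<gamma>) E"
    and partial_realisation:
      "\<lbrakk>\<U> \<subseteq> \<SS>; pairwise (\<perp>) \<U>; \<And>U. U \<in> \<U> \<Longrightarrow> c U \<in> \<C> U\<rbrakk>
       \<Longrightarrow> \<exists>x\<in>X. \<forall>U\<in>\<U>. dC U (\<pi> U x) (c U) \<le> E \<and>
             (\<forall>V\<in>\<SS>. U \<sqsubset> V \<or> U \<pitchfork> V \<longrightarrow> set_dist (dC V) {\<pi> V x} (\<rho> U V) \<le> E)"
    and uniqueness:
      "0 \<le> \<kappa> \<Longrightarrow> \<exists>\<theta>. \<forall>x\<in>X. \<forall>y\<in>X. \<theta> \<le> d x y \<longrightarrow> (\<exists>V\<in>\<SS>. \<kappa> \<le> dC V (\<pi> V x) (\<pi> V y))"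

end

theory Submission
  imports Defs
begin

text \<open>
  A wall is a pair of subsets of \<open>X\<close> that are separated by a definite gap in the four-point sums of
  a single domain; a chain is a nested sequence of walls, and \<open>n x y\<close> is the length of a longest
  chain separating \<open>x\<close> from \<open>y\<close>.

  Walls that cross lie in orthogonal domains, and at most \<open>E\<close> domains are pairwise orthogonal. But if
  a large circle were mapped to \<open>X\<close> almost isometrically for \<open>n\<close>, then the middle walls of longest
  chains joining more than \<open>E\<close> evenly spaced pairs of antipodal points would pairwise cross.

  Moreover \<open>n\<close> is almost geodesic. Given \<open>R\<close>, stop on each geodesic from \<open>\<pi> U x\<close> to \<open>\<pi> U y\<close> as soon
  as some chain of \<open>R\<close> walls starting at \<open>x\<close> precedes everything that projects further along. The
  stopping points form a consistent tuple, and a point \<open>z\<close> realising it satisfies \<open>n x z \<le> R\<close> and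
  \<open>n z y \<le> n x y - R + 1\<close>. So the metric \<open>\<sigma>\<close> that counts steps of \<open>n\<close>-length at most \<open>R\<close> is
  roughly geodesic and lies between \<open>n / (R + 1)\<close> and \<open>(n + R) / (R - 1)\<close>. For large \<open>R\<close> the
  distortion is absorbed by the strong shortcut constant, and since steps have bounded \<open>d\<close>-length by
  the uniqueness axiom, \<open>\<sigma>\<close> is quasi-isometric to \<open>d\<close>.
\<close>

subsection \<open>Riemannian circles\<close>

text \<open>The strong shortcut constant has to be close to 1, whereas \<open>d\<close> is
  controlled only up to multiplicative constants. This is why everything passes through
  \<open>n\<close>, whose triangle inequality and intermediate points fail by an additive 1 only;
  steps of length \<open>R\<close> turn that 1 into a factor as close to 1 as the number of
  antipodal pairs requires. The error is 1 because a point lies in the gap of at most one wall of a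
  chain: cutting a chain at a point loses a single wall, however large the gap \<open>M\<close> is
  compared with \<open>E\<close>.

  The obstacle to intermediate points is that one stopping rule has to act in all domains at once.
  It is therefore a property of subsets of \<open>X\<close>, inherited by smaller subsets and
  without reference to a domain. Consistency of the stopping points then reduces to inclusions
  between half-spaces of different domains, which follow from the consistency and bounded geodesic
  image axioms. Realising the tuple costs a constant depending on \<open>E\<close> only, and
  \<open>M\<close> is chosen larger than that.\<close>

abbreviation unit_circle :: "real \<Rightarrow> complex"
  where "unit_circle t \<equiv> cis (2 * pi * t)"

lemma unit_circle_shift: "unit_circle (t + 1) = unit_circle t"
  by (simp add: distrib_left cis_mult flip: cis_2pi)
     (metis cis_2pi cis_mult mult.right_neutral)

text \<open>If each of the two arcs contained a point outside \<open>G\<close>, these points would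
  cut the circle into two pieces, each with one of the two given points of \<open>G\<close>. The
  proof unrolls the circle at the first missing point and uses connectedness on the line.\<close>

lemma connected_subset_circle_contains_arc:
  assumes G: "connected G" "G \<subseteq> sphere 0 1" "unit_circle s \<in> G" "unit_circle t \<in> G"
    and st: "s \<le> t" "t \<le> s + 1"
  shows "unit_circle ` {s..t} \<subseteq> G \<or> unit_circle ` {t..s+1} \<subseteq> G"
proof (rule ccontr)
  assume "\<not> ?thesis"
  then obtain u v where u: "u \<in> {s..t}" "unit_circle u \<notin> G"
    and v: "v \<in> {t..s+1}" "unit_circle v \<notin> G" by blast
  have s1: "unit_circle (s + 1) \<in> G" using G(3) unit_circle_shift[of s] by simp
  have us: "s < u" "u < t" using u G by (auto simp: less_le)
  have vs: "t < v" "v < s + 1" using v G s1 by (auto simp: less_le)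
  \<comment> \<open>The inverse of \<open>unit_circle\<close> on the open interval from
    \<open>u\<close> to \<open>u + 1\<close>: the rotation takes the missing point
    \<open>unit_circle u\<close> to \<open>-1\<close>, so that the cut of \<open>Arg\<close> avoids
    \<open>G\<close>.\<close>
  define \<phi> where "\<phi> w = Arg (w * cis (- (2 * pi * (u + 1/2)))) / (2 * pi) + u + 1/2" for w
  have \<phi>: "\<phi> (unit_circle r) = r" if "u < r" "r < u + 1" for r
  proof -
    have eq: "unit_circle r * cis (- (2 * pi * (u + 1/2))) = cis (2 * pi * (r - u - 1/2))"
      by (simp add: cis_mult algebra_simps)
    have "2 * pi * (r - u - 1/2) < 2 * pi * (1/2)" "2 * pi * (-1/2) < 2 * pi * (r - u - 1/2)"
      by (intro mult_strict_left_mono; use that in simp)+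
    then have "Arg (cis (2 * pi * (r - u - 1/2))) = 2 * pi * (r - u - 1/2)"
      by (intro Arg_cis) auto
    then show ?thesis unfolding \<phi>_def eq by (simp add: field_simps)
  qed
  have range: "\<exists>r. u < r \<and> r < u + 1 \<and> w = unit_circle r" if "w \<in> G" for w
  proof -
    have "norm w = 1" using that G by auto
    then obtain x where x: "w = cis x" by (metis complex_norm_eq_1_exp cis_conv_exp mult.commute)
    define r where "r = x / (2 * pi) - of_int \<lfloor>x / (2 * pi) - u\<rfloor>"
    have "u \<le> r" "r < u + 1" unfolding r_def by linarith+
    have "w = unit_circle r"
    proof -
      have "2 * pi * r = x - 2 * pi * of_int \<lfloor>x / (2 * pi) - u\<rfloor>"
        unfolding r_def by (simp add: field_simps)
      then have "unit_circle r = cis x / cis (2 * pi * of_int \<lfloor>x / (2 * pi) - u\<rfloor>)"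
        by (simp only: cis_divide)
      also have "cis (2 * pi * of_int \<lfloor>x / (2 * pi) - u\<rfloor>) = 1" 
        by (rule cis_multiple_2pi) simp
      finally show ?thesis using x by simp
    qed
    moreover have "r \<noteq> u" using calculation u that by auto
    ultimately show ?thesis using \<open>u \<le> r\<close> \<open>r < u + 1\<close> by (intro exI[of _ r]) auto
  qed
  have "continuous_on G \<phi>" unfolding \<phi>_def
  proof (intro continuous_intros)
    fix w assume "w \<in> G"
    then obtain r where r: "u < r" "r < u + 1" "w = unit_circle r" using range by blast
    have eq: "w * cis (- (2 * pi * (u + 1/2))) = cis (2 * pi * (r - u - 1/2))"
      using r by (simp add: cis_mult algebra_simps)
    have "2 * pi * (r - u - 1/2) < 2 * pi * (1/2)" "2 * pi * (-1/2) < 2 * pi * (r - u - 1/2)"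
      by (intro mult_strict_left_mono; use r in simp)+
    then have "Arg (cis (2 * pi * (r - u - 1/2))) < pi"
      by (subst Arg_cis) auto
    moreover have "Arg z = pi" if "z \<in> \<real>\<^sub>\<le>\<^sub>0" "z \<noteq> 0" for z
      using that by (auto elim!: nonpos_Reals_cases simp: Arg_of_real)
    ultimately show "w * cis (- (2 * pi * (u + 1/2))) \<notin> \<real>\<^sub>\<le>\<^sub>0"
      unfolding eq using cis_neq_zero by (metis less_irrefl)
  qed auto
  then have conn: "connected (\<phi> ` G)" by (rule connected_continuous_image[OF _ G(1)])
  have "t \<in> \<phi> ` G" using G(4) \<phi>[of t] us vs by (metis imageI less_trans add.commute add_less_cancel_right)
  moreover have "s + 1 \<in> \<phi> ` G" using s1 \<phi>[of "s+1"] us vs by (metis imageI less_trans add_less_cancel_right)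
  ultimately have "v \<in> \<phi> ` G"
    using conn vs by (meson connectedD_interval less_imp_le)
  then obtain w where "w \<in> G" "v = \<phi> w" by blast
  with range[of w] \<phi> have "w = unit_circle v" by auto
  then show False using v \<open>w \<in> G\<close> by simp
qed

lemma geodesic_segmentE:
  assumes "geodesic_segment X d a b \<gamma>"
  obtains f where "f \<in> {0..d a b} \<rightarrow> X" "f 0 = a" "f (d a b) = b"
    "\<And>s t. s \<in> {0..d a b} \<Longrightarrow> t \<in> {0..d a b} \<Longrightarrow> d (f s) (f t) = \<bar>s - t\<bar>"
    "\<gamma> = f ` {0..d a b}"
  using assms unfolding geodesic_segment_def by blast

lemma (in Metric_space) geodesic_segment_isometry:
  assumes "geodesic_segment M d a b \<gamma>" "p \<in> \<gamma>" "q \<in> \<gamma>"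
  shows "d p q = \<bar>d a p - d a q\<bar>" "d a p + d p b = d a b" "p \<in> M"
proof -
  obtain f where f: "f \<in> {0..d a b} \<rightarrow> M" "f 0 = a" "f (d a b) = b"
    "\<And>s t. s \<in> {0..d a b} \<Longrightarrow> t \<in> {0..d a b} \<Longrightarrow> d (f s) (f t) = \<bar>s - t\<bar>"
    "\<gamma> = f ` {0..d a b}"
    by (rule geodesic_segmentE[OF assms(1)]) (rule that)
  obtain s where s: "s \<in> {0..d a b}" "p = f s" using assms f by auto
  obtain t where t: "t \<in> {0..d a b}" "q = f t" using assms f by auto
  have "d a p = s" "d a q = t" "d p b = d a b - s" "d p q = \<bar>s - t\<bar>"
    using f(2,3) f(4)[of 0 s] f(4)[of 0 t] f(4)[of s "d a b"] f(4)[of s t] s t by auto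
  then show "d p q = \<bar>d a p - d a q\<bar>" "d a p + d p b = d a b" by auto
  show "p \<in> M" using f(1) s by auto
qed

section \<open>Arc length on a circle with a geodesic metric\<close>

locale geodesic_circle = Metric_space "sphere (0::complex) 1" d for d +
  assumes top: "mtopology = top_of_set (sphere 0 1)"
    and geod: "geodesic_space (sphere 0 1) d"
begin

abbreviation "e \<equiv> unit_circle"

lemma e_in [simp]: "cis x \<in> sphere 0 1" by simp

lemma continuous_dist_circle:
  fixes f g :: "real \<Rightarrow> real"
  assumes "continuous_on A f" "continuous_on A g"
  shows "continuous_on A (\<lambda>t. d (e (f t)) (e (g t)))"
proof -
  have c: "continuous_map (top_of_set A) mtopology (\<lambda>t. e (h t))" if "continuous_on A h" for h
    unfolding top by (auto simp: continuous_map_in_subtopology intro!: continuous_intros that)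
  have "continuous_map (top_of_set A) euclideanreal (\<lambda>t. d (e (f t)) (e (g t)))"
    using continuous_map_mdist[of _ "metric (sphere 0 1, d)", simplified mtopology_of mdist_metric]
      c[OF assms(1)] c[OF assms(2)] by blast
  then show ?thesis by simp
qed

text \<open>A geodesic is continuous for \<open>mtopology\<close>, which is the usual topology of
  the circle, so its image is a connected subset of the circle.\<close>

lemma geodesic_contains_arc:
  assumes "s \<le> t" "t \<le> s + 1"
  obtains \<gamma> where "geodesic_segment (sphere 0 1) d (e s) (e t) \<gamma>"
    "e ` {s..t} \<subseteq> \<gamma> \<or> e ` {t..s+1} \<subseteq> \<gamma>"
proof -
  obtain \<gamma> where \<gamma>: "geodesic_segment (sphere 0 1) d (e s) (e t) \<gamma>"
    using geod unfolding geodesic_space_def by (meson e_in)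
  obtain f where f: "f \<in> {0..d (e s) (e t)} \<rightarrow> sphere 0 1" "f 0 = e s" "f (d (e s) (e t)) = e t"
    "\<And>u v. u \<in> {0..d (e s) (e t)} \<Longrightarrow> v \<in> {0..d (e s) (e t)} \<Longrightarrow> d (f u) (f v) = \<bar>u - v\<bar>"
    "\<gamma> = f ` {0..d (e s) (e t)}"
    by (rule geodesic_segmentE[OF \<gamma>]) (rule that)
  have "continuous_map (top_of_set {0..d (e s) (e t)}) mtopology f"
    unfolding continuous_map_to_metric
  proof (intro ballI allI impI)
    fix x \<epsilon> :: real assume x: "x \<in> topspace (top_of_set {0..d (e s) (e t)})" "0 < \<epsilon>"
    show "\<exists>U. openin (top_of_set {0..d (e s) (e t)}) U \<and> x \<in> U \<and> (\<forall>y\<in>U. f y \<in> mball (f x) \<epsilon>)"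
    proof (intro exI conjI ballI)
      show "openin (top_of_set {0..d (e s) (e t)}) ({0..d (e s) (e t)} \<inter> ball x \<epsilon>)" by auto
      fix y assume y: "y \<in> {0..d (e s) (e t)} \<inter> ball x \<epsilon>"
      have "f y \<in> sphere 0 1" "f x \<in> sphere 0 1" using f(1) x y by (auto simp: Pi_iff)
      moreover have "d (f x) (f y) < \<epsilon>" using f(4)[of x y] x y by (auto simp: dist_real_def)
      ultimately show "f y \<in> mball (f x) \<epsilon>" by (auto simp: in_mball)
    qed (use x in auto)
  qed
  then have "continuous_on {0..d (e s) (e t)} f"
    unfolding top by (simp add: continuous_map_in_subtopology)
  then have conn: "connected \<gamma>" unfolding f(5) by (rule connected_continuous_image) simp
  have "0 \<le> d (e s) (e t)" by simp
  then have mem: "e s \<in> \<gamma>" "e t \<in> \<gamma>" using f(2,3,5) by (metis atLeastAtMost_iff image_eqI order_refl)+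
  have "\<gamma> \<subseteq> sphere 0 1" using f(1,5) by auto
  then show thesis
    using that[OF \<gamma>] connected_subset_circle_contains_arc[OF conn _ mem assms] by blast
qed

definition D :: "real \<Rightarrow> real" where "D t = d (e 0) (e t)"

text \<open>Points of one geodesic issuing from \<open>e 0\<close> are at distance
  \<open>\<bar>D s - D t\<bar>\<close>. The absolute value avoids fixing the direction in which
  \<open>D\<close> grows.\<close>

definition isometric_arc :: "real \<Rightarrow> real \<Rightarrow> bool"
  where "isometric_arc a b \<longleftrightarrow> (\<forall>s\<in>{a..b}. \<forall>t\<in>{a..b}. d (e s) (e t) = \<bar>D s - D t\<bar>)"

lemma e_1: "e 1 = e 0" using unit_circle_shift[of 0] by simp

lemma D_cont: "continuous_on A D"
  unfolding D_def by (rule continuous_dist_circle) (auto intro: continuous_intros)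

lemma isometric_arc_cover: "t \<in> {0..1} \<Longrightarrow> isometric_arc 0 t \<or> isometric_arc t 1"
proof -
  assume t: "t \<in> {0..1}"
  obtain \<gamma> where \<gamma>: "geodesic_segment (sphere 0 1) d (e 0) (e t) \<gamma>"
    "e ` {0..t} \<subseteq> \<gamma> \<or> e ` {t..0+1} \<subseteq> \<gamma>"
    using geodesic_contains_arc[of 0 t] t by auto
  show ?thesis
    using \<gamma>(2) geodesic_segment_isometry(1)[OF \<gamma>(1)] unfolding isometric_arc_def D_def 
    by (auto simp: image_subset_iff)
qed

lemma e_inj: "e s = e t \<Longrightarrow> \<bar>s - t\<bar> < 1 \<Longrightarrow> s = t"
proof -
  assume a: "e s = e t" "\<bar>s - t\<bar> < 1"
  have "sin (2 * pi * s) = sin (2 * pi * t) \<and> cos (2 * pi * s) = cos (2 * pi * t)"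
    using a(1) by (simp add: complex_eq_iff)
  then obtain n where "2 * pi * s = 2 * pi * t + 2 * pi * real_of_int n"
    unfolding sin_cos_eq_iff by blast
  then have "2 * pi * s = 2 * pi * (t + real_of_int n)" by (simp only: distrib_left)
  then have n: "s = t + real_of_int n" by simp
  then have "\<bar>real_of_int n\<bar> < 1" using a(2) by simp
  then have "n = 0" by linarith
  then show ?thesis using n by simp
qed

lemma isometric_arc_inj: "isometric_arc a b \<Longrightarrow> b - a < 1 \<Longrightarrow> inj_on D {a..b}"
proof (rule inj_onI)
  fix s t assume *: "isometric_arc a b" "b - a < 1" "s \<in> {a..b}" "t \<in> {a..b}" "D s = D t"
  then have "d (e s) (e t) = 0" unfolding isometric_arc_def by auto
  then have "e s = e t" by simp
  then show "s = t" by (rule e_inj) (use * in auto)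
qed

lemma D_0: "D 0 = 0" "D 1 = 0" "0 \<le> D t"
  unfolding D_def using e_1 by auto

text \<open>On such an arc \<open>D\<close> is continuous and injective, hence strictly monotone,
  and it increases because it has its minimum 0 at \<open>e 0\<close>. The bound
  \<open>b < 1\<close> keeps the arc from closing up at \<open>e 1 = e 0\<close>.\<close>

lemma isometric_arc_left_mono:
  assumes "isometric_arc 0 b" "b < 1" "0 \<le> s" "s < t" "t \<le> b"
  shows "D s < D t"
proof (cases "s = 0")
  case True
  have "D t \<noteq> D 0" using inj_onD[OF isometric_arc_inj[OF assms(1)], of t 0] assms by auto
  then show ?thesis using True D_0 by (metis order_le_imp_less_or_eq)
next
  case False
  have "inj_on D {0..t}" by (rule inj_on_subset[OF isometric_arc_inj[OF assms(1)]]) (use assms in auto)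
  from continuous_inj_imp_mono[OF _ assms(4) D_cont this] False assms(3) 
  show ?thesis using D_0(1) D_0(3)[of s] by force
qed

lemma isometric_arc_right_mono:
  assumes "isometric_arc a 1" "0 < a" "a \<le> s" "s < t" "t \<le> 1"
  shows "D t < D s"
proof (cases "t = 1")
  case True
  have "D s \<noteq> D 1" using inj_onD[OF isometric_arc_inj[OF assms(1)], of s 1] assms by auto
  then show ?thesis using True D_0 by (metis order_le_imp_less_or_eq)
next
  case False
  have "inj_on D {s..1}" by (rule inj_on_subset[OF isometric_arc_inj[OF assms(1)]]) (use assms in auto)
  from continuous_inj_imp_mono[OF assms(4) _ D_cont this] False assms(5)
  show ?thesis using D_0(2) D_0(3)[of t] by force
qed

text \<open>
  Every \<open>t\<close> bounds an isometric arc on its left or on its right, by \<open>isometric_arc_cover\<close>; as \<open>[0,1]\<close> is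
  connected, some \<open>m\<close> does so on both sides.
\<close>

lemma antipode: "\<exists>m. 0 < m \<and> m < 1 \<and> isometric_arc 0 m \<and> isometric_arc m 1"
proof -
  define S1 where "S1 = {t\<in>{0..1::real}. isometric_arc 0 t}"
  define S2 where "S2 = {t\<in>{0..1::real}. isometric_arc t 1}"
  \<comment> \<open>Writing the points of the arc as \<open>t * u\<close> with \<open>u\<close>
    between 0 and 1 makes the range of the quantifiers independent of \<open>t\<close>; so
    \<open>S1\<close> is an intersection of closed sets.\<close>
  have eq1: "S1 = {0..1} \<inter> (\<Inter>u\<in>{0..1}. \<Inter>v\<in>{0..1}. {t. d (e (t * u)) (e (t * v)) = \<bar>D (t * u) - D (t * v)\<bar>})"
  proof -
    have "isometric_arc 0 t \<longleftrightarrow> (\<forall>u\<in>{0..1}. \<forall>v\<in>{0..1}. d (e (t * u)) (e (t * v)) = \<bar>D (t * u) - D (t * v)\<bar>)"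
      if "t \<in> {0..1}" for t
    proof -
      have "{0..t} = (\<lambda>u. t * u) ` {0..1}"
        using that by (simp add: image_mult_atLeastAtMost_if)
      then show ?thesis unfolding isometric_arc_def by auto
    qed
    then show ?thesis unfolding S1_def by auto
  qed
  have eq2: "S2 = {0..1} \<inter> (\<Inter>u\<in>{0..1}. \<Inter>v\<in>{0..1}. 
     {t. d (e (1 - (1-t) * u)) (e (1 - (1-t) * v)) = \<bar>D (1 - (1-t) * u) - D (1 - (1-t) * v)\<bar>})"
  proof -
    have "isometric_arc t 1 \<longleftrightarrow> (\<forall>u\<in>{0..1}. \<forall>v\<in>{0..1}. 
        d (e (1 - (1-t) * u)) (e (1 - (1-t) * v)) = \<bar>D (1 - (1-t) * u) - D (1 - (1-t) * v)\<bar>)"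
      if "t \<in> {0..1}" for t
    proof -
      have "{0..1-t} = (\<lambda>u. (1-t) * u) ` {0..1}"
        using that by (simp add: image_mult_atLeastAtMost_if)
      moreover have "{t..1} = (\<lambda>x. 1 - x) ` {0..1-t}" by simp
      ultimately have "{t..1} = (\<lambda>u. 1 - (1-t) * u) ` {0..1}" by (simp only: image_image)
      then show ?thesis unfolding isometric_arc_def by (simp only: ball_simps)
    qed
    then show ?thesis unfolding S2_def by auto
  qed
  have D': "continuous_on UNIV (\<lambda>t. D (f t))" if "continuous_on UNIV f" for f :: "real \<Rightarrow> real"
    unfolding D_def by (rule continuous_dist_circle[of _ "\<lambda>_. 0"]) (auto intro: continuous_intros that)
  have "closed S1" unfolding eq1
    by (intro closed_Int closed_INT ballI closed_Collect_eq continuous_dist_circle 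
        continuous_intros D')
  moreover have "closed S2" unfolding eq2
    by (intro closed_Int closed_INT ballI closed_Collect_eq continuous_dist_circle 
        continuous_intros D')
  moreover have "{0..1} \<subseteq> S1 \<union> S2" 
    using isometric_arc_cover unfolding S1_def S2_def by blast
  moreover have "0 \<in> S1" "1 \<in> S2" unfolding S1_def S2_def isometric_arc_def by auto
  ultimately have "S1 \<inter> S2 \<inter> {0..1} \<noteq> {}"
    using connected_Icc[of 0 "1::real"] unfolding connected_closed
    by (metis Int_iff atLeastAtMost_iff empty_iff order_refl zero_le_one)
  then obtain m where m: "m \<in> {0..1}" "isometric_arc 0 m" "isometric_arc m 1" unfolding S1_def S2_def by auto
  \<comment> \<open>The connectedness argument could return \<open>m = 0\<close> or
    \<open>m = 1\<close>. Then the whole circle would be an isometric arc, along which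
    \<open>D\<close> increases up to \<open>t = 1\<close> although \<open>D 1 = 0\<close>.\<close>
  have lt: False if "isometric_arc 0 1"
  proof -
    have "((\<lambda>t. D t - D (1/2)) \<longlongrightarrow> D 1 - D (1/2)) (at 1 within {1/2..1})"
      using D_cont[of "{1/2..1}"] unfolding continuous_on_def by (intro tendsto_intros) auto
    moreover have "eventually (\<lambda>t. 0 \<le> D t - D (1/2)) (at 1 within {1/2..1})"
      unfolding eventually_at_topological
    proof (intro exI conjI ballI impI)
      fix t :: real assume t: "t \<in> UNIV" "t \<noteq> 1" "t \<in> {1/2..1}"
      have "isometric_arc 0 t" using that t unfolding isometric_arc_def by auto
      moreover have "t = 1/2 \<or> 1/2 < t" using t by auto
      moreover have "t < 1" using t by auto
      ultimately have "t = 1/2 \<or> D (1/2) < D t" using isometric_arc_left_mono[of t "1/2" t] by auto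
      then show "0 \<le> D t - D (1/2)"
      proof
        assume "t = 1/2"
        then show ?thesis by (simp only: diff_self order_refl)
      qed simp
    qed auto
    moreover have "at 1 within {1/2..1::real} \<noteq> bot" by (simp add: at_within_Icc_at_left)
    ultimately have "0 \<le> D 1 - D (1/2)" by (rule tendsto_lowerbound)
    moreover have "isometric_arc 0 (1/2)" using that unfolding isometric_arc_def by auto
    then have "D 0 < D (1/2)" by (rule isometric_arc_left_mono) auto
    ultimately show False using D_0 by auto
  qed
  show ?thesis
  proof (intro exI conjI)
    show "0 < m" using m lt by (cases "m = 0") auto
    show "m < 1" using m lt by (cases "m = 1") auto
  qed (use m in auto)
qed

text \<open>\<open>V\<close> is arc length from \<open>e 0\<close>: it equals \<open>D\<close> up to
  the antipode \<open>e m\<close> and \<open>2 * D m - D\<close> on the way back, where the distance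
  to \<open>e 0\<close> decreases again. Both halves are isometric, so an arc across
  \<open>e m\<close> is handled by the triangle inequality at \<open>e m\<close>.\<close>

lemma arc_length_parametrisation:
  obtains V h m where "0 \<le> m" "m \<le> 1" "continuous_on {0..1} V" "V 0 = 0" "V m = h" "V 1 = 2 * h"
    "\<And>s t. 0 \<le> s \<Longrightarrow> s \<le> t \<Longrightarrow> t \<le> 1 \<Longrightarrow> d (e s) (e t) \<le> V t - V s"
    "\<And>t. 0 \<le> t \<Longrightarrow> t \<le> m \<Longrightarrow> d (e 0) (e t) = V t \<and> d (e t) (e m) = h - V t"
    "\<And>t. m \<le> t \<Longrightarrow> t \<le> 1 \<Longrightarrow> d (e 0) (e t) = 2 * h - V t \<and> d (e t) (e m) = V t - h"
proof -
  obtain m where m: "0 < m" "m < 1" "isometric_arc 0 m" "isometric_arc m 1" using antipode by blast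
  define V where "V t = (if t \<le> m then D t else 2 * D m - D t)" for t
  have leftm: "D s \<le> D t" if "0 \<le> s" "s \<le> t" "t \<le> m" for s t
    using isometric_arc_left_mono[OF m(3,2), of s t] that by (cases "s = t") auto
  have rightm: "D t \<le> D s" if "m \<le> s" "s \<le> t" "t \<le> 1" for s t
    using isometric_arc_right_mono[OF m(4,1), of s t] that by (cases "s = t") auto
  have L: "d (e s) (e t) = D t - D s" if "0 \<le> s" "s \<le> t" "t \<le> m" for s t
    using m(3) that leftm[of s t] unfolding isometric_arc_def by auto
  have R: "d (e s) (e t) = D s - D t" if "m \<le> s" "s \<le> t" "t \<le> 1" for s t
    using m(4) that rightm[of s t] unfolding isometric_arc_def by auto
  show thesis
  proof (rule that[of m V "D m"])
    show "continuous_on {0..1} V"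
    proof -
      have "continuous_on ({0..m} \<union> {m..1}) (\<lambda>t. if t \<le> m then D t else 2 * D m - D t)"
        by (rule continuous_on_If) (auto intro!: continuous_intros D_cont)
      moreover have "{0..m} \<union> {m..1} = {0..1}" using m by auto
      ultimately show ?thesis unfolding V_def by simp
    qed
    show "d (e s) (e t) \<le> V t - V s" if "0 \<le> s" "s \<le> t" "t \<le> 1" for s t
    proof -
      consider "t \<le> m" | "m < s" | "s \<le> m" "m < t" by linarith
      then show ?thesis
      proof cases
        case 3
        have "d (e s) (e t) \<le> d (e s) (e m) + d (e m) (e t)" by (rule triangle) auto
        then show ?thesis using 3 L[of s m] R[of m t] that unfolding V_def by auto
      qed (use that L R in \<open>auto simp: V_def\<close>)
    qed
    show "d (e 0) (e t) = V t \<and> d (e t) (e m) = D m - V t" if "0 \<le> t" "t \<le> m" for t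
      using L[of t m] that unfolding V_def by (auto simp: D_def)
    show "d (e 0) (e t) = 2 * D m - V t \<and> d (e t) (e m) = V t - D m" if "m \<le> t" "t \<le> 1" for t
      using R[of m t] that unfolding V_def by (auto simp: D_def commute)
    show "V 0 = 0" "V 1 = 2 * D m" using m D_0 unfolding V_def by auto
    show "V m = D m" unfolding V_def by auto
  qed (use m in auto)
qed

text \<open>The points divide the circle into \<open>2 * N\<close> arcs of equal length, with
  indices read modulo \<open>2 * N\<close>. Half a turn is worth \<open>L / 2\<close> without any
  loss, which the sharp constants of the shortcut estimate require.\<close>

lemma evenly_spaced_points:
  assumes L: "curve_length d e = ereal L" and N: "N > 0"
  obtains c :: "nat \<Rightarrow> complex" where "\<And>i. c i \<in> sphere 0 1"
    "\<And>i j. d (c i) (c (i + j)) \<le> real j * (L / (2 * real N))"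
    "\<And>i. L / 2 \<le> d (c i) (c (i + N))" "\<And>i. c (i + 2 * N) = c i"
proof -
  obtain V h m where m: "0 \<le> m" "m \<le> 1" and Vc: "continuous_on {0..1} V"
    and V: "V 0 = 0" "V m = h" "V 1 = 2 * h"
    and len: "\<And>s t. 0 \<le> s \<Longrightarrow> s \<le> t \<Longrightarrow> t \<le> 1 \<Longrightarrow> d (e s) (e t) \<le> V t - V s"
    and left: "\<And>t. 0 \<le> t \<Longrightarrow> t \<le> m \<Longrightarrow> d (e 0) (e t) = V t \<and> d (e t) (e m) = h - V t"
    and right: "\<And>t. m \<le> t \<Longrightarrow> t \<le> 1 \<Longrightarrow> d (e 0) (e t) = 2 * h - V t \<and> d (e t) (e m) = V t - h"
    by (rule arc_length_parametrisation) (rule that)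
  have Vm: "V s \<le> V t" if "0 \<le> s" "s \<le> t" "t \<le> 1" for s t
    using len[OF that] nonneg[of "e s" "e t"] by linarith
  have Lh: "L = 2 * h"
  proof -
    have "curve_length d e \<le> ereal (2 * h)"
      unfolding curve_length_def
    proof (rule SUP_least, clarify)
      fix n :: nat and t :: "nat \<Rightarrow> real"
      assume t: "t \<in> {..n} \<rightarrow> {0..1}" "mono_on {..n} t"
      have "(\<Sum>i<n. d (e (t i)) (e (t (Suc i)))) \<le> (\<Sum>i<n. V (t (Suc i)) - V (t i))"
        by (intro sum_mono len) (use t in \<open>auto simp: Pi_iff mono_on_def\<close>)
      also have "\<dots> = V (t n) - V (t 0)" by (rule sum_lessThan_telescope)
      also have "\<dots> \<le> 2 * h"
        using Vm[of 0 "t 0"] Vm[of "t n" 1] t V by (auto simp: Pi_iff)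
      finally show "ereal (\<Sum>i<n. d (e (t i)) (e (t (Suc i)))) \<le> ereal (2 * h)" by simp
    qed
    moreover have "ereal (2 * h) \<le> curve_length d e"
    proof -
      \<comment> \<open>The polygon through \<open>e 0\<close>, \<open>e m\<close>,
        \<open>e 1\<close> already has the full length.\<close>
      define t where "t i = (if i = 0 then 0 else if i = 1 then m else 1)" for i :: nat
      have "ereal (\<Sum>i<2. d (e (t i)) (e (t (Suc i)))) \<le> curve_length d e"
        unfolding curve_length_def
        by (rule SUP_upper2[of "(2, t)"]) (use m in \<open>auto simp: t_def mono_on_def\<close>)
      moreover have "(\<Sum>i<2. d (e (t i)) (e (t (Suc i)))) = 2 * h"
        using left[of m] right[of 1] m V by (simp add: t_def numeral_2_eq_2 commute)
      ultimately show ?thesis by simp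
    qed
    ultimately show ?thesis using L by simp
  qed
  have h0: "0 \<le> h" using Vm[of 0 1] V by auto
  define \<tau> where "\<tau> i = (SOME t. 0 \<le> t \<and> t \<le> 1 \<and> V t = real i * (h / real N))" for i
  have \<tau>: "0 \<le> \<tau> i \<and> \<tau> i \<le> 1 \<and> V (\<tau> i) = real i * (h / real N)" if "i \<le> 2 * N" for i
  proof -
    have "real i * (h / real N) \<le> real (2 * N) * (h / real N)"
      by (rule mult_right_mono) (use that h0 in auto)
    then have "\<exists>t. 0 \<le> t \<and> t \<le> 1 \<and> V t = real i * (h / real N)"
      using N V h0 Vc by (intro IVT') auto
    then show ?thesis unfolding \<tau>_def by (rule someI_ex)
  qed
  have \<tau>m: "\<tau> i \<le> \<tau> j" if "i < j" "j \<le> 2 * N" "h > 0" for i j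
  proof (rule ccontr)
    assume "\<not> ?thesis"
    then have "V (\<tau> j) \<le> V (\<tau> i)" using Vm[of "\<tau> j" "\<tau> i"] \<tau>[of i] \<tau>[of j] that by auto
    then have "real j * (h / real N) \<le> real i * (h / real N)" using \<tau>[of i] \<tau>[of j] that by auto
    then show False using that N by (simp add: field_simps)
  qed
  define c where "c i = e (\<tau> (i mod (2 * N)))" for i
  have step: "d (c i) (c (Suc i)) \<le> L / (2 * real N)" for i
  proof (cases "h = 0")
    case True
    have "d (e s) (e t) \<le> 0" if "s \<in> {0..1}" "t \<in> {0..1}" for s t
      using len[of s t] len[of t s] Vm[of 0 s] Vm[of s 1] Vm[of 0 t] Vm[of t 1] that V True 
      by (cases "s \<le> t") (auto simp: commute)
    then show ?thesis using True Lh \<tau> N unfolding c_def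
      by (simp add: less_imp_le)
  next
    case False
    with h0 have h: "h > 0" by simp
    define a where "a = i mod (2 * N)"
    have a: "a < 2 * N" unfolding a_def using N by simp
    have Ln: "L / (2 * real N) = h / real N" using Lh by simp
    show ?thesis
    proof (cases "Suc a = 2 * N")
      case True
      have "d (e (\<tau> a)) (e 1) \<le> V 1 - V (\<tau> a)" by (rule len) (use \<tau>[of a] a in auto)
      also have "\<dots> = h / real N"
      proof -
        have ra: "real a = 2 * real N - 1" using True by linarith
        have "V (\<tau> a) = (2 * real N - 1) * (h / real N)" using \<tau>[of a] a ra by simp
        then show ?thesis using V N by (simp add: field_simps)
      qed
      finally have 1: "d (e (\<tau> a)) (e 0) \<le> h / real N" using e_1 by simp
      have "d (e 0) (e (\<tau> 0)) \<le> V (\<tau> 0) - V 0" by (rule len) (use \<tau>[of 0] in auto)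
      then have "d (e 0) (e (\<tau> 0)) = 0"
        using \<tau>[of 0] V(1) nonneg[of "e 0" "e (\<tau> 0)"] by linarith
      then have "e 0 = e (\<tau> 0)" using zero[OF e_in e_in] by blast
      moreover have "Suc i mod (2 * N) = 0" using True unfolding a_def by (simp add: mod_Suc)
      ultimately show ?thesis using 1 Ln unfolding c_def a_def[symmetric] by simp
    next
      case False
      then have *: "Suc i mod (2 * N) = Suc a" unfolding a_def by (simp add: mod_Suc)
      have "d (e (\<tau> a)) (e (\<tau> (Suc a))) \<le> V (\<tau> (Suc a)) - V (\<tau> a)"
        by (rule len) (use \<tau>m[of a "Suc a"] \<tau>[of a] \<tau>[of "Suc a"] a False h in auto)
      also have "\<dots> = h / real N" using \<tau>[of a] \<tau>[of "Suc a"] a False by (simp add: field_simps)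
      finally show ?thesis using Ln * unfolding c_def a_def[symmetric] by simp
    qed
  qed
  \<comment> \<open>A geodesic from \<open>e s\<close> to \<open>e t\<close> covers one of the two
    arcs, so if \<open>m\<close> lies between \<open>s\<close> and \<open>t\<close> it passes
    through \<open>e m\<close> or through \<open>e 1 = e 0\<close>; the distances to either of these
    points are known from \<open>V\<close> and add up to \<open>h\<close>. If both points lie in one
    half, they are \<open>e 0\<close> and \<open>e m\<close>.\<close>
  have far: "h \<le> d (e s) (e t)" if st: "0 \<le> s" "s \<le> t" "t \<le> 1" "V t - V s = h" for s t
  proof (cases "s \<le> m \<and> m \<le> t")
    case True
    obtain \<gamma> where \<gamma>: "geodesic_segment (sphere 0 1) d (e s) (e t) \<gamma>"
      "e ` {s..t} \<subseteq> \<gamma> \<or> e ` {t..s+1} \<subseteq> \<gamma>"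
      by (rule geodesic_contains_arc[of s t]) (use st in auto)
    have "e m \<in> e ` {s..t}" by (rule imageI) (use True in auto)
    moreover have "e 1 \<in> e ` {t..s+1}" by (rule imageI) (use st in auto)
    ultimately have "e m \<in> \<gamma> \<or> e 1 \<in> \<gamma>" using \<gamma>(2) by blast
    then have "d (e s) (e m) + d (e m) (e t) = d (e s) (e t) \<or>
      d (e s) (e 0) + d (e 0) (e t) = d (e s) (e t)"
      using geodesic_segment_isometry(2)[OF \<gamma>(1)] e_1 by metis
    then show ?thesis using left[of s] right[of t] True st by (auto simp: commute)
  next
    case False
    have *: "h \<le> d (e 0) (e m)" using left[of m] m V by auto
    have "V 0 \<le> V s" "V t \<le> V 1" using Vm st by auto
    consider "t < m" | "m < s" using False by linarith
    then show ?thesis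
    proof cases
      case 1
      then have "V t \<le> h" using Vm[of t m] V m st by auto
      then have "d (e 0) (e s) \<le> 0" "d (e t) (e m) \<le> 0"
        using left[of s] left[of t] 1 st V \<open>V 0 \<le> V s\<close> by auto
      then have "e 0 = e s" "e t = e m" using nonneg[of "e 0" "e s"] nonneg[of "e t" "e m"]
        by (metis antisym e_in zero)+
      then show ?thesis using * by simp
    next
      case 2
      then have "h \<le> V s" using Vm[of m s] V m st by auto
      then have "d (e 0) (e t) \<le> 0" "d (e s) (e m) \<le> 0"
        using right[of s] right[of t] 2 st V \<open>V t \<le> V 1\<close> by auto
      then have "e 0 = e t" "e s = e m" using nonneg[of "e 0" "e t"] nonneg[of "e s" "e m"]
        by (metis antisym e_in zero)+
      then show ?thesis using * by (simp add: commute)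
    qed
  qed
  have anti: "L / 2 \<le> d (c i) (c (i + N))" for i
  proof (cases "h = 0")
    case True
    then show ?thesis using Lh by simp
  next
    case False
    with h0 have h: "h > 0" by simp
    have far': "h \<le> d (e (\<tau> a)) (e (\<tau> (a + N)))" if "a < N" for a
    proof (rule far)
      have "V (\<tau> (a + N)) - V (\<tau> a) = real (a + N) * (h / real N) - real a * (h / real N)"
        using \<tau>[of a] \<tau>[of "a + N"] that by simp
      also have "\<dots> = h" using N by (simp add: field_simps)
      finally show "V (\<tau> (a + N)) - V (\<tau> a) = h" .
    qed (use \<tau>[of a] \<tau>[of "a + N"] \<tau>m[of a "a + N"] that N h in auto)
    define a where "a = i mod (2 * N)"
    have a: "a < 2 * N" unfolding a_def using N by simp
    have ia: "(i + N) mod (2 * N) = (a + N) mod (2 * N)" unfolding a_def by (simp add: mod_add_left_eq)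
    show ?thesis
    proof (cases "a < N")
      case True
      then have "(a + N) mod (2 * N) = a + N" by simp
      then show ?thesis using far'[OF True] Lh ia unfolding c_def a_def[symmetric] by simp
    next
      case False
      define b where "b = a - N"
      have b: "a = b + N" "b < N" using False a unfolding b_def by auto
      then have "(a + N) mod (2 * N) = (b + 2 * N) mod (2 * N)"
        by (metis add.assoc mult_2)
      then have "(a + N) mod (2 * N) = b" using b by simp
      then show ?thesis using far'[OF b(2)] Lh ia b unfolding c_def a_def[symmetric] 
        by (simp add: commute)
    qed
  qed
  show thesis
  proof (rule that[of c])
    show "c i \<in> sphere 0 1" for i unfolding c_def by simp
    show "d (c i) (c (i + j)) \<le> real j * (L / (2 * real N))" for i j
    proof (induction j)
      case 0
      then show ?case using \<open>\<And>i. c i \<in> sphere 0 1\<close> by simp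
    next
      case (Suc j)
      have "d (c i) (c (i + Suc j)) \<le> d (c i) (c (i + j)) + d (c (i + j)) (c (Suc (i + j)))"
        using triangle[of "c i" "c (i+j)" "c (i + Suc j)"] by (simp add: c_def)
      also have "\<dots> \<le> real j * (L / (2 * real N)) + L / (2 * real N)"
        using Suc step[of "i + j"] by (intro add_mono)
      also have "\<dots> = real (Suc j) * (L / (2 * real N))" by (simp only: of_nat_Suc distrib_right mult_1)
      finally show ?case .
    qed
    show "L / 2 \<le> d (c i) (c (i + N))" for i by (rule anti)
    show "c (i + 2 * N) = c i" for i unfolding c_def by simp
  qed
qed

end

subsection \<open>The four-point inequality\<close>

definition gromov_product :: "('a \<Rightarrow> 'a \<Rightarrow> real) \<Rightarrow> 'a \<Rightarrow> 'a \<Rightarrow> 'a \<Rightarrow> real"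
  where "gromov_product d w x y = (d w x + d w y - d x y) / 2"

context Metric_space
begin

text \<open>The point where \<open>\<alpha>\<close> leaves the \<open>\<delta>\<close>-neighbourhood
  of \<open>\<gamma>\<close> is close to both other sides, and adding the two detours through these
  sides bounds its distance from \<open>w\<close>. The supremum need not be attained, so two points
  at distance 1/2 around it are compared; the summand 1 covers this.\<close>

lemma geodesic_near_base_point:
  assumes "hyperbolic \<delta> M d" "0 \<le> \<delta>" "x \<in> M" "y \<in> M" "w \<in> M"
    and "geodesic_segment M d x y \<alpha>" "geodesic_segment M d w y \<beta>" "geodesic_segment M d w x \<gamma>"
  shows "\<exists>m\<in>\<alpha>. d w m \<le> gromov_product d w x y + 2 * \<delta> + 1"
proof -
  obtain f where f: "f \<in> {0..d x y} \<rightarrow> M" "f 0 = x" "f (d x y) = y"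
    "\<And>s t. s \<in> {0..d x y} \<Longrightarrow> t \<in> {0..d x y} \<Longrightarrow> d (f s) (f t) = \<bar>s - t\<bar>"
    "\<alpha> = f ` {0..d x y}"
    by (rule geodesic_segmentE[OF assms(6)]) (rule that)
  have slim: "\<exists>q\<in>\<beta> \<union> \<gamma>. d p q \<le> \<delta>" if "p \<in> \<alpha>" for p
    using assms that unfolding hyperbolic_def by blast
  have xg: "x \<in> \<gamma>" and yb: "y \<in> \<beta>"
    using assms(7,8) unfolding geodesic_segment_def
    by (metis atLeastAtMost_iff image_eqI nonneg order_refl)+
  define S where "S = {s \<in> {0..d x y}. \<exists>q\<in>\<gamma>. d (f s) q \<le> \<delta>}"
  have S0: "0 \<in> S" unfolding S_def using xg f(2) assms by (auto intro!: bexI[of _ x])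
  have bdd: "bdd_above S" unfolding S_def by (auto intro: bdd_aboveI[of _ "d x y"])
  obtain s where s: "s \<in> S" "Sup S - 1/2 < s"
    using less_cSupD[of S "Sup S - 1/2"] S0 by auto
  have sD: "s \<in> {0..d x y}" using s unfolding S_def by auto
  have fs: "f s \<in> M" using f(1) sD by auto
  obtain q where q: "q \<in> \<gamma>" "d (f s) q \<le> \<delta>" using s unfolding S_def by auto
  have "\<exists>q'\<in>\<beta>. d (f s) q' \<le> \<delta> + 1"
  proof (cases "s + 1/2 > d x y")
    case True
    then have "d (f s) y \<le> \<delta> + 1" using f(4)[of s "d x y"] f(3) sD assms(2) by auto
    then show ?thesis using yb by blast
  next
    case False
    then have s2: "s + 1/2 \<in> {0..d x y}" using sD by auto
    have "s + 1/2 \<notin> S" using cSup_upper[OF _ bdd, of "s + 1/2"] s by auto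
    then obtain q' where q': "q' \<in> \<beta>" "d (f (s + 1/2)) q' \<le> \<delta>"
      using slim[of "f (s + 1/2)"] s2 f(5) unfolding S_def by auto
    have "q' \<in> M" "f (s+1/2) \<in> M" 
      using geodesic_segment_isometry(3)[OF assms(7) q'(1) q'(1)] f(1) s2 by auto
    then have "d (f s) q' \<le> d (f s) (f (s + 1/2)) + d (f (s + 1/2)) q'" using fs triangle by blast
    also have "\<dots> \<le> \<delta> + 1" using f(4)[OF sD s2] q' by simp
    finally show ?thesis using q' by blast
  qed
  then obtain q' where q': "q' \<in> \<beta>" "d (f s) q' \<le> \<delta> + 1" by blast
  have qM: "q \<in> M" "q' \<in> M"
    using geodesic_segment_isometry(3)[OF assms(8) q(1) q(1)]
      geodesic_segment_isometry(3)[OF assms(7) q'(1) q'(1)] by auto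
  have "d w q + d q x = d w x" "d w q' + d q' y = d w y"
    using geodesic_segment_isometry(2)[OF assms(8) q(1) q(1)]
      geodesic_segment_isometry(2)[OF assms(7) q'(1) q'(1)] by auto
  moreover have "d w (f s) \<le> d w q + d (f s) q" "d (f s) x \<le> d (f s) q + d q x"
     "d w (f s) \<le> d w q' + d (f s) q'" "d (f s) y \<le> d (f s) q' + d q' y"
    using triangle[of w q "f s"] triangle[of w q' "f s"] triangle[of "f s" q x] 
      triangle[of "f s" q' y] assms qM fs by (auto simp: commute)
  moreover have "d (f s) x + d (f s) y = d x y"
    using f(4)[of 0 s] f(4)[of s "d x y"] f(2,3) sD by (auto simp: commute)
  ultimately have "2 * d w (f s) + d x y \<le> d w x + d w y + 4 * \<delta> + 2"
    using q(2) q'(2) by linarith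
  then have "d w (f s) \<le> gromov_product d w x y + 2 * \<delta> + 1"
    unfolding gromov_product_def by (simp add: field_simps)
  then show ?thesis using f(5) sD by auto
qed

lemma gromov_product_le_geodesic:
  assumes "geodesic_segment M d x y \<alpha>" "m \<in> \<alpha>" "w \<in> M" "x \<in> M" "y \<in> M"
  shows "gromov_product d w x y \<le> d w m"
  using geodesic_segment_isometry(2,3)[OF assms(1,2,2)] triangle[of w m x] triangle[of w m y] assms
  unfolding gromov_product_def by (simp add: commute)

text \<open>Some point of the side from \<open>x\<close> to \<open>y\<close> is within the product
  at \<open>w\<close> plus \<open>2 * \<delta> + 1\<close> of \<open>w\<close>. Slimness moves it by
  \<open>\<delta>\<close> to a side through \<open>z\<close>, and the distance from \<open>w\<close>
  to a point of a geodesic dominates the product of the endpoints. The total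
  \<open>3 * \<delta> + 1\<close> is at most \<open>4 * \<delta>\<close>.\<close>

lemma four_point_inequality:
  assumes hyp: "hyperbolic \<delta> M d" "geodesic_space M d" "1 \<le> \<delta>"
    and M: "x \<in> M" "y \<in> M" "z \<in> M" "w \<in> M"
  shows "min (gromov_product d w x z) (gromov_product d w z y) \<le> gromov_product d w x y + 4 * \<delta>"
proof -
  have ex: "\<exists>\<gamma>. geodesic_segment M d a b \<gamma>" if "a \<in> M" "b \<in> M" for a b
    using hyp(2) that unfolding geodesic_space_def by blast
  obtain \<alpha> \<beta> \<gamma> \<beta>' \<gamma>' where g: "geodesic_segment M d x y \<alpha>" "geodesic_segment M d w y \<beta>"
    "geodesic_segment M d w x \<gamma>" "geodesic_segment M d z y \<beta>'" "geodesic_segment M d z x \<gamma>'"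
    using ex M by metis
  obtain m where m: "m \<in> \<alpha>" "d w m \<le> gromov_product d w x y + 2 * \<delta> + 1"
    using geodesic_near_base_point[OF hyp(1) _ M(1,2,4) g(1-3)] hyp(3) by auto
  obtain q where q: "q \<in> \<beta>' \<union> \<gamma>'" "d m q \<le> \<delta>"
    using hyp(1) M g m(1) unfolding hyperbolic_def by blast
  have mM: "m \<in> M" using geodesic_segment_isometry(3)[OF g(1) m(1) m(1)] .
  have qM: "q \<in> M" using q(1) geodesic_segment_isometry(3) g by blast
  have "d w q \<le> gromov_product d w x y + 4 * \<delta>"
    using triangle[of w m q] m q mM qM M hyp(3) by linarith
  moreover have "gromov_product d w z y \<le> d w q \<or> gromov_product d w z x \<le> d w q"
    using q(1) gromov_product_le_geodesic g M by blast
  moreover have "gromov_product d w x z = gromov_product d w z x"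
    unfolding gromov_product_def by (simp add: commute)
  ultimately show ?thesis by (simp add: min_le_iff_disj) linarith
qed

end

subsection \<open>Rescaling a coarse length function\<close>

text \<open>
  The function \<open>n\<close> counts walls in a longest chain. The last assumption says that at most \<open>N\<close> such
  chains can pairwise cross: \<open>low i s\<close> and \<open>high i s\<close> place \<open>s\<close> on either side of the wall number
  \<open>k i\<close> of a longest chain from \<open>p i\<close> to \<open>q i\<close>.
\<close>

locale coarse_chain_space = Metric_space X d for X :: "'a set" and d +
  fixes n :: "'a \<Rightarrow> 'a \<Rightarrow> nat" and N :: nat
  assumes n_refl: "x \<in> X \<Longrightarrow> n x x = 0"
    and n_sym: "x \<in> X \<Longrightarrow> y \<in> X \<Longrightarrow> n x y = n y x"
    and n_triangle: "x \<in> X \<Longrightarrow> y \<in> X \<Longrightarrow> z \<in> X \<Longrightarrow> n x z \<le> n x y + n y z + 1"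
    and n_intermediate: "x \<in> X \<Longrightarrow> y \<in> X \<Longrightarrow> 1 \<le> R \<Longrightarrow> R \<le> n x y \<Longrightarrow>
      \<exists>z\<in>X. n x z \<le> R \<and> n z y + R \<le> n x y + 1"
    and n_upper: "\<exists>K C. 0 \<le> K \<and> 0 \<le> C \<and> (\<forall>x\<in>X. \<forall>y\<in>X. real (n x y) \<le> K * d x y + C)"
    and n_lower: "\<exists>\<theta>. \<forall>x\<in>X. \<forall>y\<in>X. n x y \<le> R \<longrightarrow> d x y \<le> \<theta>"
    and N_pos: "0 < N"
    and n_crossing: "\<lbrakk>\<And>i. i < N \<Longrightarrow> p i \<in> X \<and> q i \<in> X \<and> k i < n (p i) (q i);
      low = (\<lambda>i s. n (p i) s < k i); high = (\<lambda>i s. n s (q i) + k i + 1 < n (p i) (q i));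
      \<And>i j. i < j \<Longrightarrow> j < N \<Longrightarrow>
        (\<exists>s\<in>X. low i s \<and> low j s) \<and> (\<exists>s\<in>X. low i s \<and> high j s) \<and>
        (\<exists>s\<in>X. high i s \<and> low j s) \<and> (\<exists>s\<in>X. high i s \<and> high j s)\<rbrakk> \<Longrightarrow> False"
begin

section \<open>The step metric\<close>

definition steps :: "nat \<Rightarrow> ('a \<times> 'a) set"
  where "steps R = {(x, y). x \<in> X \<and> y \<in> X \<and> n x y \<le> R}"

text \<open>The graph metric with the pairs in \<open>steps R\<close> as edges; by
  \<open>steps_exist\<close> the graph on \<open>X\<close> is connected for
  \<open>2 \<le> R\<close>.\<close>

definition step_dist :: "nat \<Rightarrow> 'a \<Rightarrow> 'a \<Rightarrow> nat"
  where "step_dist R x y = (LEAST l. (x, y) \<in> steps R ^^ l)"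

lemma steps_relpow_sym: "(x, y) \<in> steps R ^^ l \<Longrightarrow> (y, x) \<in> steps R ^^ l"
proof (induction l arbitrary: y)
  case (Suc l)
  then obtain z where "(x, z) \<in> steps R ^^ l" "(z, y) \<in> steps R" by auto
  then have "(z, x) \<in> steps R ^^ l" "(y, z) \<in> steps R" using Suc n_sym unfolding steps_def by auto
  then show ?case by (rule relpow_Suc_I2[rotated])
qed auto

text \<open>Each concatenation costs the additive 1 of \<open>n_triangle\<close>; hence
  \<open>R + 1\<close>.\<close>

lemma n_le_steps:
  assumes "(x, y) \<in> steps R ^^ l" "x \<in> X"
  shows "n x y \<le> (R + 1) * l" "y \<in> X"
proof -
  have "n x y \<le> (R + 1) * l \<and> y \<in> X"
    using assms(1)
  proof (induction l arbitrary: y)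
    case 0
    then show ?case using assms n_refl by auto
  next
    case (Suc l)
    then obtain z where "(x, z) \<in> steps R ^^ l" "(z, y) \<in> steps R" by auto
    then have "n x z \<le> (R + 1) * l \<and> z \<in> X" "n z y \<le> R \<and> y \<in> X"
      using Suc.IH unfolding steps_def by blast+
    moreover have "(R + 1) * Suc l = (R + 1) * l + R + 1" by simp
    ultimately show ?case using n_triangle[of x z y] assms(2) by linarith
  qed
  then show "n x y \<le> (R + 1) * l" "y \<in> X" by auto
qed

text \<open>Greedy descent: a step of length \<open>R\<close> towards \<open>y\<close> lowers
  \<open>n\<close> by at least \<open>R - 1\<close>, which is positive. The summand \<open>R\<close>
  on the right pays for the last, incomplete step.\<close>

lemma steps_exist:
  assumes "x \<in> X" "y \<in> X" "2 \<le> R"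
  shows "\<exists>l. (x, y) \<in> steps R ^^ l \<and> (R - 1) * l \<le> n x y + R"
  using assms(1)
proof (induction "n x y" arbitrary: x rule: less_induct)
  case less
  show ?case
  proof (cases "n x y \<le> R")
    case True
    then have "(x, y) \<in> steps R ^^ 1" using less.prems assms unfolding steps_def by auto
    then show ?thesis by (intro exI[of _ 1]) auto
  next
    case False
    then obtain z where z: "z \<in> X" "n x z \<le> R" "n z y + R \<le> n x y + 1"
      using n_intermediate[of x y R] less.prems assms by auto
    then obtain l where l: "(z, y) \<in> steps R ^^ l" "(R - 1) * l \<le> n z y + R"
      using less.hyps[of z] assms by auto
    have "(x, z) \<in> steps R" using z less.prems unfolding steps_def by auto
    then have "(x, y) \<in> steps R ^^ Suc l" using l(1) by (rule relpow_Suc_I2)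
    moreover have "(R - 1) * Suc l \<le> n x y + R" using l(2) z(3) assms(3) by simp
    ultimately show ?thesis by blast
  qed
qed

context
  fixes R :: nat
  assumes R: "2 \<le> R"
begin

lemma step_dist_path: "x \<in> X \<Longrightarrow> y \<in> X \<Longrightarrow> (x, y) \<in> steps R ^^ step_dist R x y"
  unfolding step_dist_def using steps_exist[OF _ _ R] by (meson LeastI_ex)

lemma step_dist_le: "(x, y) \<in> steps R ^^ l \<Longrightarrow> step_dist R x y \<le> l"
  unfolding step_dist_def by (rule Least_le)

lemma step_dist_upper:
  assumes "x \<in> X" "y \<in> X"
  shows "(R - 1) * step_dist R x y \<le> n x y + R"
proof -
  obtain l where l: "(x, y) \<in> steps R ^^ l" "(R - 1) * l \<le> n x y + R"
    using steps_exist[OF assms R] by blast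
  then show ?thesis using step_dist_le[OF l(1)] by (meson mult_le_mono2 order.trans)
qed

lemma step_dist_lower: "x \<in> X \<Longrightarrow> y \<in> X \<Longrightarrow> n x y \<le> (R + 1) * step_dist R x y"
  using n_le_steps(1)[OF step_dist_path] by blast

lemma step_dist_triangle:
  assumes "x \<in> X" "y \<in> X" "z \<in> X"
  shows "step_dist R x z \<le> step_dist R x y + step_dist R y z"
proof (rule step_dist_le)
  show "(x, z) \<in> steps R ^^ (step_dist R x y + step_dist R y z)"
    unfolding relpow_add by (rule relcompI[OF step_dist_path step_dist_path]) (use assms in auto)
qed

lemma step_dist_sym:
  assumes "x \<in> X" "y \<in> X"
  shows "step_dist R x y = step_dist R y x"
  using step_dist_le[OF steps_relpow_sym[OF step_dist_path[OF assms]]]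
    step_dist_le[OF steps_relpow_sym[OF step_dist_path[OF assms(2,1)]]] by simp

lemma step_dist_zero:
  assumes "x \<in> X" "y \<in> X"
  shows "step_dist R x y = 0 \<longleftrightarrow> x = y"
proof
  assume "step_dist R x y = 0"
  then show "x = y" using step_dist_path[OF assms] by simp
next
  assume "x = y"
  then have "(x, y) \<in> steps R ^^ 0" by simp
  then show "step_dist R x y = 0" using step_dist_le[of x y 0] by simp
qed

text \<open>The value 0 off \<open>X\<close> is chosen because \<open>Metric_space\<close> demands
  symmetry also outside the carrier.\<close>

definition \<sigma> :: "'a \<Rightarrow> 'a \<Rightarrow> real"
  where "\<sigma> x y = (if x \<in> X \<and> y \<in> X then real (step_dist R x y) else 0)"

lemma \<sigma>_metric: "Metric_space X \<sigma>"
proof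
  fix x y z assume "x \<in> X" "y \<in> X" "z \<in> X"
  then show "\<sigma> x z \<le> \<sigma> x y + \<sigma> y z"
    unfolding \<sigma>_def using step_dist_triangle[of x y z] by simp
qed (auto simp: \<sigma>_def step_dist_zero step_dist_sym)

text \<open>A shortest step path is geodesic at integer times, and rounding times down changes each
  distance by at most 1.\<close>

lemma \<sigma>_roughly_geodesic: "roughly_geodesic X \<sigma>"
  unfolding roughly_geodesic_def
proof (intro exI[of _ 1] conjI ballI)
  fix a b assume ab: "a \<in> X" "b \<in> X"
  define l where "l = step_dist R a b"
  have \<sigma>l: "\<sigma> a b = real l" unfolding \<sigma>_def l_def using ab by simp
  obtain z where z: "z 0 = a" "z l = b" "\<And>i. i < l \<Longrightarrow> (z i, z (Suc i)) \<in> steps R"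
    using step_dist_path[OF ab] unfolding l_def[symmetric] relpow_fun_conv by blast
  have zX: "z i \<in> X" if "i \<le> l" for i
  proof (cases "i = l")
    case False
    then show ?thesis using z(3)[of i] that unfolding steps_def by auto
  qed (use z ab in simp)
  have sub: "(z i, z j) \<in> steps R ^^ (j - i)" if "i \<le> j" "j \<le> l" for i j
    unfolding relpow_fun_conv
    by (rule exI[of _ "\<lambda>k. z (i + k)"]) (use z(3) that in auto)
  \<comment> \<open>A quicker connection between two of the points would shorten the whole
    path.\<close>
  have dist_z: "step_dist R (z i) (z j) = j - i" if "i \<le> j" "j \<le> l" for i j
  proof -
    have "step_dist R a (z i) \<le> i" "step_dist R (z i) (z j) \<le> j - i" "step_dist R (z j) b \<le> l - j"
      using step_dist_le[OF sub] that z(1,2) by (metis diff_zero le0 order.trans order_refl)+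
    moreover have "l \<le> step_dist R a (z i) + step_dist R (z i) (z j) + step_dist R (z j) b"
      unfolding l_def using step_dist_triangle[of a "z i" b] step_dist_triangle[of "z i" "z j" b]
        zX[of i] zX[of j] ab that by linarith
    ultimately show ?thesis using that by linarith
  qed
  have "qi_embedding 1 1 {0..\<sigma> a b} dist X \<sigma> (\<lambda>t. z (nat \<lfloor>t\<rfloor>))"
    unfolding qi_embedding_def
  proof (intro conjI ballI)
    have fl: "nat \<lfloor>t\<rfloor> \<le> l" if "t \<in> {0..\<sigma> a b}" for t
      using that unfolding \<sigma>l by (auto simp: nat_le_iff floor_le_iff)
    then show "(\<lambda>t. z (nat \<lfloor>t\<rfloor>)) \<in> {0..\<sigma> a b} \<rightarrow> X" using zX by auto
    have key: "\<sigma> (z (nat \<lfloor>s\<rfloor>)) (z (nat \<lfloor>t\<rfloor>)) = \<bar>real_of_int \<lfloor>s\<rfloor> - real_of_int \<lfloor>t\<rfloor>\<bar>"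
      if st: "s \<in> {0..\<sigma> a b}" "t \<in> {0..\<sigma> a b}" "s \<le> t" for s t
    proof -
      have m: "nat \<lfloor>s\<rfloor> \<le> nat \<lfloor>t\<rfloor>" using st by (intro nat_mono floor_mono)
      have "\<sigma> (z (nat \<lfloor>s\<rfloor>)) (z (nat \<lfloor>t\<rfloor>)) = real (nat \<lfloor>t\<rfloor> - nat \<lfloor>s\<rfloor>)"
        unfolding \<sigma>_def using dist_z[OF m fl[OF st(2)]] zX fl st by simp
      also have "\<dots> = \<bar>real_of_int \<lfloor>s\<rfloor> - real_of_int \<lfloor>t\<rfloor>\<bar>"
        using st m by (simp add: of_nat_diff floor_mono)
      finally show ?thesis .
    qed
    have key2: "\<bar>\<sigma> (z (nat \<lfloor>s\<rfloor>)) (z (nat \<lfloor>t\<rfloor>)) - dist s t\<bar> \<le> 1"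
      if st: "s \<in> {0..\<sigma> a b}" "t \<in> {0..\<sigma> a b}" for s t
    proof (cases "s \<le> t")
      case True
      then show ?thesis using key[OF st True] unfolding dist_real_def by linarith
    next
      case False
      have "\<sigma> (z (nat \<lfloor>s\<rfloor>)) (z (nat \<lfloor>t\<rfloor>)) = \<sigma> (z (nat \<lfloor>t\<rfloor>)) (z (nat \<lfloor>s\<rfloor>))"
        unfolding \<sigma>_def using step_dist_sym by auto
      then show ?thesis using key[OF st(2,1)] False unfolding dist_real_def by linarith
    qed
    fix s t assume st: "s \<in> {0..\<sigma> a b}" "t \<in> {0..\<sigma> a b}"
    show "dist s t / 1 - 1 \<le> \<sigma> (z (nat \<lfloor>s\<rfloor>)) (z (nat \<lfloor>t\<rfloor>))"
      "\<sigma> (z (nat \<lfloor>s\<rfloor>)) (z (nat \<lfloor>t\<rfloor>)) \<le> 1 * dist s t + 1"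
      using key2[OF st] by linarith+
  qed
  then show "\<exists>f. qi_embedding 1 1 {0..\<sigma> a b} dist X \<sigma> f \<and> f 0 = a \<and> f (\<sigma> a b) = b"
    using z(1,2) \<sigma>l by (intro exI[of _ "\<lambda>t. z (nat \<lfloor>t\<rfloor>)"]) auto
qed simp

text \<open>The identity works: one step has bounded \<open>d\<close>-length by
  \<open>n_lower\<close>, and conversely \<open>step_dist_upper\<close> with \<open>n_upper\<close>
  bounds the number of steps.\<close>

lemma \<sigma>_quasi_isometric: "quasi_isometric X \<sigma> X d"
proof -
  obtain K C where K: "0 \<le> K" "0 \<le> C" "\<And>x y. x \<in> X \<Longrightarrow> y \<in> X \<Longrightarrow> real (n x y) \<le> K * d x y + C"
    using n_upper by blast
  obtain \<theta>0 where \<theta>0: "\<And>x y. x \<in> X \<Longrightarrow> y \<in> X \<Longrightarrow> n x y \<le> R \<Longrightarrow> d x y \<le> \<theta>0"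
    using n_lower[of R] by blast
  define \<theta> where "\<theta> = max \<theta>0 1"
  have path: "d x y \<le> \<theta> * real l" if "(x, y) \<in> steps R ^^ l" "x \<in> X" for x y l
    using that(1)
  proof (induction l arbitrary: y)
    case 0
    then show ?case using that by simp
  next
    case (Suc l)
    then obtain z where z: "(x, z) \<in> steps R ^^ l" "(z, y) \<in> steps R" by auto
    then have "z \<in> X" "y \<in> X" "d z y \<le> \<theta>" using \<theta>0[of z y] unfolding steps_def \<theta>_def by auto
    then show ?case using Suc.IH[OF z(1)] triangle[of x z y] that(2) by (simp add: distrib_left)
  qed
  have up: "d x y \<le> \<theta> * \<sigma> x y" if "x \<in> X" "y \<in> X" for x y
    using path[OF step_dist_path[OF that] that(1)] that unfolding \<sigma>_def by simp
  have lo: "\<sigma> x y \<le> K * d x y + (C + real R)" if "x \<in> X" "y \<in> X" for x y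
  proof -
    have "step_dist R x y \<le> (R - 1) * step_dist R x y" using R by (cases R) auto
    then have "step_dist R x y \<le> n x y + R" using step_dist_upper[OF that] by linarith
    then have "real (step_dist R x y) \<le> real (n x y) + real R" by linarith
    then show ?thesis using K(3)[OF that] that unfolding \<sigma>_def by simp
  qed
  define A where "A = max \<theta> (K + 1)"
  have A: "1 \<le> A" "\<theta> \<le> A" "K \<le> A" using K unfolding A_def \<theta>_def by auto
  have "qi_embedding A (C + real R) X \<sigma> X d id"
    unfolding qi_embedding_def
  proof (intro conjI ballI)
    fix x y assume xy: "x \<in> X" "y \<in> X"
    have s0: "0 \<le> \<sigma> x y" unfolding \<sigma>_def by simp
    have "\<sigma> x y \<le> A * d x y + A * (C + real R)"
      using lo[OF xy] mult_right_mono[OF A(3), of "d x y"] mult_right_mono[OF A(1), of "C + real R"] K by simp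
    then have "\<sigma> x y / A \<le> d x y + (C + real R)"
      using A(1) by (simp add: pos_divide_le_eq algebra_simps)
    then show "\<sigma> x y / A - (C + real R) \<le> d (id x) (id y)" by simp
    show "d (id x) (id y) \<le> A * \<sigma> x y + (C + real R)"
      using up[OF xy] mult_right_mono[OF A(2) s0] K by simp
  qed auto
  moreover have "coarsely_onto (C + real R) X X d id"
    unfolding coarsely_onto_def using K by (auto intro!: bexI)
  ultimately show ?thesis
    unfolding quasi_isometric_def using A(1) K
    by (intro exI[of _ A] conjI exI[of _ "C + real R"] exI[of _ id]) auto
qed

text \<open>The circle is divided into \<open>4 * N\<close> arcs, and longest chains join the
  antipodal points with indices \<open>2 * i\<close> and \<open>2 * i + 2 * N\<close> for
  \<open>i < N\<close>. Points whose indices differ by less than \<open>N\<close> are at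
  \<open>n\<close>-distance at most \<open>T\<close>, antipodal ones at more than
  \<open>2 * T + 2\<close> if \<open>L\<close> is large. So in each chain the wall number
  \<open>k\<close>, with \<open>k\<close> just above \<open>T\<close>, separates all points near
  \<open>p i\<close> from all points near \<open>q i\<close>.\<close>

lemma \<sigma>_strongly_shortcut:
  assumes RN: "R = 8 * N + 1"
  shows "strongly_shortcut X \<sigma>"
proof -
  define K where "K = 1 + 1 / (8 * real N)"
  have N1: "1 \<le> real N" using N_pos by simp
  have K1: "1 < K" unfolding K_def using N1 by simp
  \<comment> \<open>The coefficient of \<open>L\<close> in the lower bound for antipodal points
    minus twice the upper bound \<open>T\<close>. The factor \<open>(N - 1) / N\<close> of the
    second term leaves the room for choosing \<open>R\<close> and \<open>K\<close>.\<close>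
  define \<alpha> where "\<alpha> = (real R - 1) / (2 * K) - (real R + 1) * K * (real N - 1) / (2 * real N)"
  have \<alpha>: "0 < \<alpha>"
  proof -
    \<comment> \<open>This is \<open>0 < \<alpha>\<close> with denominators cleared. The product
      \<open>(8 * N + 2) * (N - 1)\<close> falls short of \<open>8 * N * N\<close> by
      \<open>6 * N + 2\<close>, whereas the excess of \<open>K * K\<close> over 1 is at most
      \<open>3 / (8 * N)\<close> and costs at most \<open>15 / 4 * (N - 1)\<close>.\<close>
    have "K * K * ((8 * real N + 2) * (real N - 1)) < 8 * real N * real N"
    proof -
      have "1 / (8 * real N) * (1 / (8 * real N)) \<le> 1 / (8 * real N)"
        using N1 by (intro mult_left_le) auto
      then have "K * K \<le> 1 + 3 / (8 * real N)" unfolding K_def by (simp add: algebra_simps)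
      moreover have "0 \<le> (8 * real N + 2) * (real N - 1)" using N1 by simp
      ultimately have "K * K * ((8 * real N + 2) * (real N - 1))
          \<le> (1 + 3 / (8 * real N)) * ((8 * real N + 2) * (real N - 1))"
        by (rule mult_right_mono)
      also have "\<dots> = (8 * real N + 2) * (real N - 1) + 3 * (real N - 1) * ((8 * real N + 2) / (8 * real N))"
        by (simp add: algebra_simps add_divide_distrib)
      also have "\<dots> \<le> (8 * real N + 2) * (real N - 1) + 3 * (real N - 1) * (5 / 4)"
        using N1 by (intro add_left_mono mult_left_mono) (simp_all add: field_simps)
      also have "\<dots> < 8 * real N * real N" using N1 by (simp add: algebra_simps)
      finally show ?thesis .
    qed
    then have "(8 * real N + 2) * K * (real N - 1) / (2 * real N) < (8 * real N) / (2 * K)"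
      using K1 N1 by (simp add: field_simps)
    then show ?thesis unfolding \<alpha>_def RN by (simp add: algebra_simps)
  qed
  have "\<exists>B. \<forall>d' L f. riemannian_circle d' L \<longrightarrow> qi_embedding K C (sphere 0 1) d' X \<sigma> f \<longrightarrow> L \<le> B"
    if C: "0 < C" for C
  proof (intro exI[of _ "((real R - 1) * C + real R + 2 * (real R + 1) * C + 2) / \<alpha>"] allI impI)
    fix d' L f assume circ: "riemannian_circle d' L" and qi: "qi_embedding K C (sphere 0 1) d' X \<sigma> f"
    show "L \<le> ((real R - 1) * C + real R + 2 * (real R + 1) * C + 2) / \<alpha>"
    proof (rule ccontr)
      assume "\<not> ?thesis"
      then have "((real R - 1) * C + real R + 2 * (real R + 1) * C + 2) / \<alpha> < L" by simp
      then have big: "(real R - 1) * C + real R + 2 * (real R + 1) * C + 2 < \<alpha> * L"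
        using \<alpha> by (simp add: pos_divide_less_eq mult.commute)
      have gc: "geodesic_circle d'"
        using circ unfolding riemannian_circle_def geodesic_circle_def geodesic_circle_axioms_def by blast
      have len: "curve_length d' unit_circle = ereal L" using circ unfolding riemannian_circle_def by blast
      have N2: "0 < 2 * N" using N_pos by simp
      obtain c where c: "\<And>i. c i \<in> sphere 0 1"
        "\<And>i j. d' (c i) (c (i + j)) \<le> real j * (L / (2 * real (2 * N)))"
        "\<And>i. L / 2 \<le> d' (c i) (c (i + 2 * N))" "\<And>i. c (i + 2 * (2 * N)) = c i"
        by (rule geodesic_circle.evenly_spaced_points[OF gc len N2]) (rule that)
      interpret S: geodesic_circle d' by (rule gc)
      have "0 \<le> real 1 * (L / (2 * real (2 * N)))" by (rule order.trans[OF S.nonneg c(2)[of 0 1]])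
      then have L0: "0 \<le> L" using N1 by (simp add: zero_le_divide_iff)
      have fX: "f (c i) \<in> X" for i using qi c(1) unfolding qi_embedding_def by blast
      have fq: "d' (c i) (c j) / K - C \<le> \<sigma> (f (c i)) (f (c j))" "\<sigma> (f (c i)) (f (c j)) \<le> K * d' (c i) (c j) + C"
        for i j using qi c(1) unfolding qi_embedding_def by blast+
      define T where "T = (real R + 1) * (K * ((real N - 1) * (L / (4 * real N))) + C)"
      have T0: "0 \<le> T" unfolding T_def using K1 N1 L0 C by simp
      define k where "k = nat \<lfloor>T\<rfloor> + 1"
      have k: "T < real k" "real k \<le> T + 1" unfolding k_def using T0 by linarith+
      have near': "real (n (f (c i)) (f (c (i + j)))) \<le> T" if "j < N" for i j
      proof -
        have "d' (c i) (c (i + j)) \<le> (real N - 1) * (L / (4 * real N))"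
        proof -
          have "real j * (L / (4 * real N)) \<le> (real N - 1) * (L / (4 * real N))"
            by (rule mult_right_mono) (use that L0 in auto)
          then show ?thesis using c(2)[of i j] by simp
        qed
        then have "K * d' (c i) (c (i + j)) \<le> K * ((real N - 1) * (L / (4 * real N)))"
          using K1 by (intro mult_left_mono) auto
        then have s: "\<sigma> (f (c i)) (f (c (i + j))) \<le> K * ((real N - 1) * (L / (4 * real N))) + C"
          using fq(2)[of i "i + j"] by linarith
        have "n (f (c i)) (f (c (i + j))) \<le> (R + 1) * step_dist R (f (c i)) (f (c (i + j)))"
          by (rule step_dist_lower[OF fX fX])
        then have "real (n (f (c i)) (f (c (i + j)))) \<le> real ((R + 1) * step_dist R (f (c i)) (f (c (i + j))))"
          by (rule of_nat_mono)
        also have "\<dots> = (real R + 1) * \<sigma> (f (c i)) (f (c (i + j)))" unfolding \<sigma>_def using fX by (simp add: algebra_simps)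
        also have "\<dots> \<le> T" unfolding T_def using s by (intro mult_left_mono) auto
        finally show ?thesis .
      qed
      have near: "n (f (c i)) (f (c j)) < k" "real (n (f (c i)) (f (c j))) \<le> T" if "i < j + N" "j < i + N" for i j
      proof -
        show *: "real (n (f (c i)) (f (c j))) \<le> T"
        proof (cases "i \<le> j")
          case True
          then show ?thesis using near'[of "j - i" i] that by simp
        next
          case False
          then show ?thesis using near'[of "i - j" j] that n_sym[OF fX fX, of i j] by simp
        qed
        show "n (f (c i)) (f (c j)) < k" using * k by linarith
      qed
      have far: "2 * T + 2 < real (n (f (c i)) (f (c (i + 2 * N))))" for i
      proof -
        have "L / 2 / K - C \<le> d' (c i) (c (i + 2 * N)) / K - C"
          using divide_right_mono[OF c(3)[of i], of K] K1 by simp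
        then have s: "L / 2 / K - C \<le> \<sigma> (f (c i)) (f (c (i + 2 * N)))" using fq(1)[of i "i + 2 * N"] by linarith
        have "real ((R - 1) * step_dist R (f (c i)) (f (c (i + 2 * N)))) \<le> real (n (f (c i)) (f (c (i + 2 * N))) + R)"
          by (rule of_nat_mono[OF step_dist_upper[OF fX fX]])
        then have "(real R - 1) * \<sigma> (f (c i)) (f (c (i + 2 * N))) \<le> real (n (f (c i)) (f (c (i + 2 * N)))) + real R"
          unfolding \<sigma>_def using fX R by (simp add: of_nat_diff)
        moreover have "(real R - 1) * (L / 2 / K - C) \<le> (real R - 1) * \<sigma> (f (c i)) (f (c (i + 2 * N)))"
          using s R by (intro mult_left_mono) auto
        moreover have "2 * T + 2 + real R < (real R - 1) * (L / 2 / K - C)"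
        proof -
          have "(real R - 1) * (L / 2 / K - C) - 2 * T = \<alpha> * L - (real R - 1) * C - 2 * (real R + 1) * C"
            unfolding \<alpha>_def T_def by (simp add: algebra_simps diff_divide_distrib add_divide_distrib)
          then show ?thesis using big by linarith
        qed
        ultimately show ?thesis by linarith
      qed
      define p where "p i = f (c (2 * i))" for i
      define q where "q i = f (c (2 * i + 2 * N))" for i
      have p': "p i = f (c (2 * i + 4 * N))" for i unfolding p_def using c(4)[of "2 * i"] by simp
      have m: "2 * T + 2 < real (n (p i) (q i))" for i unfolding p_def q_def by (rule far)
      have high: "n s (q i) + k + 1 < n (p i) (q i)" if "real (n s (q i)) \<le> T" for s i
        using m[of i] that k by linarith
      show False
      proof (rule n_crossing[of p q "\<lambda>_. k", OF _ refl refl])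
        show "p i \<in> X \<and> q i \<in> X \<and> k < n (p i) (q i)" if "i < N" for i
          using m[of i] k T0 fX unfolding p_def q_def by auto
        fix i j assume ij: "i < j" "j < N"
        \<comment> \<open>The four witnesses have the indices \<open>i + j\<close>,
          \<open>i + j + N\<close>, \<open>i + j + 2 * N\<close> and \<open>i + j + 3 * N\<close>.
          The first is midway between the even indices of \<open>p i\<close> and \<open>p j\<close>;
          as \<open>0 < j - i < N\<close>, each of the four is less than \<open>N\<close> away from
          one end of either antipodal pair, and all combinations of ends occur.\<close>
        have 1: "n (p i) (f (c (i + j))) < k" "n (p j) (f (c (i + j))) < k"
          unfolding p_def using near(1) ij by auto
        have 2: "n (p i) (f (c (i + j + 3 * N))) < k" "real (n (f (c (i + j + 3 * N))) (q j)) \<le> T"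
          unfolding p' q_def using near(1) near(2) ij by auto
        have 3: "real (n (f (c (i + j + N))) (q i)) \<le> T" "n (p j) (f (c (i + j + N))) < k"
          unfolding p_def q_def using near(1) near(2) ij by auto
        have 4: "real (n (f (c (i + j + 2 * N))) (q i)) \<le> T" "real (n (f (c (i + j + 2 * N))) (q j)) \<le> T"
          unfolding q_def using near(2) ij by auto
        show "(\<exists>s\<in>X. n (p i) s < k \<and> n (p j) s < k) \<and>
          (\<exists>s\<in>X. n (p i) s < k \<and> n s (q j) + k + 1 < n (p j) (q j)) \<and>
          (\<exists>s\<in>X. n s (q i) + k + 1 < n (p i) (q i) \<and> n (p j) s < k) \<and>
          (\<exists>s\<in>X. n s (q i) + k + 1 < n (p i) (q i) \<and> n s (q j) + k + 1 < n (p j) (q j))"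
          using 1 2 3 4 high fX by blast
      qed
    qed
  qed
  then show ?thesis
    unfolding strongly_shortcut_def using \<sigma>_roughly_geodesic K1 by blast
qed

end

theorem exists_strongly_shortcut_metric:
  "\<exists>\<sigma>. Metric_space X \<sigma> \<and> roughly_geodesic X \<sigma> \<and> quasi_isometric X \<sigma> X d \<and> strongly_shortcut X \<sigma>"
proof -
  have R: "2 \<le> 8 * N + 1" using N_pos by simp
  show ?thesis
    using \<sigma>_metric[OF R] \<sigma>_roughly_geodesic[OF R] \<sigma>_quasi_isometric[OF R] \<sigma>_strongly_shortcut[OF R refl]
    by blast
qed

end

subsection \<open>Distances between sets\<close>

lemma set_dist_lessE:
  assumes "set_dist d A B < r" "A \<noteq> {}" "B \<noteq> {}"
  obtains a b where "a \<in> A" "b \<in> B" "d a b < r"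
proof -
  have "Inf ((\<lambda>(a, b). d a b) ` (A \<times> B)) < r" using assms(1) unfolding set_dist_def .
  then show thesis using cInf_lessD[of "(\<lambda>(a, b). d a b) ` (A \<times> B)" r] assms(2,3) that by auto
qed

lemma set_dist_ge:
  assumes "A \<noteq> {}" "B \<noteq> {}" "\<And>a b. a \<in> A \<Longrightarrow> b \<in> B \<Longrightarrow> r \<le> d a b"
  shows "r \<le> set_dist d A B"
  unfolding set_dist_def by (rule cINF_greatest) (use assms in auto)

subsection \<open>Consequences of the axioms\<close>

context hierarchically_hyperbolic_space
begin

abbreviation dp :: "'u \<Rightarrow> 'a \<Rightarrow> 'a \<Rightarrow> real"
  where "dp U x y \<equiv> dC U (\<pi> U x) (\<pi> U y)"

abbreviation projects :: "'u \<Rightarrow> 'u \<Rightarrow> bool"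
  where "projects U V \<equiv> U \<sqsubset> V \<or> U \<pitchfork> V"

text \<open>All points of \<open>\<rho> U V\<close> are required to be close because the infimum in
  \<open>set_dist\<close> need not be attained; as these sets have diameter at most
  \<open>E\<close>, the price is one more \<open>E\<close>, and the bounds compose by the triangle
  inequality.\<close>

definition near_rho :: "'u \<Rightarrow> 'u \<Rightarrow> 'c \<Rightarrow> real \<Rightarrow> bool"
  where "near_rho U V w c \<longleftrightarrow> (\<forall>q\<in>\<rho> U V. dC V w q \<le> c)"

lemma dom_nonneg [simp]: "U \<in> \<SS> \<Longrightarrow> 0 \<le> dC U p q"
  by (rule Metric_space.nonneg[OF domain_metric])

lemma dom_commute: "U \<in> \<SS> \<Longrightarrow> dC U p q = dC U q p"
  by (rule Metric_space.commute[OF domain_metric])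

lemma dom_triangle:
  "U \<in> \<SS> \<Longrightarrow> p \<in> \<C> U \<Longrightarrow> q \<in> \<C> U \<Longrightarrow> r \<in> \<C> U \<Longrightarrow> dC U p r \<le> dC U p q + dC U q r"
  by (rule Metric_space.triangle[OF domain_metric])

lemma dom_zero [simp]: "U \<in> \<SS> \<Longrightarrow> p \<in> \<C> U \<Longrightarrow> dC U p p = 0"
  by (simp add: Metric_space.mdist_zero[OF domain_metric])

lemma pi_in [simp]: "U \<in> \<SS> \<Longrightarrow> x \<in> X \<Longrightarrow> \<pi> U x \<in> \<C> U"
  using proj_in by auto

lemma nest_self: "U \<in> \<SS> \<Longrightarrow> U \<sqsubseteq> U"
  using nest_refl by (simp add: reflp_on_def)

lemma nest_transD: "U \<in> \<SS> \<Longrightarrow> V \<in> \<SS> \<Longrightarrow> W \<in> \<SS> \<Longrightarrow> U \<sqsubseteq> V \<Longrightarrow> V \<sqsubseteq> W \<Longrightarrow> U \<sqsubseteq> W"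
  using nest_trans unfolding transp_on_def by blast

lemma nest_antisymD: "U \<in> \<SS> \<Longrightarrow> V \<in> \<SS> \<Longrightarrow> U \<sqsubseteq> V \<Longrightarrow> V \<sqsubseteq> U \<Longrightarrow> U = V"
  using nest_antisym unfolding antisymp_on_def by blast

lemma orth_symD: "U \<in> \<SS> \<Longrightarrow> V \<in> \<SS> \<Longrightarrow> U \<perp> V \<Longrightarrow> V \<perp> U"
  using orth_sym unfolding symp_on_def by blast

lemma orth_nest': "\<lbrakk>U \<in> \<SS>; V \<in> \<SS>; W \<in> \<SS>; U \<sqsubseteq> V; W \<perp> V\<rbrakk> \<Longrightarrow> W \<perp> U"
  using orth_nest[of U V W] orth_symD[of W V] orth_symD[of U W] by blast

lemma transverse_sym: "U \<in> \<SS> \<Longrightarrow> V \<in> \<SS> \<Longrightarrow> U \<pitchfork> V \<Longrightarrow> V \<pitchfork> U"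
  unfolding transverse_def using orth_symD by blast

lemma domain_trichotomy:
  assumes "U \<in> \<SS>" "V \<in> \<SS>" "\<not> projects U V"
  shows "V \<perp> U \<or> V \<sqsubseteq> U"
proof (cases "U = V")
  case True
  then show ?thesis using nest_self assms by blast
next
  case False
  then show ?thesis using assms orth_symD[of U V] unfolding pnest_def transverse_def by blast
qed

lemma rho_props:
  assumes "U \<in> \<SS>" "V \<in> \<SS>" "projects U V"
  shows "\<rho> U V \<noteq> {}" "\<rho> U V \<subseteq> \<C> V" "\<And>q q'. q \<in> \<rho> U V \<Longrightarrow> q' \<in> \<rho> U V \<Longrightarrow> dC V q q' \<le> E"
proof -
  have "\<rho> U V \<noteq> {} \<and> \<rho> U V \<subseteq> \<C> V \<and> diam_le (dC V) (\<rho> U V) E"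
    using assms(3) rho_nest[OF assms(1,2)] rho_transverse[OF assms(1,2)] by blast
  then show "\<rho> U V \<noteq> {}" "\<rho> U V \<subseteq> \<C> V"
    "\<And>q q'. q \<in> \<rho> U V \<Longrightarrow> q' \<in> \<rho> U V \<Longrightarrow> dC V q q' \<le> E"
    unfolding diam_le_def by auto
qed

lemma near_rho_of_set_dist:
  assumes "U \<in> \<SS>" "V \<in> \<SS>" "projects U V" "w \<in> \<C> V" "set_dist (dC V) {w} (\<rho> U V) \<le> E"
  shows "near_rho U V w (2 * E)"
  unfolding near_rho_def
proof (rule ballI, rule field_le_epsilon)
  fix q and \<epsilon> :: real assume q: "q \<in> \<rho> U V" and "0 < \<epsilon>"
  then have "set_dist (dC V) {w} (\<rho> U V) < E + \<epsilon>" using assms by simp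
  then obtain q' where q': "q' \<in> \<rho> U V" "dC V w q' < E + \<epsilon>"
    by (rule set_dist_lessE) (use rho_props[OF assms(1-3)] in auto)
  have "dC V w q \<le> dC V w q' + dC V q' q"
    by (rule dom_triangle) (use assms q q' rho_props[OF assms(1-3)] in auto)
  then show "dC V w q \<le> 2 * E + \<epsilon>" using q' rho_props(3)[OF assms(1-3) q'(1) q] by simp
qed

lemma near_rho_close:
  assumes "U \<in> \<SS>" "V \<in> \<SS>" "projects U V" "near_rho U V w c" "near_rho U V w' c'" "w \<in> \<C> V" "w' \<in> \<C> V"
  shows "dC V w w' \<le> c + c'"
proof -
  obtain q where q: "q \<in> \<rho> U V" using rho_props[OF assms(1-3)] by blast
  have "dC V w w' \<le> dC V w q + dC V q w'"
    by (rule dom_triangle) (use assms q rho_props[OF assms(1-3)] in auto)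
  moreover have "dC V w q \<le> c" "dC V w' q \<le> c'" using assms(4,5) q unfolding near_rho_def by auto
  ultimately show ?thesis using dom_commute[OF assms(2), of q w'] by linarith
qed

lemma near_rho_close2:
  assumes "V \<in> \<SS>" "near_rho U V w c" "near_rho U' V w' c'" "w \<in> \<C> V" "w' \<in> \<C> V"
    and "q \<in> \<rho> U V" "q' \<in> \<rho> U' V" "q \<in> \<C> V" "q' \<in> \<C> V" "dC V q q' \<le> e"
  shows "dC V w w' \<le> c + c' + e"
proof -
  have "dC V w w' \<le> dC V w q + dC V q w'" "dC V q w' \<le> dC V q q' + dC V q' w'"
    by (rule dom_triangle; use assms in auto)+
  moreover have "dC V w q \<le> c" "dC V w' q' \<le> c'" using assms unfolding near_rho_def by auto
  ultimately show ?thesis using assms dom_commute[OF assms(1), of q' w'] by linarith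
qed

lemma near_rho_shift:
  assumes "U \<in> \<SS>" "V \<in> \<SS>" "projects U V" "near_rho U V w c" "w \<in> \<C> V" "w' \<in> \<C> V" 
    "dC V w' w \<le> e"
  shows "near_rho U V w' (c + e)"
  unfolding near_rho_def
proof
  fix q assume q: "q \<in> \<rho> U V"
  have "dC V w' q \<le> dC V w' w + dC V w q"
    by (rule dom_triangle) (use assms q rho_props[OF assms(1-3)] in auto)
  moreover have "dC V w q \<le> c" using assms(4) q unfolding near_rho_def by auto
  ultimately show "dC V w' q \<le> c + e" using assms(7) by linarith
qed

lemma near_rho_mono: "near_rho U V w c \<Longrightarrow> c \<le> c' \<Longrightarrow> near_rho U V w c'"
  unfolding near_rho_def by force

lemma near_rho_of_point:
  assumes "U \<in> \<SS>" "V \<in> \<SS>" "projects U V" "w \<in> \<C> V" "q \<in> \<rho> U V" "dC V w q \<le> c"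
  shows "near_rho U V w (c + E)"
  unfolding near_rho_def
proof
  fix q' assume q': "q' \<in> \<rho> U V"
  have "dC V w q' \<le> dC V w q + dC V q q'"
    by (rule dom_triangle) (use assms q' rho_props[OF assms(1-3)] in auto)
  then show "dC V w q' \<le> c + E" using rho_props(3)[OF assms(1-3,5) q'] assms by linarith
qed

lemma transverse_dichotomy:
  assumes "U \<in> \<SS>" "V \<in> \<SS>" "U \<pitchfork> V" "x \<in> X"
  shows "near_rho V U (\<pi> U x) (2 * E) \<or> near_rho U V (\<pi> V x) (2 * E)"
  using consistency_transverse[OF assms] near_rho_of_set_dist[of U V "\<pi> V x"]
    near_rho_of_set_dist[of V U "\<pi> U x"] assms transverse_sym[OF assms(1-3)]
  by (auto simp: min_le_iff_disj)

lemma nest_dichotomy: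
  assumes "U \<in> \<SS>" "V \<in> \<SS>" "U \<sqsubset> V" "x \<in> X"
  shows "near_rho U V (\<pi> V x) (2 * E) \<or> dC U (\<pi> U x) (\<rho>m V U (\<pi> V x)) \<le> E"
  using consistency_nest[OF assms] near_rho_of_set_dist[of U V "\<pi> V x"] assms
  unfolding diam_le_def by auto

text \<open>The slack 1 turns a lower bound for all distances into an infimum strictly above
  \<open>E\<close>, as the bounded geodesic image axiom demands.\<close>

lemma geodesic_image_dichotomy:
  assumes "U \<in> \<SS>" "V \<in> \<SS>" "U \<sqsubset> V" "p \<in> \<C> V" "q \<in> \<C> V" "geodesic_segment (\<C> V) (dC V) p q \<gamma>"
  shows "(\<exists>g\<in>\<gamma>. \<exists>r\<in>\<rho> U V. dC V g r \<le> E + 1) \<or> dC U (\<rho>m V U p) (\<rho>m V U q) \<le> E"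
proof (rule disjCI)
  assume far: "\<not> dC U (\<rho>m V U p) (\<rho>m V U q) \<le> E"
  have pq: "p \<in> \<gamma>" "q \<in> \<gamma>"
    using assms(6) dom_nonneg[OF assms(2)] unfolding geodesic_segment_def
    by (metis atLeastAtMost_iff image_eqI order_refl)+
  show "\<exists>g\<in>\<gamma>. \<exists>r\<in>\<rho> U V. dC V g r \<le> E + 1"
  proof (rule ccontr)
    assume "\<not> ?thesis"
    then have "E + 1 \<le> set_dist (dC V) \<gamma> (\<rho> U V)"
      using pq rho_props(1)[of U V] assms by (intro set_dist_ge) force+
    then show False
      using bounded_geodesic_image[OF assms] far pq unfolding diam_le_def by auto
  qed
qed

lemma rho_related:
  assumes "U \<in> \<SS>" "V \<in> \<SS>" "W \<in> \<SS>" "U \<sqsubseteq> V" "V \<sqsubset> W \<or> (V \<pitchfork> W \<and> \<not> W \<perp> U)"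
  obtains q q' where "q \<in> \<rho> U W" "q' \<in> \<rho> V W" "dC W q q' \<le> E + 1" "q \<in> \<C> W" "q' \<in> \<C> W"
    "projects U W" "projects V W"
proof -
  have 1: "projects U W"
  proof (cases "V \<sqsubset> W")
    case True
    then show ?thesis using assms nest_transD[of U V W] nest_antisymD[of U V] unfolding pnest_def by blast
  next
    case False
    then have *: "V \<pitchfork> W" "\<not> W \<perp> U" using assms by auto
    have "\<not> U \<perp> W" using *(2) assms orth_symD by blast
    moreover have "\<not> W \<sqsubseteq> U" using nest_transD[of W U V] assms * unfolding transverse_def by blast
    ultimately show ?thesis unfolding pnest_def transverse_def using nest_self assms by blast
  qed
  have 2: "projects V W" using assms by blast
  have "set_dist (dC W) (\<rho> U W) (\<rho> V W) < E + 1"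
    using rho_consistency[OF assms] by linarith
  then obtain q q' where q: "q \<in> \<rho> U W" "q' \<in> \<rho> V W" "dC W q q' < E + 1"
    by (rule set_dist_lessE) (use rho_props(1) 1 2 assms in auto)
  moreover have "q \<in> \<C> W" "q' \<in> \<C> W"
    using rho_props(2)[OF assms(1,3) 1] rho_props(2)[OF assms(2,3) 2] q by auto
  ultimately show thesis using that 1 2 by fastforce
qed

lemma partial_realisation':
  assumes "\<U> \<subseteq> \<SS>" "pairwise (\<perp>) \<U>" "\<And>U. U \<in> \<U> \<Longrightarrow> b U \<in> \<C> U"
  obtains x where "x \<in> X" "\<And>U. U \<in> \<U> \<Longrightarrow> dC U (\<pi> U x) (b U) \<le> E"
    "\<And>U V. U \<in> \<U> \<Longrightarrow> V \<in> \<SS> \<Longrightarrow> projects U V \<Longrightarrow> near_rho U V (\<pi> V x) (2 * E)"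
proof -
  obtain x where x: "x \<in> X" "\<forall>U\<in>\<U>. dC U (\<pi> U x) (b U) \<le> E \<and>
             (\<forall>V\<in>\<SS>. projects U V \<longrightarrow> set_dist (dC V) {\<pi> V x} (\<rho> U V) \<le> E)"
    using partial_realisation[of \<U> b] assms by blast
  show thesis
    by (rule that[OF x(1)]) (use x assms near_rho_of_set_dist in auto)
qed

subsection \<open>Complexity\<close>

definition chains_above :: "'u \<Rightarrow> 'u set set"
  where "chains_above U =
    {\<A>. \<A> \<subseteq> \<SS> \<and> pairwise (\<lambda>U V. U \<sqsubseteq> V \<or> V \<sqsubseteq> U) \<A> \<and> (\<forall>V\<in>\<A>. U \<sqsubseteq> V)}"

text \<open>Counted from the top, so that depth grows on passing to a smaller domain; finite
  complexity bounds it by \<open>E\<close>.\<close>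

definition depth :: "'u \<Rightarrow> nat"
  where "depth U = Max (card ` chains_above U)"

lemma chains_above_card:
  "\<A> \<in> chains_above U \<Longrightarrow> finite \<A> \<and> card \<A> \<le> nat \<lfloor>E\<rfloor>"
  using finite_complexity[of \<A>] unfolding chains_above_def by (auto simp: le_nat_floor)

lemma finite_card_chains_above: "finite (card ` chains_above U)"
  by (rule finite_subset[of _ "{..nat \<lfloor>E\<rfloor>}"]) (use chains_above_card in auto)

lemma depth_ge: "\<A> \<in> chains_above U \<Longrightarrow> card \<A> \<le> depth U"
  unfolding depth_def by (rule Max_ge[OF finite_card_chains_above]) auto

lemma depth_attained:
  obtains \<A> where "\<A> \<in> chains_above U" "card \<A> = depth U"
proof -
  have "{} \<in> chains_above U" unfolding chains_above_def by auto
  then have "depth U \<in> card ` chains_above U"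
    unfolding depth_def by (intro Max_in[OF finite_card_chains_above]) auto
  then show thesis using that by auto
qed

lemma depth_pos: "U \<in> \<SS> \<Longrightarrow> 1 \<le> depth U"
  using depth_ge[of "{U}" U] nest_self unfolding chains_above_def by simp

lemma depth_le: "real (depth U) \<le> E"
proof -
  obtain \<A> where "\<A> \<in> chains_above U" "card \<A> = depth U" by (rule depth_attained)
  then show ?thesis using finite_complexity[of \<A>] unfolding chains_above_def by auto
qed

lemma depth_less:
  assumes "U \<in> \<SS>" "V \<in> \<SS>" "U \<sqsubset> V"
  shows "depth V < depth U"
proof -
  obtain \<A> where A: "\<A> \<in> chains_above V" "card \<A> = depth V" by (rule depth_attained)
  have AS: "\<A> \<subseteq> \<SS>" "\<forall>W\<in>\<A>. V \<sqsubseteq> W" using A unfolding chains_above_def by auto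
  have UW: "U \<sqsubseteq> W" if "W \<in> \<A>" for W
    using nest_transD[of U V W] assms AS that unfolding pnest_def by blast
  have "U \<notin> \<A>" using AS nest_antisymD[of U V] assms unfolding pnest_def by blast
  moreover have "insert U \<A> \<in> chains_above U"
    using A UW AS nest_self assms unfolding chains_above_def by (auto simp: pairwise_insert)
  moreover have "finite \<A>" using chains_above_card[OF A(1)] by simp
  ultimately show ?thesis using depth_ge[of "insert U \<A>" U] A(2) by simp
qed

lemma maximal_above:
  assumes "B \<subseteq> \<SS>" "U \<in> B"
  obtains M where "M \<in> B" "U \<sqsubseteq> M" "\<And>V. V \<in> B \<Longrightarrow> M \<sqsubseteq> V \<Longrightarrow> V = M"
proof -
  obtain M where M: "M \<in> B \<and> U \<sqsubseteq> M" "\<forall>V. V \<in> B \<and> U \<sqsubseteq> V \<longrightarrow> depth M \<le> depth V"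
    using ex_has_least_nat[of "\<lambda>M. M \<in> B \<and> U \<sqsubseteq> M" U depth] assms nest_self by blast
  show thesis
  proof (rule that[of M])
    fix V assume V: "V \<in> B" "M \<sqsubseteq> V"
    show "V = M"
    proof (rule ccontr)
      assume "V \<noteq> M"
      then have "depth V < depth M" using depth_less[of M V] V M assms unfolding pnest_def by blast
      moreover have "U \<sqsubseteq> V" using nest_transD[of U M V] V M assms by blast
      ultimately show False using M V by auto
    qed
  qed (use M in auto)
qed

text \<open>The axiom only provides a unique maximal element. By finite complexity every domain lies
  below some maximal one, which must be this element.\<close>

lemma top_domain:
  assumes "\<SS> \<noteq> {}"
  obtains M where "M \<in> \<SS>" "\<And>U. U \<in> \<SS> \<Longrightarrow> U \<sqsubseteq> M"
proof -
  obtain M where M: "M \<in> \<SS>" "\<And>N. N \<in> \<SS> \<Longrightarrow> (\<forall>V\<in>\<SS>. N \<sqsubseteq> V \<longrightarrow> V = N) \<Longrightarrow> N = M"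
    using nest_maximal[OF assms] by blast
  show thesis
  proof (rule that[OF M(1)])
    fix U assume U: "U \<in> \<SS>"
    obtain N where N: "N \<in> \<SS>" "U \<sqsubseteq> N" "\<And>V. V \<in> \<SS> \<Longrightarrow> N \<sqsubseteq> V \<Longrightarrow> V = N"
      by (rule maximal_above[OF order.refl U]) (rule that)
    then show "U \<sqsubseteq> M" using M(2)[of N] by blast
  qed
qed

text \<open>The container of the domains orthogonal to one member holds all other members and is
  properly nested in \<open>T\<close>. So each removal of a member raises the depth of the ambient
  domain, which is at most \<open>E\<close>.\<close>

lemma orthogonal_card_below:
  assumes "finite \<U>" "\<U> \<noteq> {}" "\<U> \<subseteq> \<SS>" "pairwise (\<perp>) \<U>" "T \<in> \<SS>" "\<And>U. U \<in> \<U> \<Longrightarrow> U \<sqsubseteq> T"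
  shows "real (card \<U>) + real (depth T) \<le> E + 1"
  using assms
proof (induction \<U> arbitrary: T rule: finite_ne_induct)
  case (singleton U)
  then show ?case using depth_le[of T] by simp
next
  case (insert U \<U>)
  obtain V where V: "V \<in> \<U>" using insert by blast
  have orth: "W \<perp> U" if "W \<in> \<U>" for W
    using that insert orth_symD[of U W] by (auto simp: pairwise_insert)
  then obtain W where W: "W \<in> \<SS>" "W \<sqsubset> T" "\<forall>V\<in>\<SS>. V \<sqsubseteq> T \<and> V \<perp> U \<longrightarrow> V \<sqsubseteq> W"
    using containers[of T U] insert V by blast
  have "real (card \<U>) + real (depth W) \<le> E + 1"
  proof (rule insert.IH)
    show "pairwise (\<perp>) \<U>" using insert by (auto simp: pairwise_insert)
  qed (use insert W orth in auto)
  moreover have "depth T < depth W" using depth_less W insert by blast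
  ultimately show ?case using insert by simp
qed

lemma orthogonal_card:
  assumes "finite \<U>" "\<U> \<subseteq> \<SS>" "pairwise (\<perp>) \<U>"
  shows "real (card \<U>) \<le> E"
proof (cases "\<U> = {}")
  case True
  then show ?thesis using E_ge_1 by simp
next
  case False
  then obtain T where T: "T \<in> \<SS>" "\<And>U. U \<in> \<SS> \<Longrightarrow> U \<sqsubseteq> T"
    using assms top_domain by (metis subset_empty)
  have "real (card \<U>) + real (depth T) \<le> E + 1"
    by (rule orthogonal_card_below) (use False T assms in auto)
  then show ?thesis using depth_pos[OF T(1)] by simp
qed

text \<open>By large links the relevant domains properly nested in \<open>W\<close> lie below
  finitely many domains. These have larger depth than \<open>W\<close>, so the recursion
  ends.\<close>

lemma finite_relevant:
  assumes "x \<in> X" "y \<in> X"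
  shows "finite {U \<in> \<SS>. E \<le> dp U x y}"
proof -
  have fin: "finite {T \<in> \<SS>. T \<sqsubseteq> W \<and> E \<le> dp T x y}" if "W \<in> \<SS>" for W
    using that
  proof (induction "nat \<lfloor>E\<rfloor> - depth W" arbitrary: W rule: less_induct)
    case less
    obtain \<T> where \<T>: "\<T> \<subseteq> {T \<in> \<SS>. T \<sqsubset> W}" "finite \<T>"
      "\<forall>T\<in>\<SS>. T \<sqsubset> W \<longrightarrow> (\<exists>T'\<in>\<T>. T \<sqsubseteq> T') \<or> dp T x y < E"
      using large_links[OF less.prems assms refl] by blast
    have "finite {T \<in> \<SS>. T \<sqsubseteq> T' \<and> E \<le> dp T x y}" if "T' \<in> \<T>" for T'
    proof (rule less.hyps)
      have "depth W < depth T'" using depth_less \<T>(1) that less.prems by blast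
      moreover have "depth T' \<le> nat \<lfloor>E\<rfloor>" using depth_le by (simp add: le_nat_floor)
      ultimately show "nat \<lfloor>E\<rfloor> - depth T' < nat \<lfloor>E\<rfloor> - depth W" by linarith
    qed (use \<T>(1) that in auto)
    then have "finite ({W} \<union> (\<Union>T'\<in>\<T>. {T \<in> \<SS>. T \<sqsubseteq> T' \<and> E \<le> dp T x y}))" using \<T>(2) by auto
    moreover have "{T \<in> \<SS>. T \<sqsubseteq> W \<and> E \<le> dp T x y}
      \<subseteq> {W} \<union> (\<Union>T'\<in>\<T>. {T \<in> \<SS>. T \<sqsubseteq> T' \<and> E \<le> dp T x y})"
      using \<T>(3) unfolding pnest_def by fastforce
    ultimately show ?case by (rule rev_finite_subset)
  qed
  show ?thesis
  proof (cases "\<SS> = {}")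
    case False
    then obtain M where "M \<in> \<SS>" "\<And>U. U \<in> \<SS> \<Longrightarrow> U \<sqsubseteq> M" by (rule top_domain) (rule that)
    then show ?thesis using fin[of M] by (auto elim: rev_finite_subset)
  qed auto
qed


subsection \<open>Realisation\<close>

definition consistent :: "real \<Rightarrow> ('u \<Rightarrow> 'c) \<Rightarrow> bool"
  where "consistent \<kappa> b \<longleftrightarrow>
    (\<forall>U\<in>\<SS>. b U \<in> \<C> U) \<and>
    (\<forall>U\<in>\<SS>. \<forall>V\<in>\<SS>. U \<pitchfork> V \<longrightarrow> near_rho V U (b U) \<kappa> \<or> near_rho U V (b V) \<kappa>) \<and>
    (\<forall>U\<in>\<SS>. \<forall>V\<in>\<SS>. U \<sqsubset> V \<longrightarrow> near_rho U V (b V) \<kappa> \<or> dC U (b U) (\<rho>m V U (b V)) \<le> \<kappa>)"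

section \<open>Bad domains and their order\<close>

context
  fixes \<kappa> B :: real and b :: "'u \<Rightarrow> 'c" and p :: 'a
  assumes cons: "consistent \<kappa> b" and \<kappa>: "0 \<le> \<kappa>" and p: "p \<in> X" and B: "10 * E + \<kappa> \<le> B"
begin

definition bad :: "'u \<Rightarrow> bool"
  where "bad U \<longleftrightarrow> U \<in> \<SS> \<and> B < dC U (\<pi> U p) (b U)"

text \<open>The order in which a path from \<open>p\<close> to the tuple \<open>b\<close> would pass through the bad domains.\<close>

definition before :: "'u \<Rightarrow> 'u \<Rightarrow> bool"
  where "before U V \<longleftrightarrow> U \<pitchfork> V \<and> near_rho V U (b U) \<kappa>"

lemma b_in [simp]: "U \<in> \<SS> \<Longrightarrow> b U \<in> \<C> U"
  using cons unfolding consistent_def by blast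

lemma badD: "bad U \<Longrightarrow> U \<in> \<SS>" "bad U \<Longrightarrow> B < dC U (\<pi> U p) (b U)"
  unfolding bad_def by auto

lemma before_total:
  assumes "bad U" "bad V" "U \<pitchfork> V"
  shows "before U V \<or> before V U"
  using cons assms badD transverse_sym[of U V] unfolding consistent_def before_def by blast

text \<open>The source of most contradictions below: in a bad domain \<open>p\<close> and
  \<open>b\<close> are too far apart to be close to the same \<open>\<rho>\<close>-set.\<close>

lemma bad_not_near:
  assumes "bad U" "W \<in> \<SS>" "projects W U" "near_rho W U (b U) c" "near_rho W U (\<pi> U p) c'"
    "c + c' \<le> 10 * E + \<kappa>"
  shows False
proof -
  have "dC U (\<pi> U p) (b U) \<le> c' + c"
    by (rule near_rho_close[of W]) (use assms badD p in auto)
  then show False using assms badD B by fastforce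
qed

text \<open>In \<open>U\<close> the coordinate of \<open>b\<close> is near
  \<open>\<rho> V U\<close>, so that of \<open>p\<close> is not, because \<open>U\<close> is bad;
  the consistency axiom then moves to \<open>V\<close>.\<close>

lemma before_near:
  assumes "bad U" "bad V" "before U V"
  shows "near_rho U V (\<pi> V p) (2 * E)"
proof -
  have tr: "U \<pitchfork> V" "V \<pitchfork> U" using assms transverse_sym badD unfolding before_def by auto
  have "\<not> near_rho V U (\<pi> U p) (2 * E)"
    using bad_not_near[of U V \<kappa> "2 * E"] assms tr badD E_ge_1 unfolding before_def by auto
  then show ?thesis using transverse_dichotomy[of U V p] tr assms badD p by blast
qed

lemma before_irrefl: "bad U \<Longrightarrow> \<not> before U U"
  using nest_self badD unfolding before_def transverse_def by blast

text \<open>In \<open>V\<close> the point \<open>p\<close> is near \<open>\<rho> U V\<close> and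
  \<open>b\<close> is near \<open>\<rho> W V\<close>, so these sets are far apart. If
  \<open>U\<close> and \<open>W\<close> were nested or orthogonal, they would be close; hence
  \<open>U\<close> and \<open>W\<close> are transverse, and only the order remains to be
  decided.\<close>

lemma before_trans:
  assumes bad: "bad U" "bad V" "bad W" and UV: "before U V" and VW: "before V W"
  shows "before U W"
proof -
  note S = badD(1)[OF bad(1)] badD(1)[OF bad(2)] badD(1)[OF bad(3)]
  have tr: "U \<pitchfork> V" "V \<pitchfork> U" "V \<pitchfork> W" "W \<pitchfork> V"
    using UV VW transverse_sym S unfolding before_def by auto
  have n1: "near_rho V U (b U) \<kappa>" "near_rho U V (\<pi> V p) (2 * E)"
    using UV before_near bad unfolding before_def by auto
  have n2: "near_rho W V (b V) \<kappa>" "near_rho V W (\<pi> W p) (2 * E)"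
    using VW before_near bad unfolding before_def by auto
  have far: "E + 1 < dC V q q'" if "q \<in> \<rho> U V" "q' \<in> \<rho> W V" for q q'
  proof (rule ccontr)
    assume "\<not> ?thesis"
    then have "dC V (\<pi> V p) (b V) \<le> 2 * E + \<kappa> + (E + 1)"
      using rho_props(2)[of U V] rho_props(2)[of W V] tr S that p
      by (intro near_rho_close2[OF S(2) n1(2) n2(1)]) auto
    then show False using badD(2)[OF bad(2)] B E_ge_1 by simp
  qed
  have nVU: "\<not> V \<perp> U" "\<not> V \<perp> W" using tr unfolding transverse_def by auto
  have "\<not> U \<sqsubseteq> W"
  proof
    assume "U \<sqsubseteq> W"
    then obtain q q' where "q \<in> \<rho> U V" "q' \<in> \<rho> W V" "dC V q q' \<le> E + 1"
      using rho_related[of U W V] S tr nVU by metis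
    then show False using far by force
  qed
  moreover have "\<not> W \<sqsubseteq> U"
  proof
    assume "W \<sqsubseteq> U"
    then obtain q q' where "q \<in> \<rho> W V" "q' \<in> \<rho> U V" "dC V q q' \<le> E + 1"
      using rho_related[of W U V] S tr nVU by metis
    then show False using far[of q' q] dom_commute[OF S(2), of q q'] by simp
  qed
  moreover have "\<not> U \<perp> W"
  proof
    assume "U \<perp> W"
    then have "pairwise (\<perp>) {U, W}" using orth_symD S by (auto simp: pairwise_insert)
    then obtain x where x: "x \<in> X" "near_rho U V (\<pi> V x) (2 * E)" "near_rho W V (\<pi> V x) (2 * E)"
      using partial_realisation'[of "{U, W}" b] S tr
      by (metis (no_types, lifting) b_in empty_subsetI insertI1 insertI2 insert_iff insert_subset singletonD)
    have "near_rho U V (\<pi> V p) (2 * E) \<and> near_rho W V (\<pi> V p) (2 * E + (4 * E))"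
      using near_rho_shift[of W V "\<pi> V x" "2 * E" "\<pi> V p" "4 * E"]
        near_rho_close[of U V "\<pi> V p" "2 * E" "\<pi> V x" "2 * E"] n1 x S tr p by auto
    then show False using bad_not_near[of V W \<kappa> "2 * E + 4 * E"] n2 bad S tr E_ge_1 by auto
  qed
  ultimately have UW: "U \<pitchfork> W" "W \<pitchfork> U" using transverse_sym S unfolding transverse_def by auto
  show ?thesis
  proof (rule ccontr)
    assume "\<not> before U W"
    then have "before W U" using before_total[OF bad(1,3)] UW by blast
    then have n3: "near_rho W U (\<pi> U p) (2 * E)" using before_near bad by blast
    \<comment> \<open>In \<open>V\<close> this point is near \<open>\<rho> W V\<close>, so away from
      \<open>\<rho> U V\<close>, which puts it near \<open>\<rho> V U\<close> in \<open>U\<close>.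
      If \<open>W\<close> came before \<open>U\<close>, then \<open>p\<close> would be close to it
      in \<open>U\<close>, hence near \<open>\<rho> V U\<close>, where \<open>b\<close> is as
      well.\<close>
    obtain x where x: "x \<in> X" "near_rho W V (\<pi> V x) (2 * E)" "near_rho W U (\<pi> U x) (2 * E)"
      using partial_realisation'[of "{W}" b] S tr UW
      by (metis b_in empty_subsetI insert_subset pairwise_singleton singletonD singletonI)
    have "\<not> near_rho U V (\<pi> V x) (2 * E)"
    proof
      assume *: "near_rho U V (\<pi> V x) (2 * E)"
      have "near_rho W V (\<pi> V p) (2 * E + (4 * E))"
        using near_rho_shift[of W V "\<pi> V x" "2 * E" "\<pi> V p" "4 * E"]
          near_rho_close[of U V "\<pi> V p" "2 * E" "\<pi> V x" "2 * E"] n1 x S tr p * by auto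
      then show False using bad_not_near[of V W \<kappa> "2 * E + 4 * E"] n2 bad S tr E_ge_1 by auto
    qed
    then have "near_rho V U (\<pi> U x) (2 * E)" using transverse_dichotomy[of U V x] S tr x by blast
    moreover have "dC U (\<pi> U p) (\<pi> U x) \<le> 2 * E + 2 * E"
      by (rule near_rho_close[of W]) (use n3 x S UW p in auto)
    ultimately have "near_rho V U (\<pi> U p) (2 * E + (2 * E + 2 * E))"
      using near_rho_shift[of V U "\<pi> U x" "2 * E" "\<pi> U p" "2 * E + 2 * E"] S tr x p by auto
    then show False using bad_not_near[of U V \<kappa> "2 * E + (2 * E + 2 * E)"] n1 bad S tr E_ge_1 by auto
  qed
qed

text \<open>On the finite set of \<open>\<sqsubseteq>\<close>-maximal bad domains
  \<open>before\<close> is a strict partial order, and \<open>W\<close> is a last element. If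
  \<open>V\<close> came after \<open>W\<close>, a maximal bad \<open>V'\<close> above
  \<open>V\<close> would be transverse to \<open>W\<close> and come before it; as
  \<open>\<rho> V W\<close> and \<open>\<rho> V' W\<close> are close, \<open>p\<close> and
  \<open>b\<close> would be close in \<open>W\<close>.\<close>

lemma last_bad_domain:
  assumes fin: "finite {U. bad U}" and ne: "bad U0"
  obtains W where "bad W" "\<And>V. bad V \<Longrightarrow> \<not> W \<sqsubset> V" "\<And>V. bad V \<Longrightarrow> \<not> before W V"
proof -
  define M where "M = {U. bad U \<and> (\<forall>V. bad V \<longrightarrow> U \<sqsubseteq> V \<longrightarrow> V = U)}"
  have up: "\<exists>M'\<in>M. U \<sqsubseteq> M'" if "bad U" for U
  proof -
    have "{U. bad U} \<subseteq> \<SS>" "U \<in> {U. bad U}" using that badD by auto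
    then obtain M' where "M' \<in> {U. bad U}" "U \<sqsubseteq> M'" "\<And>V. V \<in> {U. bad U} \<Longrightarrow> M' \<sqsubseteq> V \<Longrightarrow> V = M'"
      by (rule maximal_above) (rule that)
    then show ?thesis unfolding M_def by auto
  qed
  have finM: "finite M" by (rule finite_subset[OF _ fin]) (auto simp: M_def)
  have Mbad: "bad U" if "U \<in> M" for U using that unfolding M_def by auto
  have "asymp_on M before" "transp_on M before"
    using before_trans before_irrefl Mbad unfolding asymp_on_def transp_on_def by blast+
  moreover have "M \<noteq> {}" using up ne by blast
  ultimately obtain W where W: "W \<in> M" "\<forall>V\<in>M. V \<noteq> W \<longrightarrow> \<not> before W V"
    using Finite_Set.bex_max_element[OF finM, of before] by blast
  have W': "\<not> before W V" if "V \<in> M" for V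
    using W before_irrefl[of W] Mbad that by metis
  show thesis
  proof (rule that[OF Mbad[OF W(1)]])
    fix V assume V: "bad V"
    show "\<not> W \<sqsubset> V" using W(1) V unfolding M_def pnest_def by auto
    show "\<not> before W V"
    proof
      assume WV: "before W V"
      obtain V' where V': "V' \<in> M" "V \<sqsubseteq> V'" using up V by blast
      note S = badD(1)[OF V] badD(1)[OF Mbad[OF W(1)]] badD(1)[OF Mbad[OF V'(1)]]
      have tr: "W \<pitchfork> V" "V \<pitchfork> W" using WV transverse_sym S unfolding before_def by auto
      have "\<not> W \<sqsubseteq> V'"
      proof
        assume "W \<sqsubseteq> V'"
        then have "V' = W" using W(1) Mbad[OF V'(1)] unfolding M_def by blast
        then show False using V'(2) tr unfolding transverse_def by blast
      qed
      moreover have "\<not> V' \<sqsubseteq> W" using nest_transD[of V V' W] S V' tr unfolding transverse_def by blast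
      moreover have "\<not> W \<perp> V'" using orth_nest'[of V V' W] S V' tr unfolding transverse_def by blast
      ultimately have tr': "W \<pitchfork> V'" "V' \<pitchfork> W" using transverse_sym S unfolding transverse_def by auto
      have "before V' W"
        using before_total[of W V'] tr' W'[OF V'(1)] Mbad V' W by blast
      then have n: "near_rho V' W (\<pi> W p) (2 * E)" using before_near Mbad V' W by blast
      obtain q q' where q: "q \<in> \<rho> V W" "q' \<in> \<rho> V' W" "dC W q q' \<le> E + 1" "q \<in> \<C> W" "q' \<in> \<C> W"
        using rho_related[of V V' W] S V' tr tr' unfolding transverse_def by metis
      have "near_rho V W (b W) \<kappa>" using WV unfolding before_def by blast
      then have "dC W (b W) (\<pi> W p) \<le> \<kappa> + 2 * E + (E + 1)"
        using near_rho_close2[OF S(2) _ n _ _ q(1,2,4,5,3)] S p by auto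
      then show False 
        using badD(2)[OF Mbad[OF W(1)]] B E_ge_1 dom_commute[OF S(2), of "b W" "\<pi> W p"] by linarith
    qed
  qed
qed

text \<open>Otherwise the geodesic from \<open>b V\<close> to \<open>\<pi> V p\<close>, which has
  length at most \<open>B\<close> because \<open>V\<close> is not bad, avoids
  \<open>\<rho> W V\<close>; by bounded geodesic image \<open>p\<close> and \<open>b\<close> would
  then be close in \<open>W\<close>.\<close>

lemma near_rho_last_bad_nested:
  assumes W: "bad W" "V \<in> \<SS>" "W \<sqsubset> V" "\<not> bad V"
  shows "near_rho W V (b V) (B + 4 * E + \<kappa>)"
proof (rule ccontr)
  assume n: "\<not> ?thesis"
  note S = badD(1)[OF W(1)] W(2)
  have pb: "dC V (\<pi> V p) (b V) \<le> B" using W unfolding bad_def by auto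
  have far: "B + 3 * E + \<kappa> < dC V (b V) r" if "r \<in> \<rho> W V" for r
  proof (rule ccontr)
    assume "\<not> ?thesis"
    then have "near_rho W V (b V) (B + 3 * E + \<kappa> + E)"
      by (intro near_rho_of_point[of _ _ _ r]) (use W S that in auto)
    then show False using n by (simp add: algebra_simps)
  qed
  have "\<not> near_rho W V (b V) \<kappa>"
    using n near_rho_mono[of W V "b V" \<kappa>] B E_ge_1 \<kappa> by force
  then have 1: "dC W (b W) (\<rho>m V W (b V)) \<le> \<kappa>"
    using cons S W unfolding consistent_def by blast
  have "\<not> near_rho W V (\<pi> V p) (2 * E)"
  proof
    assume "near_rho W V (\<pi> V p) (2 * E)"
    then have "near_rho W V (b V) (2 * E + B)"
      by (rule near_rho_shift[rotated 3]) (use S W pb p dom_commute[OF S(2), of "b V" "\<pi> V p"] in auto)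
    then show False using n near_rho_mono[of W V "b V" "2 * E + B"] E_ge_1 \<kappa> by force
  qed
  then have 2: "dC W (\<pi> W p) (\<rho>m V W (\<pi> V p)) \<le> E"
    using nest_dichotomy[of W V p] S W p by blast
  obtain \<gamma> where \<gamma>: "geodesic_segment (\<C> V) (dC V) (b V) (\<pi> V p) \<gamma>"
    using domain_geodesic[OF S(2)] S p unfolding geodesic_space_def by (meson b_in pi_in)
  have 3: "dC W (\<rho>m V W (b V)) (\<rho>m V W (\<pi> V p)) \<le> E"
  proof (rule ccontr)
    assume "\<not> ?thesis"
    then obtain g r where g: "g \<in> \<gamma>" "r \<in> \<rho> W V" "dC V g r \<le> E + 1"
      using geodesic_image_dichotomy[OF S W(3) _ _ \<gamma>] S p by auto
    interpret V: Metric_space "\<C> V" "dC V" by (rule domain_metric[OF S(2)])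
    have gV: "g \<in> \<C> V" "dC V (b V) g + dC V g (\<pi> V p) = dC V (b V) (\<pi> V p)"
      using V.geodesic_segment_isometry(2,3)[OF \<gamma> g(1) g(1)] by auto
    have "dC V (b V) r \<le> dC V (b V) g + dC V g r"
      by (rule V.triangle) (use gV g S W rho_props(2)[of W V] in auto)
    then show False
      using far[OF g(2)] gV g pb V.commute[of "b V" "\<pi> V p"] V.nonneg[of g "\<pi> V p"] E_ge_1 \<kappa>
      by linarith
  qed
  have m: "\<rho>m V W (b V) \<in> \<C> W" "\<rho>m V W (\<pi> V p) \<in> \<C> W"
    using rho_map[of W V] S W p by (auto simp: Pi_iff)
  have "dC W (\<pi> W p) (b W) \<le> dC W (\<pi> W p) (\<rho>m V W (\<pi> V p)) + dC W (\<rho>m V W (\<pi> V p)) (b W)"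
    "dC W (\<rho>m V W (\<pi> V p)) (b W) \<le> dC W (\<rho>m V W (\<pi> V p)) (\<rho>m V W (b V)) + dC W (\<rho>m V W (b V)) (b W)"
    by (rule dom_triangle; use S m p in auto)+
  then have "dC W (\<pi> W p) (b W) \<le> E + (E + \<kappa>)"
    using 1 2 3 dom_commute[OF S(1)] by smt
  then show False using badD(2)[OF W(1)] B E_ge_1 by simp
qed

text \<open>Otherwise consistency puts \<open>b W\<close> near \<open>\<rho> V W\<close>, and then
  \<open>p\<close> is near \<open>\<rho> W V\<close> in \<open>V\<close>. So \<open>V\<close> would
  have to be bad, with \<open>before W V\<close>.\<close>

lemma near_rho_last_bad_transverse:
  assumes W: "bad W" "V \<in> \<SS>" "W \<pitchfork> V" "bad V \<Longrightarrow> \<not> before W V"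
  shows "near_rho W V (b V) (B + 4 * E + \<kappa>)"
proof (rule ccontr)
  assume n: "\<not> ?thesis"
  note S = badD(1)[OF W(1)] W(2)
  have tr: "V \<pitchfork> W" using transverse_sym S W by blast
  have "\<not> near_rho W V (b V) \<kappa>"
    using n near_rho_mono[of W V "b V" \<kappa>] B E_ge_1 \<kappa> by force
  then have 1: "near_rho V W (b W) \<kappa>" using cons S W unfolding consistent_def by blast
  have "\<not> near_rho V W (\<pi> W p) (2 * E)"
    using bad_not_near[OF W(1) S(2), of \<kappa> "2 * E"] tr 1 E_ge_1 by auto
  then have 2: "near_rho W V (\<pi> V p) (2 * E)" using transverse_dichotomy[of W V p] S W p by blast
  have "bad V"
  proof (rule ccontr)
    assume "\<not> bad V"
    then have "dC V (b V) (\<pi> V p) \<le> B"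
      using S dom_commute[OF S(2), of "b V" "\<pi> V p"] unfolding bad_def by auto
    then have "near_rho W V (b V) (2 * E + B)"
      using near_rho_shift[OF S _ 2, of "b V" B] S W p by auto
    then show False using n near_rho_mono[of W V "b V" "2 * E + B"] E_ge_1 \<kappa> by force
  qed
  then show False using W 1 unfolding before_def by blast
qed

end

text \<open>
  A point partially realising \<open>b\<close> on an adapted family can only be bad in domains that are orthogonal
  to, or nested in, members of the family. Adjoining a maximal last bad domain, and dropping the
  members above it, yields an adapted family again; the sum of the depths grows, but never exceeds
  \<open>E * E\<close>.
\<close>

definition adapted :: "real \<Rightarrow> ('u \<Rightarrow> 'c) \<Rightarrow> 'u set \<Rightarrow> bool"
  where "adapted c b \<U> \<longleftrightarrow> \<U> \<subseteq> \<SS> \<and> finite \<U> \<and> pairwise (\<perp>) \<U> \<and>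
    (\<forall>U\<in>\<U>. \<forall>V\<in>\<SS>. projects U V \<longrightarrow> near_rho U V (b V) c)"

lemma adapted_step:
  assumes cons: "consistent \<kappa> b" and \<kappa>: "0 \<le> \<kappa>" and c: "0 \<le> c" and ad: "adapted c b \<U>"
    and fin: "\<And>p. p \<in> X \<Longrightarrow> finite {U \<in> \<SS>. 2 * E < dC U (\<pi> U p) (b U)}"
  obtains (realised) z where "z \<in> X" "\<And>U. U \<in> \<SS> \<Longrightarrow> dC U (\<pi> U z) (b U) \<le> 10 * E + \<kappa> + c"
  | (refined) \<U>' where "adapted (14 * E + 2 * \<kappa> + c) b \<U>'" "sum depth \<U> < sum depth \<U>'"
proof -
  \<comment> \<open>The summand \<open>c\<close> ensures that a domain \<open>V\<close> is not bad
    if \<open>p\<close> and \<open>b\<close> are both near \<open>\<rho> U V\<close> for a member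
    \<open>U\<close> of the family.\<close>
  define B where "B = 10 * E + \<kappa> + c"
  have B: "10 * E + \<kappa> \<le> B" using c unfolding B_def by simp
  have bC: "U \<in> \<SS> \<Longrightarrow> b U \<in> \<C> U" for U using cons unfolding consistent_def by blast
  have \<U>: "\<U> \<subseteq> \<SS>" "finite \<U>" "pairwise (\<perp>) \<U>" using ad unfolding adapted_def by auto
  obtain p where p: "p \<in> X" "\<And>U. U \<in> \<U> \<Longrightarrow> dC U (\<pi> U p) (b U) \<le> E"
    "\<And>U V. U \<in> \<U> \<Longrightarrow> V \<in> \<SS> \<Longrightarrow> projects U V \<Longrightarrow> near_rho U V (\<pi> V p) (2 * E)"
    using partial_realisation'[OF \<U>(1,3), of b] bC \<U>(1) by (metis subsetD)
  note ctx = cons \<kappa> p(1) B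
  let ?bad = "bad B b p"
  show thesis
  proof (cases "\<exists>U. ?bad U")
    case False
    then have "dC U (\<pi> U p) (b U) \<le> B" if "U \<in> \<SS>" for U
      using that unfolding bad_def[OF ctx] by force
    then show thesis using realised[OF p(1)] unfolding B_def by blast
  next
    case True
    then obtain U0 where U0: "?bad U0" by blast
    have "finite {U. ?bad U}"
      by (rule finite_subset[OF _ fin[OF p(1)]]) (use B E_ge_1 \<kappa> in \<open>auto simp: bad_def[OF ctx]\<close>)
    then obtain W where W: "?bad W" "\<And>V. ?bad V \<Longrightarrow> \<not> W \<sqsubset> V" "\<And>V. ?bad V \<Longrightarrow> \<not> before \<kappa> b W V"
      by (rule last_bad_domain[OF ctx _ U0]) (rule that)
    have WS: "W \<in> \<SS>" using badD[OF ctx W(1)] by blast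
    have bad_rel: "U \<perp> V \<or> V \<sqsubset> U" if "U \<in> \<U>" "?bad V" for U V
    proof -
      have S: "U \<in> \<SS>" "V \<in> \<SS>" using that \<U> badD[OF ctx that(2)] by auto
      have "\<not> projects U V"
      proof
        assume *: "projects U V"
        then have "near_rho U V (b V) c" using ad that S unfolding adapted_def by blast
        then show False
          using near_rho_close[OF S * p(3)[OF that(1) S(2) *]] badD(2)[OF ctx that(2)] bC S p(1) \<kappa> E_ge_1
          unfolding B_def by fastforce
      qed
      moreover have "U \<noteq> V" using p(2)[OF that(1)] badD(2)[OF ctx that(2)] B E_ge_1 \<kappa> by force
      ultimately show ?thesis using domain_trichotomy[OF S] orth_symD[of V U] S unfolding pnest_def by blast
    qed
    define \<U>' where "\<U>' = insert W {U \<in> \<U>. \<not> W \<sqsubset> U}"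
    have orthW: "W \<perp> U \<and> U \<perp> W" if "U \<in> \<U>" "\<not> W \<sqsubset> U" for U
      using bad_rel[OF that(1) W(1)] that WS \<U> orth_symD[of U W] by blast
    have Wn: "W \<notin> {U \<in> \<U>. \<not> W \<sqsubset> U}"
      using orthW[of W] orth_irrefl WS unfolding irreflp_on_def by blast
    have "adapted (14 * E + 2 * \<kappa> + c) b \<U>'"
      unfolding adapted_def
    proof (intro conjI ballI impI)
      show "\<U>' \<subseteq> \<SS>" "finite \<U>'" using \<U> WS unfolding \<U>'_def by auto
      show "pairwise (\<perp>) \<U>'"
        unfolding \<U>'_def pairwise_insert using orthW \<U>(3) by (auto simp: pairwise_def)
      fix U V assume UV: "U \<in> \<U>'" "V \<in> \<SS>" "projects U V"
      show "near_rho U V (b V) (14 * E + 2 * \<kappa> + c)"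
      proof (cases "U = W")
        case True
        have "near_rho W V (b V) (B + 4 * E + \<kappa>)"
          using UV(3) True near_rho_last_bad_nested[OF ctx W(1) UV(2)]
            near_rho_last_bad_transverse[OF ctx W(1) UV(2)] W(2,3) by blast
        then show ?thesis using True unfolding B_def by (simp add: algebra_simps)
      next
        case False
        then have "near_rho U V (b V) c" using UV ad unfolding adapted_def \<U>'_def by blast
        then show ?thesis by (rule near_rho_mono) (use E_ge_1 \<kappa> in simp)
      qed
    qed
    moreover have "sum depth \<U> < sum depth \<U>'"
    proof -
      have split: "sum depth \<U> = sum depth {U \<in> \<U>. W \<sqsubset> U} + sum depth {U \<in> \<U>. \<not> W \<sqsubset> U}"
        using \<U>(2) by (subst sum.union_disjoint[symmetric]) (auto intro!: sum.cong)
      \<comment> \<open>At most one member lies above \<open>W\<close>: two such members would be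
        orthogonal, and \<open>W\<close> would be orthogonal to a domain containing it. Depth
        decreases upwards, so \<open>W\<close> outweighs the member it replaces.\<close>
      have "sum depth {U \<in> \<U>. W \<sqsubset> U} < depth W"
      proof (cases "\<exists>U\<in>\<U>. W \<sqsubset> U")
        case True
        then obtain U where U: "U \<in> \<U>" "W \<sqsubset> U" by blast
        have "V = U" if "V \<in> \<U>" "W \<sqsubset> V" for V
        proof (rule ccontr)
          assume "V \<noteq> U"
          then have "U \<perp> V" using \<U>(3) U that unfolding pairwise_def by metis
          then have "W \<perp> V" using orth_nest[of W U V] U that WS \<U> unfolding pnest_def by blast
          then show False using orth_not_comparable[of W V] that WS \<U> unfolding pnest_def by blast
        qed
        then have "{U \<in> \<U>. W \<sqsubset> U} = {U}" using U by blast
        then show ?thesis using depth_less[of W U] U WS \<U> by auto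
      next
        case False
        then have "{U \<in> \<U>. W \<sqsubset> U} = {}" by blast
        then have "sum depth {U \<in> \<U>. W \<sqsubset> U} = 0" by (simp only: sum.empty)
        then show ?thesis using depth_pos[OF WS] by linarith
      qed
      moreover have "sum depth \<U>' = depth W + sum depth {U \<in> \<U>. \<not> W \<sqsubset> U}"
        unfolding \<U>'_def using \<U>(2) Wn by (subst sum.insert) auto
      ultimately show ?thesis using split by linarith
    qed
    ultimately show thesis by (rule refined)
  qed
qed

text \<open>The comparison of \<open>b\<close> with a pair \<open>x\<close>, \<open>y\<close> is
  there for finiteness: a domain that is bad for \<open>p\<close> is relevant for \<open>p\<close>,
  \<open>x\<close> or for \<open>x\<close>, \<open>y\<close>, so \<open>finite_relevant\<close>
  applies.\<close>

theorem realisation: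
  assumes \<kappa>: "0 \<le> \<kappa>"
  obtains \<kappa>' where "0 \<le> \<kappa>'" "\<And>b x y. consistent \<kappa> b \<Longrightarrow> x \<in> X \<Longrightarrow> y \<in> X \<Longrightarrow>
    \<forall>U\<in>\<SS>. dC U (\<pi> U x) (b U) \<le> dp U x y \<Longrightarrow>
    \<exists>z\<in>X. \<forall>U\<in>\<SS>. dC U (\<pi> U z) (b U) \<le> \<kappa>'"
proof -
  \<comment> \<open>The constant of the adapted family after \<open>n\<close> refinements.\<close>
  define c where "c n = real n * (14 * E + 2 * \<kappa>)" for n :: nat
  have c0: "0 \<le> c n" for n unfolding c_def using E_ge_1 \<kappa> by simp
  define N where "N = nat \<lfloor>E * E\<rfloor> + 1"
  have main: "\<exists>z\<in>X. \<forall>U\<in>\<SS>. dC U (\<pi> U z) (b U) \<le> 10 * E + \<kappa> + c N"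
    if b: "consistent \<kappa> b" and xy: "x \<in> X" "y \<in> X"
      and bxy: "\<forall>U\<in>\<SS>. dC U (\<pi> U x) (b U) \<le> dp U x y" for b x y
  proof -
    have bC: "U \<in> \<SS> \<Longrightarrow> b U \<in> \<C> U" for U using b unfolding consistent_def by blast
    have fin: "finite {U \<in> \<SS>. 2 * E < dC U (\<pi> U p) (b U)}" if p: "p \<in> X" for p
    proof (rule finite_subset[OF _ finite_UnI[OF finite_relevant[OF p xy(1)] finite_relevant[OF xy]]])
      show "{U \<in> \<SS>. 2 * E < dC U (\<pi> U p) (b U)}
        \<subseteq> {U \<in> \<SS>. E \<le> dp U p x} \<union> {U \<in> \<SS>. E \<le> dp U x y}"
      proof
        fix U assume U: "U \<in> {U \<in> \<SS>. 2 * E < dC U (\<pi> U p) (b U)}"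
        then have "dC U (\<pi> U p) (b U) \<le> dp U p x + dC U (\<pi> U x) (b U)"
          using p xy bC by (intro dom_triangle) auto
        then show "U \<in> {U \<in> \<SS>. E \<le> dp U p x} \<union> {U \<in> \<SS>. E \<le> dp U x y}"
          using U bspec[OF bxy, of U] by fastforce
      qed
    qed
    have step: "(\<exists>z\<in>X. \<forall>U\<in>\<SS>. dC U (\<pi> U z) (b U) \<le> 10 * E + \<kappa> + c n) \<or>
        (\<exists>\<U>. adapted (c n) b \<U> \<and> n \<le> sum depth \<U>)" for n
    proof (induction n)
      case 0
      have "adapted (c 0) b {}" unfolding adapted_def by auto
      then show ?case by auto
    next
      case (Suc n)
      have cc: "14 * E + 2 * \<kappa> + c n = c (Suc n)" "c n \<le> c (Suc n)"
        unfolding c_def using E_ge_1 \<kappa> by (auto simp: algebra_simps)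
      from Suc show ?case
      proof
        assume "\<exists>z\<in>X. \<forall>U\<in>\<SS>. dC U (\<pi> U z) (b U) \<le> 10 * E + \<kappa> + c n"
        then show ?thesis using cc(2) by fastforce
      next
        assume "\<exists>\<U>. adapted (c n) b \<U> \<and> n \<le> sum depth \<U>"
        then obtain \<U> where \<U>: "adapted (c n) b \<U>" "n \<le> sum depth \<U>" by blast
        show ?thesis
        proof (rule adapted_step[OF b \<kappa> c0 \<U>(1) fin])
          fix z assume "z \<in> X" "\<And>U. U \<in> \<SS> \<Longrightarrow> dC U (\<pi> U z) (b U) \<le> 10 * E + \<kappa> + c n"
          then show ?thesis using cc(2) by fastforce
        next
          fix \<U>' assume "adapted (14 * E + 2 * \<kappa> + c n) b \<U>'" "sum depth \<U> < sum depth \<U>'"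
          then show ?thesis using cc(1) \<U>(2) by (intro disjI2 exI[of _ \<U>']) auto
        qed
      qed
    qed
    have "sum depth \<U> < N" if "adapted (c N) b \<U>" for \<U>
    proof -
      have \<U>: "\<U> \<subseteq> \<SS>" "finite \<U>" "pairwise (\<perp>) \<U>" using that unfolding adapted_def by auto
      have "real (sum depth \<U>) \<le> (\<Sum>U\<in>\<U>. E)"
        unfolding of_nat_sum by (rule sum_mono) (rule depth_le)
      also have "\<dots> \<le> E * E"
        using mult_right_mono[OF orthogonal_card[OF \<U>(2,1,3)], of E] E_ge_1 by simp
      finally show ?thesis unfolding N_def by linarith
    qed
    then show ?thesis using step[of N] by force
  qed
  show thesis
    by (rule that[of "10 * E + \<kappa> + c N"]) (use main c0[of N] E_ge_1 \<kappa> in \<open>simp_all add: add_nonneg_nonneg\<close>)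
qed


subsection \<open>Half-spaces along geodesics\<close>

definition is_geo :: "'u \<Rightarrow> 'a \<Rightarrow> 'a \<Rightarrow> (real \<Rightarrow> 'c) \<Rightarrow> bool"
  where "is_geo U x y g \<longleftrightarrow> g \<in> {0..dp U x y} \<rightarrow> \<C> U \<and> g 0 = \<pi> U x \<and> g (dp U x y) = \<pi> U y \<and>
    (\<forall>s\<in>{0..dp U x y}. \<forall>t\<in>{0..dp U x y}. dC U (g s) (g t) = \<bar>s - t\<bar>)"

definition geo :: "'u \<Rightarrow> 'a \<Rightarrow> 'a \<Rightarrow> real \<Rightarrow> 'c"
  where "geo U x y = (SOME g. is_geo U x y g)"

lemma geo_is_geo:
  assumes "U \<in> \<SS>" "x \<in> X" "y \<in> X"
  shows "is_geo U x y (geo U x y)"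
proof -
  obtain \<gamma> where "geodesic_segment (\<C> U) (dC U) (\<pi> U x) (\<pi> U y) \<gamma>"
    using domain_geodesic[OF assms(1)] pi_in assms unfolding geodesic_space_def by meson
  then have "\<exists>g. is_geo U x y g" unfolding geodesic_segment_def is_geo_def by blast
  then show ?thesis unfolding geo_def by (rule someI_ex)
qed

lemma geo_props:
  assumes "U \<in> \<SS>" "x \<in> X" "y \<in> X"
  shows "geo U x y 0 = \<pi> U x" "geo U x y (dp U x y) = \<pi> U y"
    "t \<in> {0..dp U x y} \<Longrightarrow> geo U x y t \<in> \<C> U"
    "s \<in> {0..dp U x y} \<Longrightarrow> t \<in> {0..dp U x y} \<Longrightarrow> dC U (geo U x y s) (geo U x y t) = \<bar>s - t\<bar>"
    "t \<in> {0..dp U x y} \<Longrightarrow> dC U (\<pi> U x) (geo U x y t) = t"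
    "t \<in> {0..dp U x y} \<Longrightarrow> dC U (geo U x y t) (\<pi> U y) = dp U x y - t"
proof -
  note g = geo_is_geo[OF assms, unfolded is_geo_def]
  show 1: "geo U x y 0 = \<pi> U x" "geo U x y (dp U x y) = \<pi> U y"
    "t \<in> {0..dp U x y} \<Longrightarrow> geo U x y t \<in> \<C> U" using g by auto
  show 2: "s \<in> {0..dp U x y} \<Longrightarrow> t \<in> {0..dp U x y} \<Longrightarrow> dC U (geo U x y s) (geo U x y t) = \<bar>s - t\<bar>"
    for s t using g by blast
  show "t \<in> {0..dp U x y} \<Longrightarrow> dC U (\<pi> U x) (geo U x y t) = t"
    using 2[of 0 t] 1(1) by simp
  show "t \<in> {0..dp U x y} \<Longrightarrow> dC U (geo U x y t) (\<pi> U y) = dp U x y - t"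
    using 2[of t "dp U x y"] 1(2) by auto
qed

lemma geo_subsegment:
  assumes "U \<in> \<SS>" "x \<in> X" "y \<in> X" "0 \<le> s" "s \<le> t" "t \<le> dp U x y"
  shows "geodesic_segment (\<C> U) (dC U) (geo U x y s) (geo U x y t) (geo U x y ` {s..t})"
  unfolding geodesic_segment_def
proof (intro exI[of _ "\<lambda>u. geo U x y (s + u)"] conjI)
  note g = geo_props[OF assms(1-3)]
  have d: "dC U (geo U x y s) (geo U x y t) = t - s" using g(4)[of s t] assms by auto
  show "(\<lambda>u. geo U x y (s + u)) \<in> {0..dC U (geo U x y s) (geo U x y t)} \<rightarrow> \<C> U"
    unfolding d using g(3) assms by auto
  show "\<forall>u\<in>{0..dC U (geo U x y s) (geo U x y t)}. \<forall>v\<in>{0..dC U (geo U x y s) (geo U x y t)}.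
      dC U (geo U x y (s + u)) (geo U x y (s + v)) = \<bar>u - v\<bar>"
    unfolding d using g(4)[of "s + u" "s + v" for u v] assms by auto
  have "{s..t} = (+) s ` {0..t - s}" by simp
  then show "geo U x y ` {s..t} = (\<lambda>u. geo U x y (s + u)) ` {0..dC U (geo U x y s) (geo U x y t)}"
    unfolding d by (simp only: image_image)
qed (use geo_props(4)[OF assms(1-3), of s t] assms in auto)

text \<open>
  The defining condition bounds the Gromov product of \<open>x\<close> and \<open>p\<close> based at \<open>geo U x y t\<close> by \<open>10 * E\<close>:
  \<open>p\<close> projects to the geodesic coarsely beyond time \<open>t\<close>.
\<close>

definition half :: "'u \<Rightarrow> 'a \<Rightarrow> 'a \<Rightarrow> real \<Rightarrow> 'a set"
  where "half U x y t = {p \<in> X. t + dC U (geo U x y t) (\<pi> U p) - 20 * E \<le> dp U x p}"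

text \<open>The nesting is exact although the domain is only coarsely a tree: on moving from
  \<open>t\<close> back to \<open>s\<close> the distance to the base point grows by at most
  \<open>t - s\<close>. This lets half-spaces form chains.\<close>

lemma half_mono:
  assumes "U \<in> \<SS>" "x \<in> X" "y \<in> X" "0 \<le> s" "s \<le> t" "t \<le> dp U x y"
  shows "half U x y t \<subseteq> half U x y s"
proof
  fix p assume p: "p \<in> half U x y t"
  have "dC U (geo U x y s) (\<pi> U p) \<le> dC U (geo U x y s) (geo U x y t) + dC U (geo U x y t) (\<pi> U p)"
    by (rule dom_triangle) (use assms p geo_props(3)[OF assms(1-3)] in \<open>auto simp: half_def\<close>)
  then show "p \<in> half U x y s"
    using p geo_props(4)[OF assms(1-3), of s t] assms unfolding half_def by auto
qed

lemma near_end_in_half: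
  assumes "U \<in> \<SS>" "x \<in> X" "y \<in> X" "t \<in> {0..dp U x y}" "p \<in> X" "dp U y p \<le> 10 * E"
  shows "p \<in> half U x y t"
proof -
  have "dC U (geo U x y t) (\<pi> U p) \<le> dC U (geo U x y t) (\<pi> U y) + dp U y p"
    "dp U x y \<le> dp U x p + dp U p y"
    by (rule dom_triangle; use assms geo_props(3)[OF assms(1-3)] in auto)+
  then show ?thesis
    using geo_props(6)[OF assms(1-4)] assms dom_commute[OF assms(1), of "\<pi> U y" "\<pi> U p"]
    unfolding half_def by simp
qed

lemma half_far:
  assumes "U \<in> \<SS>" "p \<in> half U x y t"
  shows "t - 20 * E \<le> dp U x p"
proof -
  have "t + dC U (geo U x y t) (\<pi> U p) - 20 * E \<le> dp U x p" using assms(2) unfolding half_def by simp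
  then show ?thesis using dom_nonneg[OF assms(1), of "geo U x y t" "\<pi> U p"] by linarith
qed

subsection \<open>Stopping tuples\<close>

text \<open>Inserting the endpoint makes \<open>y\<close> the stopping point if \<open>Q\<close>
  holds for no half-space.\<close>

definition stop :: "('a set \<Rightarrow> bool) \<Rightarrow> 'u \<Rightarrow> 'a \<Rightarrow> 'a \<Rightarrow> real"
  where "stop Q U x y = Inf (insert (dp U x y) {t \<in> {0..dp U x y}. Q (half U x y t)})"

lemma stop_le:
  assumes "t \<in> insert (dp U x y) {t \<in> {0..dp U x y}. Q (half U x y t)}" "U \<in> \<SS>"
  shows "stop Q U x y \<le> t"
  unfolding stop_def
proof (rule cInf_lower[OF assms(1)])
  show "bdd_below (insert (dp U x y) {t \<in> {0..dp U x y}. Q (half U x y t)})"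
    by (rule bdd_belowI[of _ 0]) (use assms(2) in auto)
qed

lemma stop_bounds:
  assumes "U \<in> \<SS>"
  shows "stop Q U x y \<in> {0..dp U x y}"
proof -
  have "0 \<le> stop Q U x y" unfolding stop_def by (rule cInf_greatest) (use assms in auto)
  then show ?thesis using stop_le[OF _ assms] by simp
qed

lemma stop_less:
  assumes "U \<in> \<SS>" "stop Q U x y < dp U x y"
  obtains t where "t \<in> {0..dp U x y}" "stop Q U x y \<le> t" "t \<le> stop Q U x y + 1" "Q (half U x y t)"
proof -
  have "stop Q U x y < min (dp U x y) (stop Q U x y + 1)" using assms by simp
  then obtain t where t: "t \<in> insert (dp U x y) {t \<in> {0..dp U x y}. Q (half U x y t)}"
    "t < min (dp U x y) (stop Q U x y + 1)"
    unfolding stop_def using cInf_lessD[OF insert_not_empty] by blast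
  then show thesis using that[of t] stop_le[OF t(1) assms(1)] by auto
qed

text \<open>Here \<open>U\<close> is crossed before \<open>V\<close> on the way from
  \<open>x\<close> to \<open>y\<close>. If the walk in \<open>U\<close> stops early,
  \<open>Q\<close> holds for a half-space of \<open>U\<close>. A point beyond \<open>25 * E\<close>
  in \<open>V\<close> is at least \<open>5 * E\<close> from \<open>x\<close> there, so away from
  \<open>\<rho> U V\<close>; its coordinate in \<open>U\<close> is then near that of
  \<open>y\<close>, so it lies in that half-space. Hence the walk in \<open>V\<close> stops within
  \<open>25 * E\<close> of \<open>x\<close>.\<close>

lemma stop_tuple_consistent_transverse:
  assumes Q: "\<forall>H H'. Q H \<longrightarrow> H' \<subseteq> H \<longrightarrow> Q H'" and xy: "x \<in> X" "y \<in> X"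
    and UV: "U \<in> \<SS>" "V \<in> \<SS>" "U \<pitchfork> V"
    and n: "near_rho V U (\<pi> U y) (2 * E)" "near_rho U V (\<pi> V x) (2 * E)"
  shows "near_rho V U (geo U x y (stop Q U x y)) (30 * E) \<or>
    near_rho U V (geo V x y (stop Q V x y)) (30 * E)"
proof (cases "stop Q U x y < dp U x y")
  case False
  then have "geo U x y (stop Q U x y) = \<pi> U y"
    using stop_bounds[OF UV(1)] geo_props(2)[OF UV(1) xy] by (metis atLeastAtMost_iff antisym not_less)
  then show ?thesis using n near_rho_mono[OF n(1)] E_ge_1 by auto
next
  case True
  have VU: "V \<pitchfork> U" using transverse_sym UV by blast
  obtain t where t: "t \<in> {0..dp U x y}" "Q (half U x y t)"
    by (rule stop_less[OF UV(1) True]) (rule that)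
  have le: "stop Q V x y \<le> 25 * E"
  proof (cases "dp V x y < 25 * E")
    case True
    then show ?thesis using stop_bounds[OF UV(2)] by (metis atLeastAtMost_iff less_imp_le order.trans)
  next
    case False
    then have t': "25 * E \<in> {0..dp V x y}" using E_ge_1 by auto
    have "half V x y (25 * E) \<subseteq> half U x y t"
    proof
      fix p assume p: "p \<in> half V x y (25 * E)"
      then have pX: "p \<in> X" unfolding half_def by auto
      have "5 * E \<le> dp V x p" using half_far[OF UV(2) p] by simp
      then have "\<not> near_rho U V (\<pi> V p) (2 * E)"
        using near_rho_close[OF UV(1,2) _ n(2), of "\<pi> V p" "2 * E"] UV xy pX E_ge_1 by auto
      then have "near_rho V U (\<pi> U p) (2 * E)" using transverse_dichotomy[OF UV pX] by blast
      then have "dp U y p \<le> 2 * E + 2 * E"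
        using near_rho_close[OF UV(2,1) _ n(1), of "\<pi> U p" "2 * E"] VU UV xy pX by auto
      then show "p \<in> half U x y t" using near_end_in_half[OF UV(1) xy t(1) pX] E_ge_1 by simp
    qed
    then show ?thesis using stop_le[OF _ UV(2), of "25 * E"] t' Q t(2) by blast
  qed
  have "near_rho U V (geo V x y (stop Q V x y)) (2 * E + 25 * E)"
  proof (rule near_rho_shift[OF UV(1,2) _ n(2)])
    show "dC V (geo V x y (stop Q V x y)) (\<pi> V x) \<le> 25 * E"
      using le geo_props(5)[OF UV(2) xy stop_bounds[OF UV(2)], of Q]
        dom_commute[OF UV(2), of "geo V x y (stop Q V x y)"] by simp
  qed (use UV xy geo_props(3)[OF UV(2) xy stop_bounds[OF UV(2)]] in auto)
  then show ?thesis using near_rho_mono E_ge_1 by fastforce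
qed

lemma far_image_close:
  assumes UV: "U \<in> \<SS>" "V \<in> \<SS>" "U \<sqsubset> V" and pq: "p \<in> X" "q \<in> \<C> V"
    and seg: "geodesic_segment (\<C> V) (dC V) (\<pi> V p) q \<gamma> \<or> geodesic_segment (\<C> V) (dC V) q (\<pi> V p) \<gamma>"
    and far: "\<And>g r. g \<in> \<gamma> \<Longrightarrow> r \<in> \<rho> U V \<Longrightarrow> \<not> dC V g r \<le> 2 * E"
  shows "dC U (\<pi> U p) (\<rho>m V U q) \<le> 2 * E"
proof -
  have far': "\<not> (\<exists>g\<in>\<gamma>. \<exists>r\<in>\<rho> U V. dC V g r \<le> E + 1)" using far E_ge_1 by fastforce
  have "\<pi> V p \<in> \<gamma>"
    using seg dom_nonneg[OF UV(2)] unfolding geodesic_segment_def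
    by (metis atLeastAtMost_iff image_eqI order_refl)
  then have "\<not> near_rho U V (\<pi> V p) (2 * E)"
    using far rho_props(1)[OF UV(1,2)] UV unfolding near_rho_def by blast
  then have 1: "dC U (\<pi> U p) (\<rho>m V U (\<pi> V p)) \<le> E" using nest_dichotomy[OF UV pq(1)] by blast
  have 2: "dC U (\<rho>m V U (\<pi> V p)) (\<rho>m V U q) \<le> E"
    using seg geodesic_image_dichotomy[OF UV _ _ , of "\<pi> V p" q \<gamma>]
      geodesic_image_dichotomy[OF UV _ _ , of q "\<pi> V p" \<gamma>] far' pq UV
      dom_commute[OF UV(1), of "\<rho>m V U (\<pi> V p)" "\<rho>m V U q"] by auto
  have "dC U (\<pi> U p) (\<rho>m V U q) \<le> dC U (\<pi> U p) (\<rho>m V U (\<pi> V p)) + dC U (\<rho>m V U (\<pi> V p)) (\<rho>m V U q)"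
    by (rule dom_triangle) (use UV pq rho_map[OF UV] in \<open>auto simp: Pi_iff\<close>)
  then show ?thesis using 1 2 by simp
qed

text \<open>Used mostly in contrapositive form: points that differ by more than \<open>3 * E\<close>
  in \<open>U\<close> force the geodesic in \<open>V\<close> to pass near
  \<open>\<rho> U V\<close>.\<close>

lemma far_points_close:
  assumes UV: "U \<in> \<SS>" "V \<in> \<SS>" "U \<sqsubset> V" and pq: "p \<in> X" "q \<in> X"
    and seg: "geodesic_segment (\<C> V) (dC V) (\<pi> V p) (\<pi> V q) \<gamma>"
    and far: "\<And>g r. g \<in> \<gamma> \<Longrightarrow> r \<in> \<rho> U V \<Longrightarrow> \<not> dC V g r \<le> 2 * E"
  shows "dp U p q \<le> 3 * E"
proof -
  have 1: "dC U (\<pi> U p) (\<rho>m V U (\<pi> V q)) \<le> 2 * E"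
    by (rule far_image_close[OF UV pq(1) _ _ far]) (use seg UV pq in auto)
  have "\<pi> V q \<in> \<gamma>"
    using seg dom_nonneg[OF UV(2)] unfolding geodesic_segment_def
    by (metis atLeastAtMost_iff image_eqI order_refl)
  then have "\<not> near_rho U V (\<pi> V q) (2 * E)"
    using far rho_props(1)[OF UV(1,2)] UV unfolding near_rho_def by blast
  then have 2: "dC U (\<pi> U q) (\<rho>m V U (\<pi> V q)) \<le> E" using nest_dichotomy[OF UV pq(2)] by blast
  have "dp U p q \<le> dC U (\<pi> U p) (\<rho>m V U (\<pi> V q)) + dC U (\<rho>m V U (\<pi> V q)) (\<pi> U q)"
    by (rule dom_triangle) (use UV pq rho_map[OF UV] in \<open>auto simp: Pi_iff\<close>)
  then show ?thesis using 1 2 dom_commute[OF UV(1), of "\<pi> U q"] by simp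
qed

lemma close_to_rho_close:
  assumes "U \<in> \<SS>" "V \<in> \<SS>" "U \<sqsubset> V" "g \<in> \<C> V" "g' \<in> \<C> V" "r \<in> \<rho> U V" "r' \<in> \<rho> U V"
    "dC V g r \<le> 2 * E" "dC V g' r' \<le> 2 * E"
  shows "dC V g g' \<le> 5 * E"
proof -
  have S: "r \<in> \<C> V" "r' \<in> \<C> V" "dC V r r' \<le> E" using rho_props(2,3)[OF assms(1,2)] assms by blast+
  have "dC V g g' \<le> dC V g r + dC V r g'" "dC V r g' \<le> dC V r r' + dC V r' g'"
    by (rule dom_triangle; use assms S in auto)+
  then show ?thesis using S assms dom_commute[OF assms(2), of r' g'] by linarith
qed

text \<open>The coordinate in \<open>U\<close> can only change while the geodesic in
  \<open>V\<close> is near \<open>\<rho> U V\<close>, and these times are more than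
  \<open>27 * E\<close> away from the stopping time \<open>\<tau>\<close>. So the image of
  \<open>g \<tau>\<close> in \<open>U\<close> is near \<open>x\<close> if they come after
  \<open>\<tau>\<close> and near \<open>y\<close> if they come before. The walk in \<open>U\<close>
  has to be shown to stop at the same end.\<close>

lemma stop_tuple_consistent_nest:
  assumes Q: "\<forall>H H'. Q H \<longrightarrow> H' \<subseteq> H \<longrightarrow> Q H'" and xy: "x \<in> X" "y \<in> X"
    and UV: "U \<in> \<SS>" "V \<in> \<SS>" "U \<sqsubset> V"
    and n: "\<not> near_rho U V (geo V x y (stop Q V x y)) (30 * E)"
  shows "dC U (geo U x y (stop Q U x y)) (\<rho>m V U (geo V x y (stop Q V x y))) \<le> 30 * E"
proof -
  define g where "g = geo V x y"
  define D where "D = dp V x y"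
  define \<tau> where "\<tau> = stop Q V x y"
  define \<tau>' where "\<tau>' = stop Q U x y"
  note gp = geo_props[OF UV(2) xy, folded g_def D_def]
  note gU = geo_props[OF UV(1) xy]
  interpret V: Metric_space "\<C> V" "dC V" by (rule domain_metric[OF UV(2)])
  have \<tau>: "\<tau> \<in> {0..D}" unfolding \<tau>_def D_def by (rule stop_bounds[OF UV(2)])
  have \<tau>': "\<tau>' \<in> {0..dp U x y}" unfolding \<tau>'_def by (rule stop_bounds[OF UV(1)])
  define close where "close s \<longleftrightarrow> (\<exists>r\<in>\<rho> U V. dC V (g s) r \<le> 2 * E)" for s
  have close_far: "27 * E < \<bar>s - \<tau>\<bar>" if cs: "close s" "s \<in> {0..D}" for s
  proof (rule ccontr)
    assume *: "\<not> ?thesis"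
    obtain r where r: "r \<in> \<rho> U V" "dC V (g s) r \<le> 2 * E"
      using cs(1) unfolding close_def by blast
    have "near_rho U V (g s) (2 * E + E)"
      by (rule near_rho_of_point[of _ _ _ r]) (use r UV gp that in auto)
    then have "near_rho U V (g \<tau>) (2 * E + E + 27 * E)"
      by (rule near_rho_shift[rotated 3]) (use * UV gp that \<tau> in auto)
    then show False using n unfolding g_def \<tau>_def by simp
  qed
  have seg: "geodesic_segment (\<C> V) (dC V) (g s) (g t) (g ` {s..t})" if "0 \<le> s" "s \<le> t" "t \<le> D" for s t
    using geo_subsegment[OF UV(2) xy that(1,2)] that(3) unfolding g_def D_def by blast
  have m: "\<rho>m V U (g \<tau>) \<in> \<C> U" using rho_map[OF UV] gp(3)[OF \<tau>] by auto
  have left: "dC U (\<pi> U x) (\<rho>m V U (g \<tau>)) \<le> 2 * E" if "\<And>s. s \<in> {0..\<tau>} \<Longrightarrow> \<not> close s"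
    by (rule far_image_close[OF UV xy(1) gp(3)[OF \<tau>], of "g ` {0..\<tau>}"])
      (use seg[of 0 \<tau>] \<tau> gp(1) that in \<open>auto simp: close_def\<close>)
  have right: "dC U (\<pi> U y) (\<rho>m V U (g \<tau>)) \<le> 2 * E" if "\<And>s. s \<in> {\<tau>..D} \<Longrightarrow> \<not> close s"
    by (rule far_image_close[OF UV xy(2) gp(3)[OF \<tau>], of "g ` {\<tau>..D}"])
      (use seg[of \<tau> D] \<tau> gp(2) that in \<open>auto simp: close_def\<close>)
  have bU: "geo U x y \<tau>' \<in> \<C> U" using gU(3) \<tau>' by blast
  have viax: "dC U (geo U x y \<tau>') (\<rho>m V U (g \<tau>)) \<le> 30 * E"
    if "dC U (\<pi> U x) (\<rho>m V U (g \<tau>)) \<le> 2 * E" "\<tau>' \<le> 24 * E"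
  proof -
    have "dC U (geo U x y \<tau>') (\<rho>m V U (g \<tau>)) \<le> dC U (geo U x y \<tau>') (\<pi> U x) + dC U (\<pi> U x) (\<rho>m V U (g \<tau>))"
      by (rule dom_triangle) (use UV xy m bU in auto)
    then show ?thesis using that gU(5)[OF \<tau>'] dom_commute[OF UV(1), of "geo U x y \<tau>'" "\<pi> U x"] E_ge_1
      by linarith
  qed
  have "dC U (geo U x y \<tau>') (\<rho>m V U (g \<tau>)) \<le> 30 * E"
  proof (cases "\<exists>s0\<in>{0..\<tau>}. close s0")
    case False
    then have x: "dC U (\<pi> U x) (\<rho>m V U (g \<tau>)) \<le> 2 * E" using left by blast
    show ?thesis
    proof (cases "\<exists>s1\<in>{\<tau>..D}. close s1")
      case False
      then have "dC U (\<pi> U y) (\<rho>m V U (g \<tau>)) \<le> 2 * E" using right by blast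
      moreover have "dp U x y \<le> dC U (\<pi> U x) (\<rho>m V U (g \<tau>)) + dC U (\<rho>m V U (g \<tau>)) (\<pi> U y)"
        by (rule dom_triangle) (use UV xy m in auto)
      ultimately have "dp U x y \<le> 4 * E" using x dom_commute[OF UV(1), of "\<pi> U y"] by simp
      then show ?thesis using viax[OF x] \<tau>' E_ge_1 by auto
    next
      case True
      then obtain s1 r1 where s1: "s1 \<in> {\<tau>..D}" "close s1" "r1 \<in> \<rho> U V" "dC V (g s1) r1 \<le> 2 * E"
        unfolding close_def by blast
      have lt: "\<tau> + 27 * E < s1" using close_far[of s1] s1 \<tau> by auto
      then have "stop Q V x y < dp V x y" using s1 E_ge_1 unfolding \<tau>_def D_def by auto
      then obtain t where "t \<in> {0..dp V x y}" "t \<le> stop Q V x y + 1" "Q (half V x y t)"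
        by (rule stop_less[OF UV(2)]) (rule that)
      then have t: "t \<in> {0..D}" "t \<le> \<tau> + 1" "Q (half V x y t)" unfolding \<tau>_def D_def by auto
      \<comment> \<open>After the slack \<open>20 * E\<close> of half-spaces, \<open>24 * E\<close>
        leaves a distance \<open>4 * E\<close> from \<open>x\<close> in \<open>U\<close>, above the
        bound of \<open>far_points_close\<close>. So the geodesic in \<open>V\<close> from
        \<open>x\<close> to such a point passes near \<open>\<rho> U V\<close>, hence near
        \<open>g s1\<close>, and the point lies beyond \<open>t\<close>.\<close>
      have "\<tau>' \<le> 24 * E"
      proof (cases "dp U x y < 24 * E")
        case True
        then show ?thesis using \<tau>' by auto
      next
        case False
        then have c: "24 * E \<in> {0..dp U x y}" using E_ge_1 by auto
        have "half U x y (24 * E) \<subseteq> half V x y t"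
        proof
          fix p assume p: "p \<in> half U x y (24 * E)"
          then have pX: "p \<in> X" unfolding half_def by auto
          have d: "4 * E \<le> dp U x p" using half_far[OF UV(1) p] by simp
          obtain \<gamma> where \<gamma>: "geodesic_segment (\<C> V) (dC V) (\<pi> V x) (\<pi> V p) \<gamma>"
            using domain_geodesic[OF UV(2)] UV xy pX unfolding geodesic_space_def by (meson pi_in)
          obtain q r where q: "q \<in> \<gamma>" "r \<in> \<rho> U V" "dC V q r \<le> 2 * E"
            using far_points_close[OF UV xy(1) pX \<gamma>] d E_ge_1 by force
          have qV: "q \<in> \<C> V" "dC V (\<pi> V x) q + dC V q (\<pi> V p) = dp V x p"
            using V.geodesic_segment_isometry(2,3)[OF \<gamma> q(1) q(1)] by auto
          have s1D: "s1 \<in> {0..D}" using s1 \<tau> by auto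
          have "dC V q (g s1) \<le> 5 * E"
            by (rule close_to_rho_close[OF UV qV(1) gp(3)[OF s1D] q(2) s1(3) q(3) s1(4)])
          moreover have "dC V (\<pi> V x) (g s1) \<le> dC V (\<pi> V x) q + dC V q (g s1)"
            by (rule V.triangle) (use UV xy qV gp(3)[OF s1D] in auto)
          moreover have "dC V (g s1) (\<pi> V p) \<le> dC V (g s1) q + dC V q (\<pi> V p)"
            by (rule V.triangle) (use UV pX qV gp(3)[OF s1D] in auto)
          ultimately have "p \<in> half V x y s1"
            using qV(2) gp(5)[OF s1D] V.commute[of q "g s1"] pX E_ge_1 
            unfolding half_def g_def[symmetric] by auto
          then show "p \<in> half V x y t"
            using half_mono[OF UV(2) xy, of t s1] t s1 lt E_ge_1 unfolding D_def by auto
        qed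
        then show ?thesis using stop_le[OF _ UV(1), of "24 * E"] c Q t(3) unfolding \<tau>'_def by blast
      qed
      then show ?thesis using viax[OF x] by blast
    qed
  next
    case True
    then obtain s0 r0 where s0: "s0 \<in> {0..\<tau>}" "close s0" "r0 \<in> \<rho> U V" "dC V (g s0) r0 \<le> 2 * E"
      unfolding close_def by blast
    have s0D: "s0 \<in> {0..D}" using s0 \<tau> by auto
    have lt: "s0 + 27 * E < \<tau>" using close_far[of s0] s0 s0D by auto
    have "\<not> close s1" if "s1 \<in> {\<tau>..D}" for s1
    proof
      assume "close s1"
      then obtain r1 where r1: "r1 \<in> \<rho> U V" "dC V (g s1) r1 \<le> 2 * E" unfolding close_def by blast
      have s1D: "s1 \<in> {0..D}" using that \<tau> by auto
      have "dC V (g s0) (g s1) \<le> 5 * E"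
        by (rule close_to_rho_close[OF UV gp(3)[OF s0D] gp(3)[OF s1D] s0(3) r1(1) s0(4) r1(2)])
      then show False using gp(4)[OF s0D s1D] lt that E_ge_1 by auto
    qed
    then have y: "dC U (\<pi> U y) (\<rho>m V U (g \<tau>)) \<le> 2 * E" using right by blast
    have "\<tau>' = dp U x y"
    proof (rule ccontr)
      assume "\<tau>' \<noteq> dp U x y"
      then have "stop Q U x y < dp U x y" using \<tau>' unfolding \<tau>'_def by auto
      then obtain t where t: "t \<in> {0..dp U x y}" "Q (half U x y t)"
        by (rule stop_less[OF UV(1)]) (rule that)
      \<comment> \<open>If a geodesic from \<open>y\<close> to a point of the half-space at
        \<open>u\<close> passed near \<open>\<rho> U V\<close>, the accumulated errors would force
        \<open>u - s0\<close> to be at most \<open>15 * E\<close>. On the other hand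
        \<open>16 * E\<close> is less than the gap \<open>27 * E\<close> before
        \<open>\<tau>\<close>.\<close>
      define u where "u = s0 + 16 * E"
      have uD: "u \<in> {0..D}" and ult: "u < \<tau>" using s0 \<tau> lt E_ge_1 unfolding u_def by auto
      have "half V x y u \<subseteq> half U x y t"
      proof
        fix p assume p: "p \<in> half V x y u"
        then have pX: "p \<in> X" and pu: "u + dC V (g u) (\<pi> V p) - 20 * E \<le> dp V x p"
          unfolding half_def g_def by auto
        obtain \<gamma> where \<gamma>: "geodesic_segment (\<C> V) (dC V) (\<pi> V y) (\<pi> V p) \<gamma>"
          using domain_geodesic[OF UV(2)] UV xy pX unfolding geodesic_space_def by (meson pi_in)
        have "dp U y p \<le> 3 * E"
        proof (rule far_points_close[OF UV xy(2) pX \<gamma>], rule notI)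
          fix q r assume q: "q \<in> \<gamma>" "r \<in> \<rho> U V" "dC V q r \<le> 2 * E"
          have qV: "q \<in> \<C> V" "dC V (\<pi> V y) q + dC V q (\<pi> V p) = dp V y p"
            using V.geodesic_segment_isometry(2,3)[OF \<gamma> q(1) q(1)] by auto
          have "dC V q (g s0) \<le> 5 * E"
            by (rule close_to_rho_close[OF UV qV(1) gp(3)[OF s0D] q(2) s0(3) q(3) s0(4)])
          moreover have "dC V (\<pi> V y) (g s0) \<le> dC V (\<pi> V y) q + dC V q (g s0)"
            "dC V (\<pi> V p) (g s0) \<le> dC V (\<pi> V p) q + dC V q (g s0)"
            "dp V x p \<le> dC V (\<pi> V x) (g s0) + dC V (g s0) (\<pi> V p)"
            "dp V y p \<le> dC V (\<pi> V y) (g u) + dC V (g u) (\<pi> V p)"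
            by (rule V.triangle; use UV xy pX qV gp(3)[OF s0D] gp(3)[OF uD] in auto)+
          moreover have "dC V (\<pi> V y) (g s0) = D - s0" "dC V (\<pi> V y) (g u) = D - u"
            using gp(6)[OF s0D] gp(6)[OF uD] by (simp_all add: V.commute)
          ultimately show False
            using qV(2) gp(5)[OF s0D] pu V.commute[of "\<pi> V p" q] V.commute[of "\<pi> V p" "g s0"] E_ge_1
            unfolding u_def by linarith
        qed
        then show "p \<in> half U x y t" using near_end_in_half[OF UV(1) xy t(1) pX] E_ge_1 by simp
      qed
      then have "\<tau> \<le> u" using stop_le[OF _ UV(2), of u] uD Q t(2) unfolding \<tau>_def D_def by blast
      then show False using ult by simp
    qed
    then show ?thesis using y gU(2) E_ge_1 by simp
  qed
  then show ?thesis unfolding g_def \<tau>_def \<tau>'_def .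
qed

lemma stop_tuple_consistent:
  assumes Q: "\<forall>H H'. Q H \<longrightarrow> H' \<subseteq> H \<longrightarrow> Q H'" and xy: "x \<in> X" "y \<in> X"
  shows "consistent (30 * E) (\<lambda>U. geo U x y (stop Q U x y))"
  unfolding consistent_def
proof (intro conjI ballI impI)
  show bC: "geo U x y (stop Q U x y) \<in> \<C> U" if "U \<in> \<SS>" for U
    using geo_props(3)[OF that xy] stop_bounds[OF that] by blast
  fix U V assume UV: "U \<in> \<SS>" "V \<in> \<SS>"
  show "near_rho U V (geo V x y (stop Q V x y)) (30 * E) \<or>
    dC U (geo U x y (stop Q U x y)) (\<rho>m V U (geo V x y (stop Q V x y))) \<le> 30 * E" if "U \<sqsubset> V"
    using stop_tuple_consistent_nest[OF Q xy UV that] by blast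
  have both: "near_rho V U (geo U x y (stop Q U x y)) (30 * E)"
    if n: "near_rho V U (\<pi> U x) (2 * E)" "near_rho V U (\<pi> U y) (2 * E)" "U \<in> \<SS>" "V \<in> \<SS>" "V \<pitchfork> U" for U V
  proof -
    have "dp U x y \<le> 2 * E + 2 * E" by (rule near_rho_close[of V]) (use n xy in auto)
    then have "near_rho V U (geo U x y (stop Q U x y)) (2 * E + 4 * E)"
      using near_rho_shift[OF n(4,3) _ n(1), of "geo U x y (stop Q U x y)" "4 * E"] n xy 
        geo_props(3,5)[OF n(3) xy stop_bounds[OF n(3)]] stop_bounds[OF n(3), of Q x y]
        dom_commute[OF n(3), of "geo U x y (stop Q U x y)" "\<pi> U x"] by auto
    then show ?thesis by (rule near_rho_mono) (use E_ge_1 in simp)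
  qed
  assume tr: "U \<pitchfork> V"
  then have tr': "V \<pitchfork> U" using transverse_sym UV by blast
  show "near_rho V U (geo U x y (stop Q U x y)) (30 * E) \<or>
    near_rho U V (geo V x y (stop Q V x y)) (30 * E)"
    using transverse_dichotomy[OF UV tr xy(1)] transverse_dichotomy[OF UV tr xy(2)]
      both[of V U] both[of U V] UV tr tr'
      stop_tuple_consistent_transverse[OF Q xy UV tr] stop_tuple_consistent_transverse[OF Q xy UV(2,1) tr']
    by blast
qed


subsection \<open>Walls and chains\<close>

text \<open>In a tree, the condition says that the two sets lie on different sides of a segment of length \<open>M\<close>.\<close>

definition wall_in :: "real \<Rightarrow> 'u \<Rightarrow> 'a set \<times> 'a set \<Rightarrow> bool"
  where "wall_in M U w \<longleftrightarrow> U \<in> \<SS> \<and> fst w \<subseteq> X \<and> snd w \<subseteq> X \<and>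
    (\<forall>p\<in>fst w. \<forall>q\<in>fst w. \<forall>r\<in>snd w. \<forall>s\<in>snd w. dp U p q + dp U r s + 2 * M \<le> dp U p r + dp U q s)"

text \<open>A wall may leave points on neither side. The condition says that such gaps do not
  overlap: a point that is not on the first side of \<open>w\<close> has already passed
  \<open>v\<close>.\<close>

definition prec :: "'a set \<times> 'a set \<Rightarrow> 'a set \<times> 'a set \<Rightarrow> bool"
  where "prec v w \<longleftrightarrow> X - fst w \<subseteq> snd v"

text \<open>The ends are sets so that a chain can lead from a point to a whole half-space.\<close>

definition chain :: "real \<Rightarrow> 'a set \<Rightarrow> 'a set \<Rightarrow> ('a set \<times> 'a set) list \<Rightarrow> bool"
  where "chain M P Q ws \<longleftrightarrow> sorted_wrt prec ws \<and>
    (\<forall>w\<in>set ws. (\<exists>U. wall_in M U w) \<and> P \<subseteq> fst w \<and> Q \<subseteq> snd w)"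

lemma wall_gap:
  assumes "wall_in M U w" "x \<in> fst w" "y \<in> snd w"
  shows "M \<le> dp U x y"
proof -
  have S: "U \<in> \<SS>" "x \<in> X" "y \<in> X" using assms unfolding wall_in_def by auto
  have "dp U x x + dp U y y + 2 * M \<le> dp U x y + dp U x y" using assms unfolding wall_in_def by blast
  then show ?thesis using S by simp
qed

lemma wall_swap:
  assumes "wall_in M U w"
  shows "wall_in M U (prod.swap w)"
proof -
  have U: "U \<in> \<SS>" using assms unfolding wall_in_def by blast
  have "dp U p q + dp U r s + 2 * M \<le> dp U p r + dp U q s"
    if "p \<in> snd w" "q \<in> snd w" "r \<in> fst w" "s \<in> fst w" for p q r s
  proof -
    have "dp U r s + dp U p q + 2 * M \<le> dp U r p + dp U s q"
      using assms that unfolding wall_in_def by blast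
    then show ?thesis
      using dom_commute[OF U, of "\<pi> U r" "\<pi> U p"] dom_commute[OF U, of "\<pi> U s" "\<pi> U q"] by linarith
  qed
  moreover have "fst w \<subseteq> X" "snd w \<subseteq> X" using assms unfolding wall_in_def by auto
  ultimately show ?thesis using U unfolding wall_in_def fst_swap snd_swap by blast
qed

lemma wall_disjoint:
  assumes "wall_in M U w" "0 < M"
  shows "fst w \<inter> snd w = {}"
proof -
  have "False" if "x \<in> fst w" "x \<in> snd w" for x
    using wall_gap[OF assms(1) that] assms that unfolding wall_in_def by auto
  then show ?thesis by blast
qed

section \<open>Cutting, reversing and bounding chains\<close>

lemma chain_Nil: "chain M P Q []"
  unfolding chain_def by simp

lemma chain_take: "chain M P Q ws \<Longrightarrow> chain M P Q (take k ws)"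
  unfolding chain_def by (auto simp: sorted_wrt_take dest: in_set_takeD)

lemma chain_mono: "chain M P Q ws \<Longrightarrow> P' \<subseteq> P \<Longrightarrow> Q' \<subseteq> Q \<Longrightarrow> chain M P' Q' ws"
  unfolding chain_def by blast

lemma chain_rev:
  assumes "chain M P Q ws"
  shows "chain M Q P (rev (map prod.swap ws))"
proof -
  have X: "fst w \<subseteq> X" "snd w \<subseteq> X" if "w \<in> set ws" for w
    using assms that unfolding chain_def wall_in_def by blast+
  have "sorted_wrt (\<lambda>v w. prec (prod.swap w) (prod.swap v)) ws"
    by (rule sorted_wrt_mono_rel[of _ prec]) (use assms X in \<open>auto simp: chain_def prec_def\<close>)
  then have "sorted_wrt prec (rev (map prod.swap ws))"
    by (simp add: sorted_wrt_rev sorted_wrt_map)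
  moreover have "(\<exists>U. wall_in M U v) \<and> Q \<subseteq> fst v \<and> P \<subseteq> snd v" if v: "v \<in> set (rev (map prod.swap ws))" for v
  proof -
    obtain w where w: "w \<in> set ws" "v = prod.swap w" using v by auto
    obtain U where "wall_in M U w" using assms w(1) unfolding chain_def by blast
    then have "wall_in M U v" using wall_swap w(2) by blast
    then show ?thesis using assms w unfolding chain_def by auto
  qed
  ultimately show ?thesis unfolding chain_def by blast
qed

lemma chain_before:
  assumes "chain M P Q ws" "i < length ws" "z \<in> X" "z \<notin> fst (ws ! i)"
  shows "chain M P {z} (take i ws)"
proof -
  have "z \<in> snd w" if w: "w \<in> set (take i ws)" for w
  proof -
    obtain j where "j < i" "w = ws ! j" using w by (auto simp: in_set_conv_nth)
    then have "prec w (ws ! i)" using assms unfolding chain_def by (auto simp: sorted_wrt_iff_nth_less)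
    then show ?thesis using assms unfolding prec_def by auto
  qed
  then show ?thesis using chain_take[OF assms(1), of i] unfolding chain_def by auto
qed

lemma chain_after:
  assumes "chain M P Q ws" "i < length ws" "z \<in> X" "z \<notin> snd (ws ! i)"
  shows "chain M {z} Q (drop (Suc i) ws)"
proof -
  have "z \<in> fst w" if w: "w \<in> set (drop (Suc i) ws)" for w
  proof -
    obtain j where "j < length ws - Suc i" "w = ws ! (Suc i + j)"
      using w by (auto simp: in_set_conv_nth)
    then have "prec (ws ! i) w" using assms unfolding chain_def by (auto simp: sorted_wrt_iff_nth_less)
    then show ?thesis using assms unfolding prec_def by auto
  qed
  then show ?thesis using assms(1) unfolding chain_def by (auto simp: sorted_wrt_drop dest: in_set_dropD)
qed

text \<open>The chain is cut at the first wall that \<open>z\<close> has not passed. All later walls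
  have \<open>z\<close> on their first side, so only this one is lost.\<close>

lemma chain_triangle:
  assumes "chain M P Q ws" "z \<in> X"
  obtains ws1 ws2 where "chain M P {z} ws1" "chain M {z} Q ws2" "length ws \<le> length ws1 + length ws2 + 1"
proof (cases "\<exists>i<length ws. z \<notin> snd (ws ! i)")
  case False
  then have "z \<in> snd w" if "w \<in> set ws" for w using that by (metis in_set_conv_nth)
  then have "chain M P {z} ws" using assms(1) unfolding chain_def by blast
  then show thesis using that[OF _ chain_Nil] by simp
next
  case True
  define i where "i = (LEAST i. i < length ws \<and> z \<notin> snd (ws ! i))"
  have i: "i < length ws \<and> z \<notin> snd (ws ! i)" unfolding i_def by (rule LeastI_ex) (use True in auto)
  have less: "z \<in> snd (ws ! j)" if "j < i" for j
    using not_less_Least[of j] that i unfolding i_def by fastforce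
  have "z \<in> snd w" if w: "w \<in> set (take i ws)" for w
  proof -
    obtain j where "j < i" "w = ws ! j" using w by (auto simp: in_set_conv_nth)
    then show ?thesis using less by blast
  qed
  then have "chain M P {z} (take i ws)"
    using chain_take[OF assms(1), of i] unfolding chain_def by blast
  then show thesis using that[OF _ chain_after[OF assms(1) _ assms(2)]] i by auto
qed

lemma chain_empty_if_close:
  assumes "chain M {x} {y} ws" "\<And>U. U \<in> \<SS> \<Longrightarrow> dp U x y < M"
  shows "ws = []"
proof (rule ccontr)
  assume "ws \<noteq> []"
  then have "hd ws \<in> set ws" by simp
  then obtain U where U: "wall_in M U (hd ws)" "x \<in> fst (hd ws)" "y \<in> snd (hd ws)"
    using assms(1) unfolding chain_def by auto
  moreover have "U \<in> \<SS>" using U unfolding wall_in_def by blast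
  ultimately show False using wall_gap[OF U] assms(2)[of U] by simp
qed

text \<open>No wall fits between consecutive points, so each of them contributes only the 1 of
  \<open>chain_triangle\<close>.\<close>

lemma chain_length_along_sequence:
  assumes "0 < M" "\<And>i. z i \<in> X"
    and "\<And>U i. U \<in> \<SS> \<Longrightarrow> i < N \<Longrightarrow> dp U (z i) (z (Suc i)) < M"
    and "chain M {z 0} {z N} ws"
  shows "length ws \<le> N"
  using assms(3,4)
proof (induction N arbitrary: ws)
  case 0
  then show ?case using chain_empty_if_close[of M "z 0" "z 0" ws] assms(1,2) by auto
next
  case (Suc N)
  obtain ws1 ws2 where w: "chain M {z 0} {z N} ws1" "chain M {z N} {z (Suc N)} ws2"
    "length ws \<le> length ws1 + length ws2 + 1"
    by (rule chain_triangle[OF Suc.prems(2) assms(2)[of N]]) (rule that)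
  have "length ws1 \<le> N" using Suc.IH[OF _ w(1)] Suc.prems(1) by simp
  moreover have "ws2 = []" by (rule chain_empty_if_close[OF w(2)]) (use Suc.prems(1) in simp)
  ultimately show ?case using w(3) by simp
qed

lemma chain_length_bound:
  obtains M0 K C where "0 \<le> K" "0 \<le> C" "0 < M0"
    "\<And>M x y ws. M0 \<le> M \<Longrightarrow> x \<in> X \<Longrightarrow> y \<in> X \<Longrightarrow> chain M {x} {y} ws \<Longrightarrow> real (length ws) \<le> K * d x y + C"
proof -
  obtain K C where K: "1 \<le> K" "0 \<le> C" and qg0: "\<forall>a\<in>X. \<forall>b\<in>X. \<exists>T\<ge>0::real. \<exists>f.
        qi_embedding K C {0..T} dist X d f \<and> f 0 = a \<and> f T = b"
    using quasigeodesic unfolding quasigeodesic_space_def by blast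
  define path where "path a b T f \<longleftrightarrow> qi_embedding K C {0..T} dist X d f \<and> f 0 = a \<and> f T = b"
    for a b and T :: real and f
  have qg: "\<forall>a\<in>X. \<forall>b\<in>X. \<exists>T\<ge>0. \<exists>f. path a b T f" using qg0 unfolding path_def .
  \<comment> \<open>Points of the quasigeodesic at times at most 1 apart differ by less than this in
    every domain, so no wall separates them.\<close>
  define M0 where "M0 = E * (K + C) + E + 1"
  have M0: "0 < M0" unfolding M0_def using E_ge_1 K by (simp add: add_nonneg_pos)
  have "real (length ws) \<le> K * d x y + (K * C + 1)"
    if M: "M0 \<le> M" and xy: "x \<in> X" "y \<in> X" and ws: "chain M {x} {y} ws" for M x y ws
  proof -
    obtain T f where "0 \<le> T" "path x y T f" using qg xy by blast
    then have T: "0 \<le> T" "qi_embedding K C {0..T} dist X d f" "f 0 = x" "f T = y"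
      unfolding path_def by auto
    have fX: "f s \<in> X" if "s \<in> {0..T}" for s using T(2) that unfolding qi_embedding_def by auto
    have fd: "dist s t / K - C \<le> d (f s) (f t) \<and> d (f s) (f t) \<le> K * dist s t + C"
      if "s \<in> {0..T}" "t \<in> {0..T}" for s t using T(2) that unfolding qi_embedding_def by blast
    define z where "z i = f (min (real i) T)" for i
    define N where "N = nat \<lceil>T\<rceil>"
    have zX: "z i \<in> X" for i unfolding z_def by (rule fX) (use T in auto)
    have "T \<le> real N" unfolding N_def by linarith
    then have z: "z 0 = x" "z N = y" using T unfolding z_def by (auto simp: min_def)
    have "dp U (z i) (z (Suc i)) < M" if "U \<in> \<SS>" for U i
    proof -
      have "dist (min (real i) T) (min (real (Suc i)) T) \<le> 1" using T by (auto simp: dist_real_def min_def)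
      then have "K * dist (min (real i) T) (min (real (Suc i)) T) \<le> K" using K mult_left_mono[of _ 1 K] by simp
      then have "d (z i) (z (Suc i)) \<le> K + C"
        using fd[of "min (real i) T" "min (real (Suc i)) T"] T unfolding z_def by auto
      then have "E * d (z i) (z (Suc i)) \<le> E * (K + C)" using E_ge_1 by (intro mult_left_mono) auto
      then show ?thesis using proj_lipschitz[OF that zX[of i] zX[of "Suc i"]] M unfolding M0_def by linarith
    qed
    then have "length ws \<le> N"
      using chain_length_along_sequence[of M z N ws] zX M M0 ws z by auto
    moreover have "real N \<le> T + 1" unfolding N_def using T by linarith
    moreover have "T \<le> K * d x y + K * C"
    proof -
      have "T / K - C \<le> d x y" using fd[of 0 T] T by (auto simp: dist_real_def)
      then have "T / K \<le> d x y + C" by simp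
      then have "T \<le> (d x y + C) * K" using K by (simp add: pos_divide_le_eq)
      then show ?thesis by (simp add: algebra_simps)
    qed
    ultimately show ?thesis by linarith
  qed
  then show thesis using that[of K "K * C + 1" M0] K M0 by auto
qed

text \<open>Based at \<open>geo U x y t\<close>, the product of \<open>x\<close> and
  \<open>y\<close> vanishes while that of \<open>x\<close> and \<open>p\<close> exceeds
  \<open>10 * E\<close>. By the four-point inequality the product of \<open>p\<close> and
  \<open>y\<close> is at most \<open>4 * E\<close>.\<close>

lemma not_half_product:
  assumes "U \<in> \<SS>" "x \<in> X" "y \<in> X" "t \<in> {0..dp U x y}" "p \<in> X" "p \<notin> half U x y t"
  shows "dC U (geo U x y t) (\<pi> U p) + (dp U x y - t) - 8 * E \<le> dp U p y"
proof -
  let ?a = "geo U x y t"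
  note g = geo_props[OF assms(1-3)]
  have "min (gromov_product (dC U) ?a (\<pi> U x) (\<pi> U p)) (gromov_product (dC U) ?a (\<pi> U p) (\<pi> U y))
     \<le> gromov_product (dC U) ?a (\<pi> U x) (\<pi> U y) + 4 * E"
    by (rule Metric_space.four_point_inequality[OF domain_metric domain_hyperbolic domain_geodesic E_ge_1])
      (use assms g in auto)
  moreover have "gromov_product (dC U) ?a (\<pi> U x) (\<pi> U y) = 0"
    using g(5,6)[OF assms(4)] dom_commute[OF assms(1), of ?a "\<pi> U x"] unfolding gromov_product_def by simp
  moreover have "10 * E < gromov_product (dC U) ?a (\<pi> U x) (\<pi> U p)"
    using assms(5,6) g(5)[OF assms(4)] dom_commute[OF assms(1), of ?a "\<pi> U x"]
    unfolding gromov_product_def half_def by simp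
  ultimately have "gromov_product (dC U) ?a (\<pi> U p) (\<pi> U y) \<le> 4 * E" using E_ge_1 by linarith
  then show ?thesis using g(6)[OF assms(4)] unfolding gromov_product_def by simp
qed

text \<open>A path from outside the first half-space into the second one passes near both base
  points in order, with total error \<open>36 * E\<close>: \<open>20 * E\<close> from the definition
  of \<open>half\<close> and twice the bound \<open>8 * E\<close> on a product. Two such estimates
  give the gap.\<close>

lemma half_wall:
  assumes U: "U \<in> \<SS>" "x \<in> X" "y \<in> X" and st: "0 \<le> s" "s + M + 36 * E \<le> t" "t \<le> dp U x y" and M: "0 < M"
  shows "wall_in M U (X - half U x y s, half U x y t)"
proof -
  let ?a = "geo U x y s" and ?b = "geo U x y t"
  note g = geo_props[OF U]
  have s: "s \<in> {0..dp U x y}" and t: "t \<in> {0..dp U x y}" using st E_ge_1 M by auto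
  have ab: "dC U ?a ?b = t - s" using g(4)[OF s t] st E_ge_1 M by auto
  have aC: "?a \<in> \<C> U" "?b \<in> \<C> U" using g(3) s t by auto
  have sep: "dC U ?a (\<pi> U p) + (t - s) + dC U ?b (\<pi> U r) - 36 * E \<le> dp U p r"
    if p: "p \<in> X" "p \<notin> half U x y s" and r: "r \<in> half U x y t" for p r
  proof -
    have rX: "r \<in> X" "t + dC U ?b (\<pi> U r) - 20 * E \<le> dp U x r" using r unfolding half_def by auto
    have "dp U p y \<le> dC U (\<pi> U p) ?b + dC U ?b (\<pi> U y)" "dp U x r \<le> dC U (\<pi> U x) ?a + dC U ?a (\<pi> U r)"
      by (rule dom_triangle; use U p rX aC in auto)+
    then have 1: "dC U ?a (\<pi> U p) + (t - s) - 8 * E \<le> dC U (\<pi> U p) ?b"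
      and 2: "(t - s) + dC U ?b (\<pi> U r) - 20 * E \<le> dC U ?a (\<pi> U r)"
      using not_half_product[OF U s p] g(6)[OF t] g(5)[OF s] rX by linarith+
    have "min (gromov_product (dC U) ?a (\<pi> U p) (\<pi> U r)) (gromov_product (dC U) ?a (\<pi> U r) ?b)
       \<le> gromov_product (dC U) ?a (\<pi> U p) ?b + 4 * E"
      by (rule Metric_space.four_point_inequality[OF domain_metric domain_hyperbolic domain_geodesic E_ge_1])
        (use U p rX aC in auto)
    moreover have "gromov_product (dC U) ?a (\<pi> U p) ?b \<le> 4 * E"
      using 1 ab unfolding gromov_product_def by simp
    moreover have "8 * E < gromov_product (dC U) ?a (\<pi> U r) ?b"
      using 2 ab st(2) M E_ge_1 dom_commute[OF U(1), of "\<pi> U r" ?b] unfolding gromov_product_def by simp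
    ultimately have "gromov_product (dC U) ?a (\<pi> U p) (\<pi> U r) \<le> 8 * E" by linarith
    then show ?thesis using 2 unfolding gromov_product_def by simp
  qed
  show ?thesis unfolding wall_in_def fst_conv snd_conv
  proof (intro conjI ballI)
    show "half U x y t \<subseteq> X" unfolding half_def by auto
    fix p q r r' assume pq: "p \<in> X - half U x y s" "q \<in> X - half U x y s"
      and r: "r \<in> half U x y t" "r' \<in> half U x y t"
    have rX: "r \<in> X" "r' \<in> X" using r unfolding half_def by auto
    have "dp U p q \<le> dC U (\<pi> U p) ?a + dC U ?a (\<pi> U q)" "dp U r r' \<le> dC U (\<pi> U r) ?b + dC U ?b (\<pi> U r')"
      by (rule dom_triangle; use U pq rX aC in auto)+
    then show "dp U p q + dp U r r' + 2 * M \<le> dp U p r + dp U q r'"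
      using sep[of p r] sep[of q r'] pq r st(2) dom_commute[OF U(1), of "\<pi> U p" ?a]
        dom_commute[OF U(1), of "\<pi> U r" ?b] by auto
  qed (use U in auto)
qed

lemma exists_chain:
  assumes U: "U \<in> \<SS>" "x \<in> X" "y \<in> X" and M: "0 < M" and n: "20 * E + real n * (M + 36 * E) \<le> dp U x y"
  obtains ws where "chain M {x} {y} ws" "length ws = n"
proof -
  \<comment> \<open>Starting at \<open>20 * E\<close> keeps \<open>x\<close> out of all the
    half-spaces. Successive walls share the half-space at \<open>s (Suc i)\<close>, so
    \<open>prec\<close> reduces to \<open>half_mono\<close>.\<close>
  define s where "s i = 20 * E + real i * (M + 36 * E)" for i
  define w where "w i = (X - half U x y (s i), half U x y (s (Suc i)))" for i
  have sm: "s i \<le> s j" if "i \<le> j" for i j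
    unfolding s_def using that M E_ge_1 by (intro add_left_mono mult_right_mono) auto
  have s0: "0 \<le> s i" "20 * E \<le> s i" for i unfolding s_def using M E_ge_1 by auto
  have sD: "s i \<le> dp U x y" if "i \<le> n" for i using sm[OF that] n unfolding s_def by linarith
  have "chain M {x} {y} (map w [0..<n])"
    unfolding chain_def
  proof (intro conjI ballI)
    show "sorted_wrt prec (map w [0..<n])"
      unfolding sorted_wrt_map sorted_wrt_iff_nth_less prec_def w_def
    proof (intro allI impI, simp)
      fix i j assume ij: "i < j" "j < n"
      have "X - (X - half U x y (s j)) \<subseteq> half U x y (s j)" by auto
      also have "\<dots> \<subseteq> half U x y (s (Suc i))"
        by (rule half_mono[OF U]) (use ij s0 sm sD in auto)
      finally show "X - (X - half U x y (s j)) \<subseteq> half U x y (s (Suc i))" .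
    qed
    fix v assume "v \<in> set (map w [0..<n])"
    then obtain i where i: "i < n" "v = w i" by auto
    have "wall_in M U (w i)" unfolding w_def
      by (rule half_wall[OF U]) (use s0 sD[of "Suc i"] i M in \<open>auto simp: s_def algebra_simps\<close>)
    then show "\<exists>U. wall_in M U v" using i by blast
    have "x \<notin> half U x y (s i)"
      using half_far[OF U(1), of x x y "s i"] geo_props(5)[OF U, of "s i"] s0[of i] sD[of i] i U E_ge_1
        dom_commute[OF U(1), of "geo U x y (s i)" "\<pi> U x"] unfolding half_def by auto
    then show "{x} \<subseteq> fst v" using i U unfolding w_def by auto
    have "y \<in> half U x y (s (Suc i))"
      by (rule near_end_in_half[OF U]) (use s0 sD[of "Suc i"] i U E_ge_1 in auto)
    then show "{y} \<subseteq> snd v" using i unfolding w_def by auto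
  qed
  then show thesis using that by simp
qed

subsection \<open>Crossing walls\<close>

text \<open>Points near \<open>\<rho> V U\<close> in \<open>U\<close> are all on one side of
  \<open>w\<close>, and points near \<open>\<rho> U V\<close> in \<open>V\<close> all on one side of
  \<open>v\<close>, since walls are wider than \<open>4 * E\<close>. The corner opposite to both
  sides is near neither set.\<close>

lemma crossing_walls_not_transverse:
  assumes w: "wall_in M U w" "wall_in M V v" and M: "5 * E < M" and UV: "U \<pitchfork> V"
    and quad: "p \<in> fst w" "p \<in> fst v" "q \<in> fst w" "q \<in> snd v" "r \<in> snd w" "r \<in> fst v" "s \<in> snd w" "s \<in> snd v"
  shows False
proof -
  have S: "U \<in> \<SS>" "V \<in> \<SS>" using w unfolding wall_in_def by auto
  have X: "p \<in> X" "q \<in> X" "r \<in> X" "s \<in> X" using w quad unfolding wall_in_def by auto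
  have VU: "V \<pitchfork> U" using transverse_sym S UV by blast
  have nU: "\<not> (near_rho V U (\<pi> U a) (2 * E) \<and> near_rho V U (\<pi> U b) (2 * E))"
    if "a \<in> fst w" "b \<in> snd w" "a \<in> X" "b \<in> X" for a b
    using near_rho_close[OF S(2,1), of "\<pi> U a" "2 * E" "\<pi> U b" "2 * E"] VU wall_gap[OF w(1) that(1,2)] that S M E_ge_1
    by auto
  have nV: "\<not> (near_rho U V (\<pi> V a) (2 * E) \<and> near_rho U V (\<pi> V b) (2 * E))"
    if "a \<in> fst v" "b \<in> snd v" "a \<in> X" "b \<in> X" for a b
    using near_rho_close[OF S, of "\<pi> V a" "2 * E" "\<pi> V b" "2 * E"] UV wall_gap[OF w(2) that(1,2)] that S M E_ge_1
    by auto
  show False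
    using transverse_dichotomy[OF S UV X(1)] transverse_dichotomy[OF S UV X(2)]
      transverse_dichotomy[OF S UV X(3)] transverse_dichotomy[OF S UV X(4)] nU nV quad X by blast
qed

text \<open>The wall \<open>w\<close> separates \<open>p\<close> from \<open>r\<close> and
  \<open>q\<close> from \<open>s\<close> in \<open>U\<close>, so both geodesics in \<open>V\<close>
  pass near \<open>\<rho> U V\<close>. Exchanging their ends there bounds
  \<open>dp V p q + dp V r s\<close> by the other sum plus \<open>10 * E\<close>, whereas
  \<open>v\<close> demands a surplus of \<open>2 * M\<close>.\<close>

lemma crossing_walls_not_nested:
  assumes w: "wall_in M U w" "wall_in M V v" and M: "5 * E < M" and UV: "U \<sqsubset> V"
    and quad: "p \<in> fst w" "p \<in> fst v" "q \<in> fst w" "q \<in> snd v" "r \<in> snd w" "r \<in> fst v" "s \<in> snd w" "s \<in> snd v"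
  shows False
proof -
  have S: "U \<in> \<SS>" "V \<in> \<SS>" using w unfolding wall_in_def by auto
  have X: "p \<in> X" "q \<in> X" "r \<in> X" "s \<in> X" using w quad unfolding wall_in_def by auto
  interpret V: Metric_space "\<C> V" "dC V" by (rule domain_metric[OF S(2)])
  have ex: "\<exists>g h. g \<in> \<C> V \<and> dC V (\<pi> V a) g + dC V g (\<pi> V b) = dp V a b \<and> h \<in> \<rho> U V \<and> dC V g h \<le> 2 * E"
    if ab: "a \<in> fst w" "b \<in> snd w" "a \<in> X" "b \<in> X" for a b
  proof -
    obtain \<gamma> where \<gamma>: "geodesic_segment (\<C> V) (dC V) (\<pi> V a) (\<pi> V b) \<gamma>"
      using domain_geodesic[OF S(2)] S ab unfolding geodesic_space_def by (meson pi_in)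
    have "\<not> dp U a b \<le> 3 * E" using wall_gap[OF w(1) ab(1,2)] M E_ge_1 by simp
    then obtain g h where "g \<in> \<gamma>" "h \<in> \<rho> U V" "dC V g h \<le> 2 * E"
      using far_points_close[OF S UV ab(3,4) \<gamma>] by blast
    then show ?thesis using V.geodesic_segment_isometry(2,3)[OF \<gamma>] by blast
  qed
  obtain g h where g: "g \<in> \<C> V" "dC V (\<pi> V p) g + dC V g (\<pi> V r) = dp V p r" "h \<in> \<rho> U V" "dC V g h \<le> 2 * E"
    using ex[of p r] quad X by blast
  obtain g' h' where g': "g' \<in> \<C> V" "dC V (\<pi> V q) g' + dC V g' (\<pi> V s) = dp V q s" "h' \<in> \<rho> U V" "dC V g' h' \<le> 2 * E"
    using ex[of q s] quad X by blast
  have gg: "dC V g g' \<le> 5 * E" by (rule close_to_rho_close[OF S UV g(1) g'(1) g(3) g'(3) g(4) g'(4)])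
  have "dp V p q \<le> dC V (\<pi> V p) g + dC V g (\<pi> V q)" "dC V g (\<pi> V q) \<le> dC V g g' + dC V g' (\<pi> V q)"
    "dp V r s \<le> dC V (\<pi> V r) g + dC V g (\<pi> V s)" "dC V g (\<pi> V s) \<le> dC V g g' + dC V g' (\<pi> V s)"
    by (rule V.triangle; use S X g g' in auto)+
  moreover have "dp V p r + dp V q s + 2 * M \<le> dp V p q + dp V r s"
    using w(2) quad unfolding wall_in_def by blast
  ultimately show False using g(2) g'(2) gg M V.commute[of g' "\<pi> V q"] V.commute[of g "\<pi> V r"] by linarith
qed

lemma crossing_walls_orthogonal:
  assumes w: "wall_in M U w" "wall_in M V v" and M: "5 * E < M"
    and quad: "p \<in> fst w" "p \<in> fst v" "q \<in> fst w" "q \<in> snd v" "r \<in> snd w" "r \<in> fst v" "s \<in> snd w" "s \<in> snd v"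
  shows "U \<perp> V" "U \<noteq> V"
proof -
  have S: "U \<in> \<SS>" "V \<in> \<SS>" using w unfolding wall_in_def by auto
  \<comment> \<open>In a single domain the two walls compare the same two sums in opposite
    directions.\<close>
  show "U \<noteq> V"
  proof
    assume "U = V"
    then have "dp U p q + dp U r s + 2 * M \<le> dp U p r + dp U q s"
      "dp U p r + dp U q s + 2 * M \<le> dp U p q + dp U r s"
      using w quad unfolding wall_in_def by blast+
    then show False using M E_ge_1 by linarith
  qed
  moreover have "\<not> U \<pitchfork> V" using crossing_walls_not_transverse[OF w M _ quad] by blast
  moreover have "\<not> U \<sqsubset> V" using crossing_walls_not_nested[OF w M _ quad] by blast
  moreover have "\<not> V \<sqsubset> U"
    using crossing_walls_not_nested[OF w(2,1) M _ quad(2,1,6,5,4,3,8,7)] by blast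
  ultimately show "U \<perp> V" unfolding transverse_def pnest_def by blast
qed

subsection \<open>Intermediate points\<close>

text \<open>The point \<open>z\<close> realises the stopping tuple for the property of being
  preceded by \<open>R\<close> walls starting at \<open>x\<close>. A longer chain to
  \<open>z\<close> would have permitted an earlier stop in some domain. Conversely, the first wall
  of a chain from \<open>z\<close> to \<open>y\<close> can be traded for the \<open>R\<close> walls
  that caused the stop in the domain of that wall.\<close>

lemma intermediate_point:
  obtains M0 where "0 < M0" "\<And>M R x y. M0 \<le> M \<Longrightarrow> 1 \<le> R \<Longrightarrow> x \<in> X \<Longrightarrow> y \<in> X \<Longrightarrow>
    \<exists>z\<in>X. (\<forall>ws. chain M {x} {z} ws \<longrightarrow> length ws \<le> R) \<and>
      (\<forall>ws. chain M {z} {y} ws \<longrightarrow> ws \<noteq> [] \<longrightarrow> (\<exists>vs. chain M {x} {y} vs \<and> length vs + 1 = R + length ws))"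
proof -
  have E0: "0 \<le> 30 * E" using E_ge_1 by simp
  obtain \<kappa> where \<kappa>: "0 \<le> \<kappa>" and real: "\<And>b x y. consistent (30 * E) b \<Longrightarrow> x \<in> X \<Longrightarrow> y \<in> X \<Longrightarrow>
    \<forall>U\<in>\<SS>. dC U (\<pi> U x) (b U) \<le> dp U x y \<Longrightarrow> \<exists>z\<in>X. \<forall>U\<in>\<SS>. dC U (\<pi> U z) (b U) \<le> \<kappa>"
    by (rule realisation[OF E0]) (rule that)
  show thesis
  proof (rule that[of "\<kappa> + 20 * E + 2"])
    show "0 < \<kappa> + 20 * E + 2" using \<kappa> E_ge_1 by simp
    fix M :: real and R :: nat and x y assume M: "\<kappa> + 20 * E + 2 \<le> M" and R: "1 \<le> R" and xy: "x \<in> X" "y \<in> X"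
    have M0: "0 < M" using M \<kappa> E_ge_1 by linarith
    define Q where "Q H \<longleftrightarrow> (\<exists>ws. length ws = R \<and> chain M {x} H ws)" for H
    have Q: "\<forall>H H'. Q H \<longrightarrow> H' \<subseteq> H \<longrightarrow> Q H'" unfolding Q_def using chain_mono by blast
    define \<tau> where "\<tau> U = stop Q U x y" for U
    have \<tau>: "\<tau> U \<in> {0..dp U x y}" if "U \<in> \<SS>" for U unfolding \<tau>_def using stop_bounds[OF that] .
    have "consistent (30 * E) (\<lambda>U. geo U x y (\<tau> U))" unfolding \<tau>_def by (rule stop_tuple_consistent[OF Q xy])
    moreover have "dC U (\<pi> U x) (geo U x y (\<tau> U)) \<le> dp U x y" if "U \<in> \<SS>" for U
      using geo_props(5)[OF that xy \<tau>[OF that]] \<tau>[OF that] by simp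
    ultimately obtain z where z: "z \<in> X" "\<And>U. U \<in> \<SS> \<Longrightarrow> dC U (\<pi> U z) (geo U x y (\<tau> U)) \<le> \<kappa>"
      using real[OF _ xy] by blast
    have near: "\<bar>dp U z p - dC U (geo U x y t) (\<pi> U p)\<bar> \<le> \<kappa> + 1"
      if U: "U \<in> \<SS>" and t: "t \<in> {0..dp U x y}" "\<bar>t - \<tau> U\<bar> \<le> 1" and p: "p \<in> X" for U t p
    proof -
      have gC: "geo U x y t \<in> \<C> U" "geo U x y (\<tau> U) \<in> \<C> U" using geo_props(3)[OF U xy] t \<tau>[OF U] by auto
      have "dC U (geo U x y (\<tau> U)) (geo U x y t) \<le> 1"
        using geo_props(4)[OF U xy \<tau>[OF U] t(1)] t(2) by linarith
      moreover have "dC U (\<pi> U z) (geo U x y t)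
          \<le> dC U (\<pi> U z) (geo U x y (\<tau> U)) + dC U (geo U x y (\<tau> U)) (geo U x y t)"
        "dp U z p \<le> dC U (\<pi> U z) (geo U x y t) + dC U (geo U x y t) (\<pi> U p)"
        "dC U (geo U x y t) (\<pi> U p) \<le> dC U (geo U x y t) (\<pi> U z) + dp U z p"
        by (rule dom_triangle; use U z p gC in auto)+
      ultimately show ?thesis using z(2)[OF U] dom_commute[OF U, of "geo U x y t" "\<pi> U z"] by linarith
    qed
    have "length ws \<le> R" if ws: "chain M {x} {z} ws" for ws
    proof (rule ccontr)
      assume "\<not> ?thesis"
      then have R': "R < length ws" by simp
      define w where "w = ws ! R"
      have "w \<in> set ws" unfolding w_def using R' by simp
      then obtain U where wU: "wall_in M U w" "x \<in> fst w" "z \<in> snd w" using ws unfolding chain_def by auto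
      have U: "U \<in> \<SS>" using wU unfolding wall_in_def by blast
      \<comment> \<open>A time before the stop, where \<open>Q\<close> must fail, unless the walk
        stops at its very start.\<close>
      define t where "t = max 0 (\<tau> U - 1)"
      have t: "t \<in> {0..dp U x y}" "\<bar>t - \<tau> U\<bar> \<le> 1" "\<tau> U \<le> t + 1" using \<tau>[OF U] unfolding t_def by auto
      note tz = near[OF U t(1,2)]
      have zz: "dC U (geo U x y t) (\<pi> U z) \<le> \<kappa> + 1" using tz[OF z(1)] z U by auto
      have xz: "M \<le> dp U x z" by (rule wall_gap[OF wU])
      have xz': "dp U x z \<le> t + \<kappa> + 1"
        
        using tz[OF xy(1)] geo_props(5)[OF U xy t(1)] dom_commute[OF U, of "\<pi> U x" "geo U x y t"]
          dom_commute[OF U, of "\<pi> U x" "\<pi> U z"] by linarith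
      \<comment> \<open>Seen from \<open>x\<close>, such a \<open>p\<close> lies coarsely beyond
        \<open>z\<close>; but if \<open>w\<close> had \<open>x\<close> and \<open>p\<close> on the
        side opposite to \<open>z\<close>, the detour through \<open>z\<close> would cost
        \<open>2 * M\<close>.\<close>
      have "p \<notin> fst w" if p: "p \<in> half U x y t" for p
      proof
        assume pw: "p \<in> fst w"
        have pX: "p \<in> X" "t + dC U (geo U x y t) (\<pi> U p) - 20 * E \<le> dp U x p" using p unfolding half_def by auto
        have "dp U x p + dp U z z + 2 * M \<le> dp U x z + dp U p z"
          using wU pw unfolding wall_in_def by blast
        then show False
          using pX(2) xz' tz[OF pX(1)] M dom_zero[OF U pi_in[OF U z(1)]]
            dom_commute[OF U, of "\<pi> U p" "\<pi> U z"] E_ge_1 \<kappa> by linarith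
      qed
      then have "half U x y t \<subseteq> X - fst w" unfolding half_def by blast
      then have "half U x y t \<subseteq> snd v" if v: "v \<in> set (take R ws)" for v
      proof -
        obtain j where "j < R" "v = ws ! j" using v R' by (auto simp: in_set_conv_nth)
        then have "prec v w" using ws R' unfolding chain_def w_def by (auto simp: sorted_wrt_iff_nth_less)
        then show ?thesis using \<open>half U x y t \<subseteq> X - fst w\<close> unfolding prec_def by blast
      qed
      then have "chain M {x} (half U x y t) (take R ws)"
        using chain_take[OF ws, of R] unfolding chain_def by blast
      then have "Q (half U x y t)" unfolding Q_def using R' by (intro exI[of _ "take R ws"]) auto
      then have "\<tau> U \<le> t" using stop_le[of t U x y Q] t U unfolding \<tau>_def by blast
      then have "t = 0" unfolding t_def by linarith
      then show False using xz xz' M E_ge_1 by linarith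
    qed
    moreover have "\<exists>vs. chain M {x} {y} vs \<and> length vs + 1 = R + length ws"
      if ws: "chain M {z} {y} ws" "ws \<noteq> []" for ws
    proof -
      obtain w ws' where wws: "ws = w # ws'" using ws(2) by (cases ws) auto
      obtain U where wU: "wall_in M U w" "z \<in> fst w" "y \<in> snd w" using ws wws unfolding chain_def by auto
      have U: "U \<in> \<SS>" using wU unfolding wall_in_def by blast
      have "\<tau> U < dp U x y"
      proof (rule ccontr)
        assume "\<not> ?thesis"
        then have "geo U x y (\<tau> U) = \<pi> U y" using \<tau>[OF U] geo_props(2)[OF U xy] by (metis antisym atLeastAtMost_iff not_less)
        then show False using wall_gap[OF wU] z(2)[OF U] M E_ge_1 by simp
      qed
      then have "stop Q U x y < dp U x y" unfolding \<tau>_def .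
      then obtain t where "t \<in> {0..dp U x y}" "stop Q U x y \<le> t" "t \<le> stop Q U x y + 1" "Q (half U x y t)"
        by (rule stop_less[OF U]) (rule that)
      then have t: "t \<in> {0..dp U x y}" "\<tau> U \<le> t" "t \<le> \<tau> U + 1" "Q (half U x y t)"
        unfolding \<tau>_def by auto
      then obtain vs where vs: "length vs = R" "chain M {x} (half U x y t) vs" unfolding Q_def by blast
      have tz: "\<bar>dp U z p - dC U (geo U x y t) (\<pi> U p)\<bar> \<le> \<kappa> + 1" if "p \<in> X" for p
        by (rule near[OF U t(1) _ that]) (use t in auto)
      \<comment> \<open>A point outside the half-space is reached from \<open>y\<close> by passing
        near \<open>geo U x y t\<close>, hence near \<open>z\<close>; but \<open>w\<close> has
        \<open>y\<close> and \<open>p\<close> on the side opposite to \<open>z\<close>.\<close>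
      have sub: "snd w \<subseteq> half U x y t"
      proof
        fix p assume p: "p \<in> snd w"
        have pX: "p \<in> X" using p wU unfolding wall_in_def by blast
        have "dp U z z + dp U p y + 2 * M \<le> dp U z p + dp U z y"
          using wU p unfolding wall_in_def by blast
        then have "dp U p y + 2 * M \<le> dC U (geo U x y t) (\<pi> U p) + (dp U x y - t) + 2 * \<kappa> + 2"
          using tz[OF pX] tz[OF xy(2)] geo_props(6)[OF U xy t(1)] dom_zero[OF U pi_in[OF U z(1)]]
          by linarith
        then show "p \<in> half U x y t" using not_half_product[OF U xy t(1) pX] M E_ge_1 by force
      qed
      \<comment> \<open>The second side of \<open>w\<close> bridges the half-space and the remaining
        walls; dropping \<open>w\<close> itself is the loss of 1.\<close>
      have vX: "X - fst v \<subseteq> half U x y t" if "v \<in> set ws'" for v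
        using ws(1) wws that sub unfolding chain_def prec_def by auto
      have "vs \<noteq> []" using vs R by auto
      then have "hd vs \<in> set vs" by simp
      then obtain V where "wall_in M V (hd vs)" "x \<in> fst (hd vs)" "half U x y t \<subseteq> snd (hd vs)"
        using vs(2) unfolding chain_def by auto
      then have x: "x \<notin> half U x y t" using wall_disjoint[of M V "hd vs"] M0 by blast
      have y: "y \<in> half U x y t" using sub wU by blast
      have "chain M {x} {y} (vs @ ws')"
        unfolding chain_def
      proof (intro conjI ballI)
        have "prec v v'" if "v \<in> set vs" "v' \<in> set ws'" for v v'
          using vX[OF that(2)] vs(2) that(1) unfolding chain_def prec_def by blast
        then show "sorted_wrt prec (vs @ ws')"
          using vs(2) ws(1) wws unfolding chain_def sorted_wrt_append by auto
        fix v assume v: "v \<in> set (vs @ ws')"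
        show "\<exists>U. wall_in M U v" using v vs(2) ws(1) wws unfolding chain_def by auto
        have "x \<in> fst v" if "v \<in> set ws'" using vX[OF that] xy x by blast
        then show "{x} \<subseteq> fst v" using v vs(2) unfolding chain_def by auto
        show "{y} \<subseteq> snd v" using v vs(2) ws(1) wws y unfolding chain_def by auto
      qed
      then show ?thesis using vs wws by (intro exI[of _ "vs @ ws'"]) auto
    qed
    ultimately show "\<exists>z\<in>X. (\<forall>ws. chain M {x} {z} ws \<longrightarrow> length ws \<le> R) \<and>
      (\<forall>ws. chain M {z} {y} ws \<longrightarrow> ws \<noteq> [] \<longrightarrow> (\<exists>vs. chain M {x} {y} vs \<and> length vs + 1 = R + length ws))"
      using z(1) by blast
  qed
qed


section \<open>Longest chains as a coarse length function\<close>

definition longest_chain :: "real \<Rightarrow> 'a \<Rightarrow> 'a \<Rightarrow> nat"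
  where "longest_chain M x y = Max {length ws | ws. chain M {x} {y} ws}"

lemma chain_space:
  obtains M where "coarse_chain_space X d (longest_chain M) (nat \<lfloor>E\<rfloor> + 1)"
proof -
  obtain M1 K C where K: "0 \<le> K" "0 \<le> C" "0 < M1"
    and bound: "\<And>M x y ws. M1 \<le> M \<Longrightarrow> x \<in> X \<Longrightarrow> y \<in> X \<Longrightarrow> chain M {x} {y} ws \<Longrightarrow> real (length ws) \<le> K * d x y + C"
    by (rule chain_length_bound) (rule that)
  obtain M2 where M2: "0 < M2" and inter: "\<And>M R x y. M2 \<le> M \<Longrightarrow> 1 \<le> R \<Longrightarrow> x \<in> X \<Longrightarrow> y \<in> X \<Longrightarrow>
    \<exists>z\<in>X. (\<forall>ws. chain M {x} {z} ws \<longrightarrow> length ws \<le> R) \<and>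
      (\<forall>ws. chain M {z} {y} ws \<longrightarrow> ws \<noteq> [] \<longrightarrow> (\<exists>vs. chain M {x} {y} vs \<and> length vs + 1 = R + length ws))"
    by (rule intermediate_point) (rule that)
  \<comment> \<open>Above the thresholds for the length bound, for intermediate points and for
    crossing walls.\<close>
  define M where "M = max (max M1 M2) (5 * E + 1)"
  have M: "M1 \<le> M" "M2 \<le> M" "5 * E < M" unfolding M_def by auto
  have M0: "0 < M" using K M by linarith
  let ?n = "longest_chain M"
  have fin: "finite {length ws | ws. chain M {x} {y} ws}" if "x \<in> X" "y \<in> X" for x y
  proof (rule finite_subset)
    show "{length ws | ws. chain M {x} {y} ws} \<subseteq> {..nat \<lceil>K * d x y + C\<rceil>}"
    proof
      fix l assume "l \<in> {length ws | ws. chain M {x} {y} ws}"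
      then obtain ws where "chain M {x} {y} ws" "l = length ws" by blast
      then have "real l \<le> K * d x y + C" using bound[OF M(1) that] by blast
      then show "l \<in> {..nat \<lceil>K * d x y + C\<rceil>}" unfolding atMost_iff by linarith
    qed
  qed simp
  have le: "length ws \<le> ?n x y" if "chain M {x} {y} ws" "x \<in> X" "y \<in> X" for x y ws
    unfolding longest_chain_def by (rule Max_ge[OF fin]) (use that in auto)
  have ex: "\<exists>ws. chain M {x} {y} ws \<and> length ws = ?n x y" if "x \<in> X" "y \<in> X" for x y
  proof -
    have "?n x y \<in> {length ws | ws. chain M {x} {y} ws}"
      unfolding longest_chain_def by (rule Max_in[OF fin[OF that]]) (use chain_Nil in blast)
    then show ?thesis by force
  qed
  have "coarse_chain_space X d ?n (nat \<lfloor>E\<rfloor> + 1)"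
  proof (unfold_locales)
    fix x y z assume xyz: "x \<in> X" "y \<in> X" "z \<in> X"
    obtain ws where ws: "chain M {x} {z} ws" "length ws = ?n x z" using ex xyz by blast
    obtain ws1 ws2 where "chain M {x} {y} ws1" "chain M {y} {z} ws2" "length ws \<le> length ws1 + length ws2 + 1"
      by (rule chain_triangle[OF ws(1) xyz(2)]) (rule that)
    then show "?n x z \<le> ?n x y + ?n y z + 1" using le[of x y ws1] le[of y z ws2] xyz ws(2) by simp
  next
    fix x assume x: "x \<in> X"
    obtain ws where ws: "chain M {x} {x} ws" "length ws = ?n x x" using ex x by blast
    have "ws = []" by (rule chain_empty_if_close[OF ws(1)]) (use x M0 in auto)
    then show "?n x x = 0" using ws by simp
  next
    have "?n x y \<le> ?n y x" if xy: "x \<in> X" "y \<in> X" for x y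
    proof -
      obtain ws where ws: "chain M {x} {y} ws" "length ws = ?n x y" using ex xy by blast
      show ?thesis using le[OF chain_rev[OF ws(1)] xy(2,1)] ws(2) by simp
    qed
    then show "x \<in> X \<Longrightarrow> y \<in> X \<Longrightarrow> ?n x y = ?n y x" for x y by (simp add: antisym)
  next
    fix x y and R :: nat assume xy: "x \<in> X" "y \<in> X" and R: "1 \<le> R" "R \<le> ?n x y"
    obtain z where z: "z \<in> X" "\<forall>ws. chain M {x} {z} ws \<longrightarrow> length ws \<le> R"
      "\<forall>ws. chain M {z} {y} ws \<longrightarrow> ws \<noteq> [] \<longrightarrow> (\<exists>vs. chain M {x} {y} vs \<and> length vs + 1 = R + length ws)"
      using inter[OF M(2) R(1) xy] by blast
    have "?n x z \<le> R" using ex[OF xy(1) z(1)] z(2) by metis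
    moreover have "?n z y + R \<le> ?n x y + 1"
    proof -
      obtain ws where ws: "chain M {z} {y} ws" "length ws = ?n z y" using ex[OF z(1) xy(2)] by blast
      show ?thesis
      proof (cases "ws = []")
        case True
        then show ?thesis using ws R by simp
      next
        case False
        then obtain vs where "chain M {x} {y} vs" "length vs + 1 = R + length ws" using z(3) ws by blast
        then show ?thesis using le[of x y vs] xy ws by simp
      qed
    qed
    ultimately show "\<exists>z\<in>X. ?n x z \<le> R \<and> ?n z y + R \<le> ?n x y + 1" using z(1) by blast
  next
    have "real (?n x y) \<le> K * d x y + C" if "x \<in> X" "y \<in> X" for x y
      using ex[OF that] bound[OF M(1) that] by metis
    then show "\<exists>K C. 0 \<le> K \<and> 0 \<le> C \<and> (\<forall>x\<in>X. \<forall>y\<in>X. real (?n x y) \<le> K * d x y + C)"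
      using K by blast
  next
    fix R :: nat
    \<comment> \<open>A domain in which \<open>x\<close> and \<open>y\<close> are this far apart
      carries a chain of \<open>R + 1\<close> walls by \<open>exists_chain\<close>.\<close>
    define \<kappa> where "\<kappa> = 20 * E + real (R + 1) * (M + 36 * E)"
    have "0 \<le> \<kappa>" unfolding \<kappa>_def using E_ge_1 M0 by simp
    then obtain \<theta> where \<theta>: "\<forall>x\<in>X. \<forall>y\<in>X. \<theta> \<le> d x y \<longrightarrow> (\<exists>V\<in>\<SS>. \<kappa> \<le> dp V x y)"
      using uniqueness by blast
    have "d x y \<le> \<theta>" if xy: "x \<in> X" "y \<in> X" and n: "?n x y \<le> R" for x y
    proof (rule ccontr)
      assume "\<not> ?thesis"
      then obtain V where V: "V \<in> \<SS>" "\<kappa> \<le> dp V x y" using \<theta> xy by force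
      obtain ws where "chain M {x} {y} ws" "length ws = R + 1"
        by (rule exists_chain[OF V(1) xy M0, of "R + 1"]) (use V(2) in \<open>auto simp: \<kappa>_def\<close>)
      then show False using le[of x y ws] xy n by simp
    qed
    then show "\<exists>\<theta>. \<forall>x\<in>X. \<forall>y\<in>X. ?n x y \<le> R \<longrightarrow> d x y \<le> \<theta>" by blast
  next
    show "0 < nat \<lfloor>E\<rfloor> + 1" by simp
  next
    fix p q :: "nat \<Rightarrow> 'a" and k :: "nat \<Rightarrow> nat" and low high
    assume pq: "\<And>i. i < nat \<lfloor>E\<rfloor> + 1 \<Longrightarrow> p i \<in> X \<and> q i \<in> X \<and> k i < ?n (p i) (q i)"
      and low: "low = (\<lambda>i s. ?n (p i) s < k i)" and high: "high = (\<lambda>i s. ?n s (q i) + k i + 1 < ?n (p i) (q i))"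
      and cross: "\<And>i j. i < j \<Longrightarrow> j < nat \<lfloor>E\<rfloor> + 1 \<Longrightarrow>
        (\<exists>s\<in>X. low i s \<and> low j s) \<and> (\<exists>s\<in>X. low i s \<and> high j s) \<and>
        (\<exists>s\<in>X. high i s \<and> low j s) \<and> (\<exists>s\<in>X. high i s \<and> high j s)"
    define N where "N = nat \<lfloor>E\<rfloor> + 1"
    note pq = pq[folded N_def] and cross = cross[folded N_def]
    \<comment> \<open>Wall number \<open>k i\<close> of a longest chain works. If \<open>s\<close>
      missed its first side, the \<open>k i\<close> walls before it would separate
      \<open>p i\<close> from \<open>s\<close>; if \<open>s\<close> missed its second side, all
      walls after it would separate \<open>s\<close> from \<open>q i\<close>. The 1 in
      \<open>high\<close> accounts for the wall itself.\<close>
    have "\<exists>w U. wall_in M U w \<and> (\<forall>s\<in>X. low i s \<longrightarrow> s \<in> fst w) \<and> (\<forall>s\<in>X. high i s \<longrightarrow> s \<in> snd w)" if i: "i < N" for i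
    proof -
      obtain ws where ws: "chain M {p i} {q i} ws" "length ws = ?n (p i) (q i)" using ex pq[OF i] by blast
      have k: "k i < length ws" using ws pq[OF i] by simp
      then obtain U where U: "wall_in M U (ws ! k i)" using ws(1) unfolding chain_def by (meson nth_mem)
      have "s \<in> fst (ws ! k i)" if s: "s \<in> X" "low i s" for s
      proof (rule ccontr)
        assume "\<not> ?thesis"
        then have "chain M {p i} {s} (take (k i) ws)" by (rule chain_before[OF ws(1) k s(1)])
        then show False using le[of "p i" s "take (k i) ws"] pq[OF i] s k unfolding low by simp
      qed
      moreover have "s \<in> snd (ws ! k i)" if s: "s \<in> X" "high i s" for s
      proof (rule ccontr)
        assume "\<not> ?thesis"
        then have "chain M {s} {q i} (drop (Suc (k i)) ws)" by (rule chain_after[OF ws(1) k s(1)])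
        then show False using le[of s "q i" "drop (Suc (k i)) ws"] pq[OF i] s ws(2) unfolding high by simp
      qed
      ultimately show ?thesis using U by blast
    qed
    then obtain w U where w: "\<And>i. i < N \<Longrightarrow> wall_in M (U i) (w i)"
      "\<And>i s. i < N \<Longrightarrow> s \<in> X \<Longrightarrow> low i s \<Longrightarrow> s \<in> fst (w i)"
      "\<And>i s. i < N \<Longrightarrow> s \<in> X \<Longrightarrow> high i s \<Longrightarrow> s \<in> snd (w i)"
      by metis
    have U: "U i \<in> \<SS>" if "i < N" for i using w(1)[OF that] unfolding wall_in_def by blast
    have orth: "U i \<perp> U j \<and> U i \<noteq> U j" if ij: "i < j" "j < N" for i j
    proof -
      have i: "i < N" using ij by simp
      obtain s1 s2 s3 s4 where s: "s1 \<in> X" "low i s1" "low j s1" "s2 \<in> X" "low i s2" "high j s2"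
        "s3 \<in> X" "high i s3" "low j s3" "s4 \<in> X" "high i s4" "high j s4" using cross[OF ij] by blast
      show ?thesis
        using crossing_walls_orthogonal[OF w(1)[OF i] w(1)[OF ij(2)] M(3), of s1 s2 s3 s4]
          w(2,3) i ij(2) s by blast
    qed
    have orth': "U i \<perp> U j \<and> U i \<noteq> U j" if "i < N" "j < N" "i \<noteq> j" for i j
      using that orth[of i j] orth[of j i] orth_symD[OF U U, of j i] by (metis nat_neq_iff)
    have "inj_on U {..<N}" using orth' by (auto simp: inj_on_def)
    then have "card (U ` {..<N}) = N" by (simp add: card_image)
    moreover have "real (card (U ` {..<N})) \<le> E"
      by (rule orthogonal_card) (use U orth' in \<open>auto simp: pairwise_def\<close>)
    ultimately show False unfolding N_def by linarith
  qed
  then show thesis by (rule that)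
qed

theorem exists_strongly_shortcut_metric:
  "\<exists>\<sigma>. Metric_space X \<sigma> \<and> roughly_geodesic X \<sigma> \<and> quasi_isometric X \<sigma> X d \<and> strongly_shortcut X \<sigma>"
proof -
  obtain M where "coarse_chain_space X d (longest_chain M) (nat \<lfloor>E\<rfloor> + 1)"
    by (rule chain_space) (rule that)
  then show ?thesis by (rule coarse_chain_space.exists_strongly_shortcut_metric)
qed

end

theorem corollaryD:
  fixes X :: "'a set" and d :: "'a \<Rightarrow> 'a \<Rightarrow> real"
    and E :: real and \<SS> :: "'u set"
    and \<C> :: "'u \<Rightarrow> 'c set" and dC :: "'u \<Rightarrow> 'c \<Rightarrow> 'c \<Rightarrow> real"
    and \<pi> :: "'u \<Rightarrow> 'a \<Rightarrow> 'c"
    and nest orth :: "'u \<Rightarrow> 'u \<Rightarrow> bool"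
    and \<rho> :: "'u \<Rightarrow> 'u \<Rightarrow> 'c set" and \<rho>m :: "'u \<Rightarrow> 'u \<Rightarrow> 'c \<Rightarrow> 'c"
  assumes "hierarchically_hyperbolic_space X d E \<SS> \<C> dC \<pi> nest orth \<rho> \<rho>m"
  shows "\<exists>\<sigma>. Metric_space X \<sigma> \<and> roughly_geodesic X \<sigma> \<and>
             quasi_isometric X \<sigma> X d \<and> strongly_shortcut X \<sigma>"
  by (rule hierarchically_hyperbolic_space.exists_strongly_shortcut_metric[OF assms])

end
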